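(* Let $d\ge2$, let $D=\{0,\dots,d\}$, let $\mathcal T$ be the $(d+1)$-regular rooted tree with a fixed legal edge colouring by $D$, and let $F\le\operatorname{Sym}(D)$ be any subgroup. Then the group $V_F$ is finitely generated and dense in $\mathcal N_F=\mathcal F(U(F))$.
   Context: Tree and colouring: $\mathcal T=(\mathcal V,\mathcal E)$ is the $(d+1)$-regular tree with root $v_0$; edges are directed, with origin $o(e)$, terminus $t(e)$ and inverse $\bar e$. A legal edge colouring is a map $\operatorname{col}:\mathcal E\to D$ with $\operatorname{col}(e)=\operatorname{col}(\bar e)$ and such that for each vertex $v$ the restriction of $\operatorname{col}$ to $o^{-1}(v)$ is a bijection onto $D$. For $g\in\operatorname{Aut}(\mathcal T)$, $\operatorname{prm}_{g,v}(\chi)=\operatorname{col}\big(g((\operatorname{col}|_{o^{-1}(v)})^{-1}(\chi))\big)$, and $U(F)=\{g\in\operatorname{Aut}(\mathcal T)\mid\operatorname{prm}_{g,v}\in F\ \forall v\in\mathcal V\}$. $\operatorname{Aut}(\mathcal T)$ has the topology with neighbourhood basis of the identity the pointwise fixators of finite sets of vertices and edges; $U(F)$ has the subspace topology. Almost automorphisms: the children of a vertex $v$ are its neighbours farther from $v_0$, and $\mathcal T_v$ is the subtree of all $w$ such that $v$ lies on the geodesic from $v_0$ to $w$. A finite subtree $T$ is complete if it contains $v_0$ and, for every vertex of $T$ that is not a leaf, all its children lie in $T$; a leaf of $T$ is a vertex with no child in $T$, and $\mathcal LT$ is the set of leaves. Put $\mathcal T\setminus T:=\bigsqcup_{v\in\mathcal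 LT}\mathcal T_v$. An honest almost automorphism is a forest isomorphism $\varphi:\mathcal T\setminus T_1\to\mathcal T\setminus T_2$ with $T_1,T_2$ finite complete; two of them with domains $\mathcal T\setminus T_1,\mathcal T\setminus T_1'$ are equivalent if they agree on $\mathcal T\setminus T$ for some finite complete $T\supset T_1\cup T_1'$. Classes form a group $\operatorname{AAut}(\mathcal T)$ under composition of suitable representatives, containing $\operatorname{Aut}(\mathcal T)$. $\varphi$ is $U(F)$-honest if for every $v\in\mathcal LT_1$ there is $g_v\in U(F)$ with $\varphi|_{\mathcal T_v}=g_v|_{\mathcal T_v}$; $\mathcal N_F=\mathcal F(U(F))$ is the subgroup of classes of $U(F)$-honest almost automorphisms, with the unique group topology for which the inclusion $U(F)\hookrightarrow\mathcal N_F$ is continuous and open. The group $V_F$: let $D^{(0)},\dots,D^{(l)}$ be the $F$-orbits in $D$. For $v\ne v_0$ let $e_v$ be the parent edge of $v$ (joining $v$ to its parent), and let $\ell_F(v)$ be the $F$-orbit of $\operatorname{col}(e_v)$. Choose reference colours $\chi^{(i)}\in D^{(i)}$, and for each $\chi\in D^{(i)}$ an element $f_\chi\in F$ with $f_\chi(\chi)=\chi^{(i)}$, where $f_{\chi^{(i)}}=\mathrm{id}$. Order the children of $v_0$ by the colour of their parent edge; for $v\ne v_0$ with $\operatorname{col}(e_v)=\chi$ order the children of $v$ by $v_1<_vv_2$ iff $f_\chi(\operatorname{col}(e_{v_1}))<f_\chi(\operatorname{col}(e_{v_2}))$. An honest almost automorphism $\varphi:\mathcal T\setminus T_1\to\mathcal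 T\setminus T_2$ is label-preserving if it maps the children of every vertex $v$ of $\mathcal T\setminus T_1$ order-preservingly to the children of $\varphi(v)$ and $\ell_F(v)=\ell_F(\varphi(v))$ for all $v\in\mathcal LT_1$ (the latter being void if $T_1=T_2=\{v_0\}$). $V_F\le\mathcal N_F$ is the subgroup of all almost automorphisms having a label-preserving representative. *)

theory Defs
  imports
    "HOL-Analysis.Abstract_Topology"
    "HOL-Analysis.Product_Topology"
    "Graph_Theory.Digraph_Component"
    "HOL-Algebra.Bij"
    "HOL-Algebra.Generated_Groups"
begin

section \<open>Groups\<close>

definition finitely_generated_subgroup :: "'a set \<Rightarrow> ('a, 'b) monoid_scheme \<Rightarrow> bool" where
  "finitely_generated_subgroup H N \<longleftrightarrow>
     subgroup H N \<and> (\<exists>S. finite S \<and> S \<subseteq> H \<and> generate N S = H)"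

definition group_topology :: "('a, 'b) monoid_scheme \<Rightarrow> 'a topology \<Rightarrow> bool" where
  "group_topology N \<tau> \<longleftrightarrow>
     topspace \<tau> = carrier N \<and>
     continuous_map (prod_topology \<tau> \<tau>) \<tau> (\<lambda>(x, y). x \<otimes>\<^bsub>N\<^esub> y) \<and>
     continuous_map \<tau> \<tau> (\<lambda>x. inv\<^bsub>N\<^esub> x)"

section \<open>Permutations of the colours\<close>

text \<open>
  Colours are the elements of \<open>D = {0..d}\<close>, and \<open>Sym(D)\<close> is \<open>BijGroup {0..d}\<close>, whose elements
  are extensional: they take the value \<open>undefined\<close> outside \<open>D\<close>.
\<close>

definition colour_orbit :: "(nat \<Rightarrow> nat) set \<Rightarrow> nat \<Rightarrow> nat set" where
  "colour_orbit F \<chi> = {p \<chi> | p. p \<in> F}"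

text \<open>
  A choice of a reference colour \<open>ref O\<close> in every orbit \<open>O\<close>, together with the elements \<open>f \<chi>\<close>
  of \<open>F\<close> that move \<open>\<chi>\<close> to the reference colour of its orbit.
\<close>

definition reference_choice ::
  "nat \<Rightarrow> (nat \<Rightarrow> nat) set \<Rightarrow> (nat set \<Rightarrow> nat) \<Rightarrow> (nat \<Rightarrow> nat \<Rightarrow> nat) \<Rightarrow> bool" where
  "reference_choice d F ref f \<longleftrightarrow>
     (\<forall>\<chi>\<in>{0..d}.
        ref (colour_orbit F \<chi>) \<in> colour_orbit F \<chi> \<and>
        f \<chi> \<in> F \<and>
        f \<chi> \<chi> = ref (colour_orbit F \<chi>) \<and>
        f (ref (colour_orbit F \<chi>)) = (\<lambda>x\<in>{0..d}. x))"

section \<open>The coloured regular tree\<close>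

text \<open>
  A tree has neither loops nor multiple edges, so a directed edge is the pair of its origin and
  its terminus, and the inverse edge is the swapped pair.  In a symmetric digraph, going along an
  edge and back again is a \<open>cycle\<close> in the sense of the library; \<open>acyclic\<close> says that there are no
  others.  The parameter \<open>v0\<close> is the root.
\<close>

locale coloured_regular_tree = pair_sym_digraph G
  for G :: "'v pair_pre_digraph" +
  fixes v0 :: 'v and d :: nat and col :: "'v \<times> 'v \<Rightarrow> nat"
  assumes root: "v0 \<in> pverts G"
    and connected: "connected (with_proj G)"
    and acyclic: "\<And>p. cycle p \<Longrightarrow> \<exists>u v. p = [(u, v), (v, u)]"
    and regular: "\<And>v. v \<in> pverts G \<Longrightarrow> out_degree (with_proj G) v = d + 1"
    and col_inverse: "\<And>u v. (u, v) \<in> parcs G \<Longrightarrow> col (v, u) = col (u, v)"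
    and col_legal: "\<And>v. v \<in> pverts G \<Longrightarrow> bij_betw col (out_arcs (with_proj G) v) {0..d}"
begin

subsection \<open>Automorphisms\<close>

definition Aut :: "('v \<Rightarrow> 'v) set" where
  "Aut = {g \<in> Bij (pverts G).
            \<forall>u\<in>pverts G. \<forall>v\<in>pverts G. (g u, g v) \<in> parcs G \<longleftrightarrow> (u, v) \<in> parcs G}"

definition prm :: "('v \<Rightarrow> 'v) \<Rightarrow> 'v \<Rightarrow> nat \<Rightarrow> nat" where
  "prm g v = (\<lambda>\<chi>\<in>{0..d}. col (map_prod g g (inv_into (out_arcs (with_proj G) v) col \<chi>)))"

definition U :: "(nat \<Rightarrow> nat) set \<Rightarrow> ('v \<Rightarrow> 'v) set" where
  "U F = {g \<in> Aut. \<forall>v\<in>pverts G. prm g v \<in> F}"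

definition fixator :: "'v set \<Rightarrow> ('v \<times> 'v) set \<Rightarrow> ('v \<Rightarrow> 'v) set" where
  "fixator A B = {g \<in> Aut. (\<forall>v\<in>A. g v = v) \<and> (\<forall>e\<in>B. map_prod g g e = e)}"

text \<open>
  The fixators of finite sets form a neighbourhood basis of the identity; their left translates
  generate the topology.
\<close>

definition Aut_topology :: "('v \<Rightarrow> 'v) topology" where
  "Aut_topology = topology_generated_by
     {(\<lambda>k. compose (pverts G) g k) ` fixator A B | g A B.
        g \<in> Aut \<and> finite A \<and> A \<subseteq> pverts G \<and> finite B \<and> B \<subseteq> parcs G}"

definition U_topology :: "(nat \<Rightarrow> nat) set \<Rightarrow> ('v \<Rightarrow> 'v) topology" where
  "U_topology F = subtopology Aut_topology (U F)"

subsection \<open>Rooted structure and complete subtrees\<close>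

definition tree_dist :: "'v \<Rightarrow> 'v \<Rightarrow> nat" where
  "tree_dist u v = (LEAST n. \<exists>p. awalk u p v \<and> length p = n)"

definition children :: "'v \<Rightarrow> 'v set" where
  "children v = {w. (v, w) \<in> parcs G \<and> tree_dist v0 v < tree_dist v0 w}"

definition parent :: "'v \<Rightarrow> 'v" where
  "parent v = (THE u. v \<in> children u)"

definition subtree :: "'v \<Rightarrow> 'v set" where
  "subtree v = {w. \<exists>p. awalk v0 p w \<and> length p = tree_dist v0 w \<and> v \<in> set (pawalk_verts v0 p)}"

text \<open>A subtree is determined by its set of vertices.\<close>

definition complete_subtree :: "'v set \<Rightarrow> bool" where
  "complete_subtree T \<longleftrightarrow>
     finite T \<and> T \<subseteq> pverts G \<and> connected (with_proj G \<restriction> T) \<and> v0 \<in> T \<and>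
     (\<forall>v\<in>T. children v \<inter> T \<noteq> {} \<longrightarrow> children v \<subseteq> T)"

definition leaves :: "'v set \<Rightarrow> 'v set" where
  "leaves T = {v \<in> T. children v \<inter> T = {}}"

text \<open>
  Vertices and edges of the forest obtained by removing \<open>T\<close>, the disjoint union of the trees
  below the leaves of \<open>T\<close>.
\<close>

definition forest_verts :: "'v set \<Rightarrow> 'v set" where
  "forest_verts T = (\<Union>l\<in>leaves T. subtree l)"

definition forest_arcs :: "'v set \<Rightarrow> ('v \<times> 'v) set" where
  "forest_arcs T = (\<Union>l\<in>leaves T. {(u, w) \<in> parcs G. u \<in> subtree l \<and> w \<in> subtree l})"

subsection \<open>Almost automorphisms\<close>

text \<open>
  An honest almost automorphism is a partial function on the vertices, defined exactly on the
  vertices of its domain forest.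
\<close>

definition honest :: "'v set \<Rightarrow> 'v set \<Rightarrow> ('v \<rightharpoonup> 'v) \<Rightarrow> bool" where
  "honest T1 T2 \<phi> \<longleftrightarrow>
     complete_subtree T1 \<and> complete_subtree T2 \<and>
     dom \<phi> = forest_verts T1 \<and> ran \<phi> = forest_verts T2 \<and> inj_on \<phi> (dom \<phi>) \<and>
     (\<forall>u\<in>dom \<phi>. \<forall>w\<in>dom \<phi>.
        (u, w) \<in> forest_arcs T1 \<longleftrightarrow> (the (\<phi> u), the (\<phi> w)) \<in> forest_arcs T2)"

definition honest_equiv :: "(('v \<rightharpoonup> 'v) \<times> ('v \<rightharpoonup> 'v)) set" where
  "honest_equiv =
     {(\<phi>, \<psi>). \<exists>T1 T2 T1' T2' T. honest T1 T2 \<phi> \<and> honest T1' T2' \<psi> \<and>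
        complete_subtree T \<and> T1 \<union> T1' \<subseteq> T \<and> (\<forall>v\<in>forest_verts T. \<phi> v = \<psi> v)}"

definition embed :: "('v \<Rightarrow> 'v) \<Rightarrow> ('v \<rightharpoonup> 'v) set" where
  "embed g = honest_equiv `` {(\<lambda>v. if v \<in> pverts G then Some (g v) else None)}"

text \<open>
  Two classes are multiplied by composing representatives \<open>\<phi>\<close>, \<open>\<psi>\<close> for which the range forest of
  \<open>\<psi>\<close> is the domain forest of \<open>\<phi>\<close>.
\<close>

definition AAut :: "('v \<rightharpoonup> 'v) set monoid" where
  "AAut =
     \<lparr>carrier = {\<phi>. \<exists>T1 T2. honest T1 T2 \<phi>} // honest_equiv,
      mult = (\<lambda>X Y. {\<theta>. \<exists>\<phi>\<in>X. \<exists>\<psi>\<in>Y. dom \<phi> = ran \<psi> \<and> (\<phi> \<circ>\<^sub>m \<psi>, \<theta>) \<in> honest_equiv}),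
      one = embed (\<lambda>v\<in>pverts G. v)\<rparr>"

definition U_honest :: "(nat \<Rightarrow> nat) set \<Rightarrow> ('v \<rightharpoonup> 'v) \<Rightarrow> bool" where
  "U_honest F \<phi> \<longleftrightarrow>
     (\<exists>T1 T2. honest T1 T2 \<phi> \<and> (\<forall>v\<in>leaves T1. \<exists>g\<in>U F. \<forall>w\<in>subtree v. \<phi> w = Some (g w)))"

definition N :: "(nat \<Rightarrow> nat) set \<Rightarrow> ('v \<rightharpoonup> 'v) set monoid" where
  "N F = AAut\<lparr>carrier := {X \<in> carrier AAut. \<exists>\<phi>\<in>X. U_honest F \<phi>}\<rparr>"

text \<open>
  The property that determines the topology of \<open>N F\<close>: a group topology for which the inclusion
  of \<open>U F\<close> is continuous and open.
\<close>

definition is_N_topology :: "(nat \<Rightarrow> nat) set \<Rightarrow> ('v \<rightharpoonup> 'v) set topology \<Rightarrow> bool" where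
  "is_N_topology F \<tau> \<longleftrightarrow>
     group_topology (N F) \<tau> \<and>
     continuous_map (U_topology F) \<tau> embed \<and> open_map (U_topology F) \<tau> embed"

subsection \<open>The group of label-preserving almost automorphisms\<close>

definition label :: "(nat \<Rightarrow> nat) set \<Rightarrow> 'v \<Rightarrow> nat set" where
  "label F v = colour_orbit F (col (v, parent v))"

definition child_less :: "(nat \<Rightarrow> nat \<Rightarrow> nat) \<Rightarrow> 'v \<Rightarrow> 'v \<Rightarrow> 'v \<Rightarrow> bool" where
  "child_less f v w1 w2 \<longleftrightarrow>
     (if v = v0 then col (w1, parent w1) < col (w2, parent w2)
      else f (col (v, parent v)) (col (w1, parent w1))
         < f (col (v, parent v)) (col (w2, parent w2)))"

text \<open>
  The root has no label, so the condition on labels is dropped when both trees are \<open>{v0}\<close>.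
  (If one of them is \<open>{v0}\<close>, so is the other, by counting components.)
\<close>

definition label_preserving ::
  "(nat \<Rightarrow> nat) set \<Rightarrow> (nat \<Rightarrow> nat \<Rightarrow> nat) \<Rightarrow> ('v \<rightharpoonup> 'v) \<Rightarrow> bool" where
  "label_preserving F f \<phi> \<longleftrightarrow>
     (\<exists>T1 T2. honest T1 T2 \<phi> \<and>
        (\<forall>v\<in>forest_verts T1.
           (\<lambda>w. the (\<phi> w)) ` children v = children (the (\<phi> v)) \<and>
           (\<forall>w1\<in>children v. \<forall>w2\<in>children v.
              child_less f v w1 w2 \<longrightarrow> child_less f (the (\<phi> v)) (the (\<phi> w1)) (the (\<phi> w2)))) \<and>
        (T1 = {v0} \<and> T2 = {v0} \<or> (\<forall>v\<in>leaves T1. label F v = label F (the (\<phi> v)))))"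

definition V :: "(nat \<Rightarrow> nat) set \<Rightarrow> (nat \<Rightarrow> nat \<Rightarrow> nat) \<Rightarrow> ('v \<rightharpoonup> 'v) set set" where
  "V F f = {X \<in> carrier AAut. \<exists>\<phi>\<in>X. label_preserving F f \<phi>}"

end

end

theory Submission
  imports Defs "HOL-Library.Sublist"
begin

text \<open>
  Almost automorphisms are handled as total maps on the vertices modulo finitely many values; the
  subgroups \<open>N F\<close> and \<open>V F f\<close> then consist of the classes of maps that satisfy a local condition at
  almost all vertices.

  Finite generation.  An element of \<open>V F f\<close> replaces prefixes of words by prefixes of the same type.
  Counting leaves by type shows that the two finite trees of such an element have the same number
  of interior vertices of each type, so the first is turned into the second by exchanging pairs
  of disjoint isomorphic subtrees, and a permutation of leaves remains; hence the exchanges generate.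
  As the root has at least three children, every exchange is conjugate, by an exchange of two
  subtrees near the root, to one that is closer to the root, and finitely many exchanges suffice.

  Density.  An element \<open>g\<close> of \<open>N F\<close> maps every leaf \<open>v\<close> of a large finite tree to a vertex with the
  same label, so it may be compared with the canonical isomorphism below \<open>v\<close>; the two differ by an
  element of \<open>U F\<close> that fixes the finite tree, hence is close to the identity.
\<close>

section \<open>The rooted tree\<close>

text \<open>A label-preserving map is defined through trees and orders on siblings, both of which
  vary with the representative and the vertex. The orders disappear by normalisation:
  \<open>f \<chi>\<close> sends the colour of the parent edge to the reference colour of its orbit,
  so the children of all non-root vertices with one label carry the same set of normalised colours.
  An increasing bijection of such a set is the identity. Hence the label-preserving maps are, up to
  finitely many vertices, the maps that keep labels and the normalised colours of children.

  The same normalisation links V_F to N_F: if \<chi> and \<chi>' are the colours of the parent edges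
  of a vertex and of its image, the local permutation of such a map is \<open>f \<chi>\<close>
  followed by the inverse of \<open>f \<chi>'\<close>. It belongs to F, and it is right on the
  parent edge as well, because both parent colours are normalised to the reference colour of their
  common orbit. Solving this relation for the unknown map gives the correction in the density
  argument.

  A finite tree with n interior vertices has (d-1)n + 2 leaves; as d is at least 2, the leaves
  determine n, and this starts the comparison of the two trees label by label.\<close>

locale branching_tree = coloured_regular_tree G v0 d col
  for G :: "'v pair_pre_digraph" and v0 :: 'v and d :: nat and col :: "'v \<times> 'v \<Rightarrow> nat" +
  assumes d_ge_2: "d \<ge> 2"
begin

lemmas root_vert = root \<comment> \<open>an alias, since the case names of \<open>tree_induct\<close> hide \<open>root\<close>\<close>

definition nbrs :: "'v \<Rightarrow> 'v set" where
  "nbrs v = {w. (v, w) \<in> parcs G}"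

lemma nb_verts: "w \<in> nbrs v \<Longrightarrow> w \<in> pverts G" "w \<in> nbrs v \<Longrightarrow> v \<in> pverts G"
  by (auto simp: nbrs_def dest: in_arcsD1 in_arcsD2)

lemma nb_sym: "w \<in> nbrs v \<Longrightarrow> v \<in> nbrs w"
  by (auto simp: nbrs_def intro: arcs_symmetric)

lemma out_arcs_nb: "out_arcs (with_proj G) v = Pair v ` nbrs v"
  by (auto simp: nbrs_def out_arcs_def)

lemma card_nb: "v \<in> pverts G \<Longrightarrow> card (nbrs v) = d + 1"
  using regular[of v] by (simp add: out_degree_def out_arcs_nb card_image inj_on_def)

lemma finite_nb: "finite (nbrs v)"
proof (cases "v \<in> pverts G")
  case True
  then show ?thesis using card_nb[of v] by (metis Suc_eq_plus1 card.infinite nat.distinct(1))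
next
  case False
  then have "nbrs v = {}" using nb_verts(2) by blast
  then show ?thesis by simp
qed

lemma col_bij: "v \<in> pverts G \<Longrightarrow> bij_betw (\<lambda>w. col (v, w)) (nbrs v) {0..d}"
  using col_legal[of v] unfolding out_arcs_nb
  by (simp add: bij_betw_def inj_on_def image_image)

lemma col_inj: "w \<in> nbrs v \<Longrightarrow> w' \<in> nbrs v \<Longrightarrow> col (v, w) = col (v, w') \<Longrightarrow> w = w'"
  using col_bij[of v] nb_verts(2) by (meson bij_betw_imp_inj_on inj_onD)

lemma col_range: "w \<in> nbrs v \<Longrightarrow> col (v, w) \<in> {0..d}"
  using col_bij[of v] nb_verts(2) by (meson bij_betwE)

lemma col_ex: "v \<in> pverts G \<Longrightarrow> c \<in> {0..d} \<Longrightarrow> \<exists>w\<in>nbrs v. col (v, w) = c"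
  using col_bij[of v] unfolding bij_betw_def by (metis imageE)

lemma col_sym: "w \<in> nbrs v \<Longrightarrow> col (w, v) = col (v, w)"
  using col_inverse by (auto simp: nbrs_def)

section \<open>Depth, parents and children\<close>

abbreviation depth :: "'v \<Rightarrow> nat" where
  "depth v \<equiv> tree_dist v0 v"

lemma walk_ex: "v \<in> pverts G \<Longrightarrow> \<exists>p. awalk v0 p v"
proof -
  assume v: "v \<in> pverts G"
  have "parcs (mk_symmetric (with_proj G)) = parcs G"
    by (auto simp: mk_symmetric_def intro: arcs_symmetric)
  then have "mk_symmetric (with_proj G) = G"
    by (simp add: mk_symmetric_def)
  then have "strongly_connected (with_proj G)"
    using connected by (simp add: connected_def)
  then have "v0 \<rightarrow>\<^sup>*\<^bsub>with_proj G\<^esub> v"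
    using v root by (auto simp: strongly_connected_def)
  then show ?thesis by (simp add: reachable_awalk)
qed

lemma depth_walk: "v \<in> pverts G \<Longrightarrow> \<exists>p. awalk v0 p v \<and> length p = depth v"
proof -
  assume "v \<in> pverts G"
  then have "\<exists>n. \<exists>p. awalk v0 p v \<and> length p = n" using walk_ex by blast
  then show ?thesis unfolding tree_dist_def by (rule LeastI_ex)
qed

lemma depth_le: "awalk v0 p v \<Longrightarrow> depth v \<le> length p"
  unfolding tree_dist_def by (rule Least_le) blast

lemma depth_root [simp]: "depth v0 = 0"
  using depth_le[of "[]" v0] root by (simp add: awalk_Nil_iff)

lemma depth_0: "v \<in> pverts G \<Longrightarrow> depth v = 0 \<Longrightarrow> v = v0"
  using depth_walk[of v] by (auto simp: awalk_Nil_iff)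

lemma awalk_snoc: "awalk u p v \<Longrightarrow> w \<in> nbrs v \<Longrightarrow> awalk u (p @ [(v, w)]) w"
  by (rule awalk_appendI) (auto simp: awalk_Cons_iff awalk_Nil_iff nbrs_def dest: in_arcsD1 in_arcsD2)

lemma depth_nb: "w \<in> nbrs v \<Longrightarrow> depth w \<le> depth v + 1"
proof -
  assume w: "w \<in> nbrs v"
  obtain p where p: "awalk v0 p v" "length p = depth v" using depth_walk nb_verts(2)[OF w] by blast
  show ?thesis using depth_le[OF awalk_snoc[OF p(1) w]] p(2) by simp
qed

text \<open>Cut the walk down to a path and close it with the edge from \<open>v\<close> to
  \<open>w\<close>. The result is a library cycle, which can only run along an edge and back, so the
  path is the edge from \<open>w\<close> to \<open>v\<close>.\<close>

lemma no_bypass: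
  assumes "w \<in> nbrs v" "awalk w p v"
  shows "(v, w) \<in> set p \<or> (w, v) \<in> set p"
proof -
  let ?q = "awalk_to_apath p"
  have q: "apath w ?q v" using assms(2) by (rule apath_awalk_to_apath)
  have "cycle ((v, w) # ?q)"
    unfolding cycle_def using q assms(1) by (intro exI[of _ v]) (auto simp: apath_def awalk_Cons_iff nbrs_def)
  then obtain a b where "(v, w) # ?q = [(a, b), (b, a)]" using acyclic by blast
  then have "(w, v) \<in> set ?q" by simp
  then show ?thesis using awalk_to_apath_subset[OF assms(2)] by blast
qed

lemma no_loop: "v \<notin> nbrs v"
proof
  assume "v \<in> nbrs v"
  then show False using no_bypass[of v v "[]"] nb_verts[of v v] by (auto simp: awalk_Nil_iff)
qed

lemma lower_ex:
  assumes "v \<in> pverts G" "v \<noteq> v0"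
  shows "\<exists>u\<in>nbrs v. depth v = depth u + 1"
proof -
  obtain p where p: "awalk v0 p v" "length p = depth v" using depth_walk assms by blast
  then have "p \<noteq> []" using assms by (auto simp: awalk_Nil_iff)
  then obtain q e where pe: "p = q @ [e]" by (metis rev_exhaust)
  then have q: "awalk v0 q (fst e)" and e: "e \<in> parcs G" "snd e = v"
    using p by (auto simp: awalk_Cons_iff awalk_Nil_iff)
  have n: "fst e \<in> nbrs v" using e by (auto simp: nbrs_def intro: arcs_symmetric)
  have "depth (fst e) \<le> length q" using q by (rule depth_le)
  moreover have "depth v \<le> depth (fst e) + 1" using depth_nb nb_sym[OF n] by blast
  ultimately show ?thesis using n p pe by (intro bexI[of _ "fst e"]) auto
qed

lemma shortest_avoids:
  assumes "awalk v0 p u" "length p = depth u" "(a, b) \<in> set p"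
  shows "depth a < depth u" "depth b \<le> depth u"
proof -
  obtain q r where p: "p = q @ (a, b) # r" using assms(3) by (meson split_list)
  then have q: "awalk v0 q a" "(a, b) \<in> parcs G" using assms(1) by (auto simp: awalk_Cons_iff)
  then have "depth a \<le> length q" by (simp add: depth_le)
  then show "depth a < depth u" using p assms(2) by simp
  moreover have "depth b \<le> depth a + 1" using depth_nb q by (simp add: nbrs_def)
  ultimately show "depth b \<le> depth u" by simp
qed

text \<open>Otherwise the walk from \<open>u\<close> to the root, out to \<open>w\<close> and on to
  \<open>v\<close> bypasses the edge between \<open>u\<close> and \<open>v\<close>. Since
  \<open>u\<close> may be as deep as \<open>v\<close>, this also excludes edges between vertices of
  equal depth.\<close>

lemma lower_unique:
  assumes "u \<in> nbrs v" "w \<in> nbrs v" "depth u \<le> depth v" "depth w < depth v"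
  shows "u = w"
proof (rule ccontr)
  assume ne: "u \<noteq> w"
  obtain p where p: "awalk v0 p u" "length p = depth u" using depth_walk nb_verts assms by blast
  obtain q where q: "awalk v0 q w" "length q = depth w" using depth_walk nb_verts assms by blast
  have "awalk u (rev_path p @ q) w" using p q by (intro awalk_appendI[where v=v0]) simp_all
  then have "awalk u ((rev_path p @ q) @ [(w, v)]) v"
    using awalk_snoc nb_sym[OF assms(2)] by blast
  then have "(v, u) \<in> set ((rev_path p @ q) @ [(w, v)]) \<or> (u, v) \<in> set ((rev_path p @ q) @ [(w, v)])"
    using no_bypass[of u v] assms(1) by blast
  moreover have rp: "\<And>a b. (a, b) \<in> set (rev_path p) \<longleftrightarrow> (b, a) \<in> set p"
    by (induct p) auto
  moreover have "v \<noteq> u" "v \<noteq> w" using assms no_loop by auto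
  ultimately have "(u, v) \<in> set p \<or> (v, u) \<in> set p \<or> (u, v) \<in> set q \<or> (v, u) \<in> set q"
    using ne by auto
  then show False
    using shortest_avoids[OF p] shortest_avoids[OF q] assms by fastforce
qed

lemma children_altdef: "children v = {w \<in> nbrs v. depth v < depth w}"
  by (simp add: children_def nbrs_def)

lemma child_unique:
  assumes "w \<in> children u" "w \<in> children v" shows "u = v"
  using assms lower_unique[of u w v] nb_sym[of w u] nb_sym[of w v] by (simp add: children_altdef)

lemma parent_child: "w \<in> children v \<Longrightarrow> parent w = v"
  unfolding parent_def using child_unique by blast

lemma child_iff: "w \<in> children v \<longleftrightarrow> w \<in> pverts G \<and> w \<noteq> v0 \<and> parent w = v"
proof
  assume w: "w \<in> children v"
  then have "w \<in> pverts G" "w \<noteq> v0" using nb_verts(1)[of w v] by (auto simp: children_altdef)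
  then show "w \<in> pverts G \<and> w \<noteq> v0 \<and> parent w = v" using parent_child w by blast
next
  assume w: "w \<in> pverts G \<and> w \<noteq> v0 \<and> parent w = v"
  then obtain u where u: "u \<in> nbrs w" "depth w = depth u + 1" using lower_ex by blast
  then have "w \<in> children u" using nb_sym[OF u(1)] by (simp add: children_altdef)
  then show "w \<in> children v" using parent_child w by auto
qed

lemma children_verts: "w \<in> children v \<Longrightarrow> w \<in> pverts G" "w \<in> children v \<Longrightarrow> v \<in> pverts G"
  using nb_verts unfolding children_altdef by blast+

lemma parent_props:
  assumes "w \<in> pverts G" "w \<noteq> v0"
  shows "parent w \<in> pverts G" "parent w \<in> nbrs w" "w \<in> nbrs (parent w)" "w \<in> children (parent w)"
proof -
  show *: "w \<in> children (parent w)" using assms child_iff by blast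
  then show "w \<in> nbrs (parent w)" by (simp add: children_altdef)
  then show "parent w \<in> pverts G" "parent w \<in> nbrs w" using nb_verts(2) nb_sym by blast+
qed

lemma root_not_child: "v0 \<notin> children v" by (simp add: child_iff)

lemma nb_cases: "w \<in> nbrs v \<longleftrightarrow> w \<in> children v \<or> v \<noteq> v0 \<and> v \<in> pverts G \<and> w = parent v"
proof
  assume w: "w \<in> nbrs v"
  then have v: "v \<in> pverts G" "w \<in> pverts G" using nb_verts[OF w] by auto
  show "w \<in> children v \<or> v \<noteq> v0 \<and> v \<in> pverts G \<and> w = parent v"
  proof (cases "depth v < depth w")
    case True then show ?thesis using w by (simp add: children_altdef)
  next
    case False
    have "v \<noteq> v0"
      using False depth_0[of w] v w no_loop by auto
    then obtain u where u: "u \<in> nbrs v" "depth v = depth u + 1" using lower_ex v by blast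
    then have "w = u" using lower_unique[of w v u] w False by simp
    moreover have "v \<in> children u" using u(2) nb_sym[OF u(1)] by (simp add: children_altdef)
    ultimately show ?thesis using parent_child \<open>v \<noteq> v0\<close> v by blast
  qed
next
  assume "w \<in> children v \<or> v \<noteq> v0 \<and> v \<in> pverts G \<and> w = parent v"
  then show "w \<in> nbrs v" using parent_props(2) children_altdef by blast
qed

lemma nb_root: "nbrs v0 = children v0"
  using nb_cases by blast

lemma depth_child: "w \<in> children v \<Longrightarrow> depth w = depth v + 1"
  using depth_nb[of w v] by (simp add: children_altdef)

lemma depth_parent: "w \<in> pverts G \<Longrightarrow> w \<noteq> v0 \<Longrightarrow> depth w = depth (parent w) + 1"
  using depth_child parent_props(4) by blast

lemma parent_notin_children: "v \<in> pverts G \<Longrightarrow> v \<noteq> v0 \<Longrightarrow> parent v \<notin> children v"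
  using depth_child[of "parent v" v] depth_parent[of v] by auto

lemma nb_nonroot: "v \<in> pverts G \<Longrightarrow> v \<noteq> v0 \<Longrightarrow> nbrs v = insert (parent v) (children v)"
  using nb_cases by blast

lemma finite_children: "finite (children v)"
  using finite_nb[of v] by (auto simp: children_altdef)

lemma card_children:
  "v \<in> pverts G \<Longrightarrow> v \<noteq> v0 \<Longrightarrow> card (children v) = d"
  using card_nb[of v] nb_nonroot[of v] parent_notin_children[of v] finite_children[of v] by simp

lemma card_children_root: "card (children v0) = d + 1"
  using card_nb[OF root] nb_root by simp

lemma tree_induct [consumes 1, case_names root step]:
  assumes "v \<in> pverts G" "P v0"
    and step: "\<And>w. w \<in> pverts G \<Longrightarrow> w \<noteq> v0 \<Longrightarrow> P (parent w) \<Longrightarrow> P w"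
  shows "P v"
  using assms(1)
proof (induct "depth v" arbitrary: v)
  case 0 then show ?case using depth_0 assms(2) by metis
next
  case (Suc n)
  then have "v \<noteq> v0" by auto
  then show ?case using Suc step[of v] depth_parent[of v] parent_props(1)[of v] by auto
qed

section \<open>Subtrees below a vertex\<close>

lemma subtree_self: "v \<in> pverts G \<Longrightarrow> v \<in> subtree v"
  unfolding subtree_def using depth_walk[of v] awlast_of_awalk by (force simp: awalk_verts_conv)

lemma awalk_verts_snoc:
  assumes "awalk u p v" shows "pawalk_verts u (p @ [(v, w)]) = pawalk_verts u p @ [w]"
  using assms by (induct p arbitrary: u) (auto simp: awalk_Cons_iff awalk_Nil_iff)

text \<open>Replaces the shortest walks in the definition of \<open>subtree\<close> by a recursion
  towards the root; the later arguments about subtrees rest on this form.\<close>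

lemma subtree_step:
  assumes "v \<in> pverts G"
  shows "w \<in> subtree v \<longleftrightarrow> w = v \<or> w \<in> pverts G \<and> w \<noteq> v0 \<and> parent w \<in> subtree v"
proof
  assume "w \<in> subtree v"
  then obtain p where p: "awalk v0 p w" "length p = depth w" "v \<in> set (pawalk_verts v0 p)"
    by (auto simp: subtree_def)
  then have w: "w \<in> pverts G" using awalk_last_in_verts by blast
  show "w = v \<or> w \<in> pverts G \<and> w \<noteq> v0 \<and> parent w \<in> subtree v"
  proof (cases "w = v0")
    case True
    then show ?thesis using p by auto
  next
    case False
    then have "p \<noteq> []" using p by (auto simp: awalk_Nil_iff)
    then obtain q u x where pe: "p = q @ [(u, x)]" by (metis rev_exhaust surj_pair)
    have x: "x = w" and q: "awalk v0 q u" and e: "(u, w) \<in> parcs G" using p(1) pe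
      by (auto simp: awalk_Cons_iff awalk_Nil_iff)
    have "depth u \<le> length q" "depth w \<le> depth u + 1"
      using q e depth_le depth_nb by (auto simp: nbrs_def)
    then have du: "depth w = depth u + 1" "length q = depth u" using p pe by auto
    then have "w \<in> children u" using e by (simp add: children_def)
    then have par: "parent w = u" by (rule parent_child)
    show ?thesis
    proof (cases "v = w")
      case False
      then have "v \<in> set (pawalk_verts v0 q)" using p(3) awalk_verts_snoc[OF q] pe x by auto
      then have "u \<in> subtree v" using q du by (auto simp: subtree_def)
      then show ?thesis using par w \<open>w \<noteq> v0\<close> by simp
    qed simp
  qed
next
  assume "w = v \<or> w \<in> pverts G \<and> w \<noteq> v0 \<and> parent w \<in> subtree v"
  then show "w \<in> subtree v"
  proof
    assume "w = v" then show ?thesis using assms subtree_self by simp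
  next
    assume w: "w \<in> pverts G \<and> w \<noteq> v0 \<and> parent w \<in> subtree v"
    then obtain p where p: "awalk v0 p (parent w)" "length p = depth (parent w)"
      "v \<in> set (pawalk_verts v0 p)" by (auto simp: subtree_def)
    have "awalk v0 (p @ [(parent w, w)]) w" using awalk_snoc p w parent_props by blast
    moreover have "v \<in> set (pawalk_verts v0 (p @ [(parent w, w)]))"
      using awalk_verts_snoc[OF p(1)] p(3) by simp
    moreover have "length (p @ [(parent w, w)]) = depth w" using p w depth_parent by simp
    ultimately show ?thesis unfolding subtree_def by blast
  qed
qed

lemma subtree_verts: "w \<in> subtree v \<Longrightarrow> w \<in> pverts G"
  unfolding subtree_def using awalk_last_in_verts by blast

lemma subtree_child: "v \<in> pverts G \<Longrightarrow> u \<in> subtree v \<Longrightarrow> w \<in> children u \<Longrightarrow> w \<in> subtree v"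
  using subtree_step[of v w] child_iff[of w u] by blast

lemma subtree_induct [consumes 2, case_names self step]:
  assumes "w \<in> subtree v" "v \<in> pverts G" "P v"
    and "\<And>u x. u \<in> subtree v \<Longrightarrow> x \<in> children u \<Longrightarrow> P u \<Longrightarrow> P x"
  shows "P w"
proof -
  have "w \<in> pverts G" using assms subtree_verts by blast
  then show ?thesis using assms(1)
  proof (induct w rule: tree_induct)
    case root then show ?case using subtree_step[of v v0] assms by auto
  next
    case (step w) then show ?case using subtree_step[of v w] assms child_iff by blast
  qed
qed

lemma subtree_trans: "u \<in> pverts G \<Longrightarrow> v \<in> subtree u \<Longrightarrow> w \<in> subtree v \<Longrightarrow> w \<in> subtree u"
proof -
  assume u: "u \<in> pverts G" and v: "v \<in> subtree u" and w: "w \<in> subtree v"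
  show ?thesis using w subtree_verts[OF v]
    by (induct w rule: subtree_induct) (use v u subtree_child in blast)+
qed

section \<open>Ancestor-closed sets, complete subtrees and their forests\<close>

lemma finite_ancestors: "w \<in> pverts G \<Longrightarrow> finite {v \<in> pverts G. w \<in> subtree v}"
proof (induct w rule: tree_induct)
  case root
  have "{v \<in> pverts G. v0 \<in> subtree v} \<subseteq> {v0}" using subtree_step[of _ v0] by blast
  then show ?case by (rule finite_subset) simp
next
  case (step w)
  have "{v \<in> pverts G. w \<in> subtree v} \<subseteq> insert w {v \<in> pverts G. parent w \<in> subtree v}"
    using subtree_step[of _ w] by blast
  then show ?case by (rule finite_subset) (simp add: step)
qed

definition ancestor_closed :: "'v set \<Rightarrow> bool" where
  "ancestor_closed C \<longleftrightarrow> finite C \<and> C \<subseteq> pverts G \<and> (\<forall>w\<in>C. w \<noteq> v0 \<longrightarrow> parent w \<in> C)"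

lemma ancestor_closedD:
  assumes "ancestor_closed C"
  shows "finite C" "C \<subseteq> pverts G" "w \<in> C \<Longrightarrow> w \<noteq> v0 \<Longrightarrow> parent w \<in> C"
    "w \<in> children v \<Longrightarrow> w \<in> C \<Longrightarrow> v \<in> C"
  using assms by (auto simp: ancestor_closed_def child_iff)

lemma ancestor_closed_subtree:
  assumes "ancestor_closed C" "v \<in> pverts G" "w \<in> subtree v" "w \<in> C"
  shows "v \<in> C"
  using assms(3,2,4)
proof (induct w rule: subtree_induct)
  case (step u x) then show ?case using ancestor_closedD(4)[OF assms(1)] by blast
qed

lemma ancestor_closed_root: "ancestor_closed C \<Longrightarrow> C \<noteq> {} \<Longrightarrow> v0 \<in> C"
proof -
  assume c: "ancestor_closed C" "C \<noteq> {}"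
  then obtain w where w: "w \<in> C" "w \<in> pverts G" by (auto simp: ancestor_closed_def)
  have "w \<in> C \<longrightarrow> v0 \<in> C" using w(2)
    by (induct w rule: tree_induct) (use c ancestor_closedD(3) in auto)
  then show ?thesis using w by blast
qed

lemma closure_ex:
  assumes "finite A" "A \<subseteq> pverts G"
  shows "\<exists>C. ancestor_closed C \<and> v0 \<in> C \<and> A \<subseteq> C"
proof -
  let ?C = "insert v0 (\<Union>w\<in>A. {v \<in> pverts G. w \<in> subtree v})"
  have "finite ?C" using assms finite_ancestors by auto
  moreover have "parent x \<in> ?C" if x: "x \<in> ?C" "x \<noteq> v0" for x
  proof -
    obtain w where w: "w \<in> A" "x \<in> pverts G" "w \<in> subtree x" using x by blast
    have "x \<in> subtree (parent x)"
      using subtree_child subtree_self parent_props[OF w(2) x(2)] by blast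
    then have "w \<in> subtree (parent x)" using subtree_trans w parent_props[OF w(2) x(2)] by blast
    then show ?thesis using w parent_props[OF w(2) x(2)] by blast
  qed
  ultimately have "ancestor_closed ?C" using root by (auto simp: ancestor_closed_def)
  moreover have "A \<subseteq> ?C" using assms subtree_self by blast
  ultimately show ?thesis by (intro exI[of _ ?C]) simp
qed

text \<open>The complete subtree with set of interior vertices \<open>C\<close>.\<close>

definition span_tree :: "'v set \<Rightarrow> 'v set" where
  "span_tree C = (if C = {} then {v0} else C \<union> (\<Union>v\<in>C. children v))"

text \<open>Used wherever something has to be matched across the boundary of a subtree, which is
  crossed by a single edge.\<close>

lemma subtree_enter:
  assumes "v \<in> pverts G" "y \<in> nbrs x" "y \<in> subtree v" "x \<notin> subtree v"
  shows "y = v \<and> v \<noteq> v0 \<and> x = parent v"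
proof -
  have "x \<in> children y \<or> y \<noteq> v0 \<and> y \<in> pverts G \<and> x = parent y"
    using nb_cases nb_sym assms by blast
  then show ?thesis using assms subtree_step[of v y] subtree_child[of v y x] by auto
qed

lemma induce_reach:
  assumes "T \<subseteq> pverts G"
  shows "connected (with_proj G \<restriction> T) \<longleftrightarrow>
    T \<noteq> {} \<and> (\<forall>u\<in>T. \<forall>v\<in>T. (u, v) \<in> rtrancl_on T {(x, y). y \<in> nbrs x \<and> x \<in> T \<and> y \<in> T})"
proof -
  have "parcs (mk_symmetric (with_proj G \<restriction> T)) = {(x, y). y \<in> nbrs x \<and> x \<in> T \<and> y \<in> T}"
    by (auto simp: mk_symmetric_def induce_subgraph_def nbrs_def intro: arcs_symmetric)
  moreover have "pverts (mk_symmetric (with_proj G \<restriction> T)) = T"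
    by (simp add: mk_symmetric_def induce_subgraph_def)
  ultimately show ?thesis
    by (simp add: connected_def strongly_connected_def reachable_def)
qed

text \<open>Connectedness gives a walk inside \<open>T\<close> from the root to \<open>w\<close>. It
  starts outside \<open>subtree w\<close> and can enter it only from the parent of
  \<open>w\<close>.\<close>

lemma complete_closed:
  assumes T: "complete_subtree T" and w: "w \<in> T" "w \<noteq> v0"
  shows "parent w \<in> T"
proof -
  have wv: "w \<in> pverts G" using T w by (auto simp: complete_subtree_def)
  have "(v0, w) \<in> rtrancl_on T {(x, y). y \<in> nbrs x \<and> x \<in> T \<and> y \<in> T}"
    using induce_reach[of T] T w by (auto simp: complete_subtree_def)
  moreover have "y \<in> subtree w \<longrightarrow> parent w \<in> T"
    if "(v0, y) \<in> rtrancl_on T {(x, y). y \<in> nbrs x \<and> x \<in> T \<and> y \<in> T}" for y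
    using that
  proof (induct rule: rtrancl_on_induct)
    case base then show ?case using subtree_step[OF wv, of v0] w by auto
  next
    case (step x y)
    then show ?case using subtree_enter[OF wv, of y x] by auto
  qed
  ultimately show ?thesis using subtree_self wv by blast
qed

lemma span_tree_complete:
  assumes "ancestor_closed C" shows "complete_subtree (span_tree C)"
proof (cases "C = {}")
  case True
  have "v0 \<notin> children v0" by (rule root_not_child)
  then show ?thesis using True root
    by (auto simp: complete_subtree_def span_tree_def induce_reach)
next
  case False
  let ?T = "span_tree C"
  have C: "v0 \<in> C" using ancestor_closed_root assms False by blast
  have sub: "?T \<subseteq> pverts G" using ancestor_closedD(2)[OF assms] children_verts False by (auto simp: span_tree_def)
  have par: "parent w \<in> C" if "w \<in> ?T" "w \<noteq> v0" for w
    using that ancestor_closedD(3)[OF assms] False parent_child by (auto simp: span_tree_def)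
  let ?R = "{(x, y). y \<in> nbrs x \<and> x \<in> ?T \<and> y \<in> ?T}"
  have CT: "C \<subseteq> ?T" by (auto simp: span_tree_def)
  have reach: "w \<in> ?T \<longrightarrow> (v0, w) \<in> rtrancl_on ?T ?R \<and> (w, v0) \<in> rtrancl_on ?T ?R"
    if "w \<in> pverts G" for w
    using that
  proof (induct w rule: tree_induct)
    case root then show ?case by auto
  next
    case (step w)
    show ?case
    proof
      assume w: "w \<in> ?T"
      have p: "parent w \<in> ?T" using par w step CT by blast
      then have "(parent w, w) \<in> ?R" "(w, parent w) \<in> ?R" using w step parent_props by auto
      then show "(v0, w) \<in> rtrancl_on ?T ?R \<and> (w, v0) \<in> rtrancl_on ?T ?R"
        using step(3) p w rtrancl_on_into_rtrancl_on[of v0 "parent w" ?T ?R w]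
          converse_rtrancl_on_into_rtrancl_on[of w "parent w" ?R v0 ?T] by blast
    qed
  qed
  have "connected (with_proj G \<restriction> ?T)"
    unfolding induce_reach[OF sub]
  proof (intro conjI ballI)
    show "?T \<noteq> {}" using C CT by blast
    fix u v assume "u \<in> ?T" "v \<in> ?T"
    then show "(u, v) \<in> rtrancl_on ?T ?R"
      using reach sub rtrancl_on_trans[of u v0 ?T ?R v] by blast
  qed
  moreover have "children v \<subseteq> ?T" if "v \<in> ?T" "children v \<inter> ?T \<noteq> {}" for v
  proof -
    obtain w where "w \<in> children v" "w \<in> ?T" using \<open>children v \<inter> ?T \<noteq> {}\<close> by blast
    then have "v \<in> C" using par[of w] parent_child root_not_child by metis
    then show ?thesis using False by (auto simp: span_tree_def)
  qed
  moreover have "finite ?T" using ancestor_closedD(1)[OF assms] finite_children by (auto simp: span_tree_def)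
  ultimately show ?thesis using sub C CT by (auto simp: complete_subtree_def)
qed

lemma complete_span_tree_ex:
  assumes "complete_subtree T"
  shows "\<exists>C. ancestor_closed C \<and> T = span_tree C"
proof -
  let ?C = "{v \<in> T. children v \<inter> T \<noteq> {}}"
  have T: "finite T" "T \<subseteq> pverts G" "v0 \<in> T" "\<And>v. v \<in> T \<Longrightarrow> children v \<inter> T \<noteq> {} \<Longrightarrow> children v \<subseteq> T"
    using assms by (auto simp: complete_subtree_def)
  have c: "w \<in> children (parent w)" "parent w \<in> ?C" if "w \<in> T" "w \<noteq> v0" for w
  proof -
    have p: "parent w \<in> T" "w \<in> pverts G" using that complete_closed[OF assms] T(2) by blast+
    show "w \<in> children (parent w)" using that(2) p(2) by (simp add: child_iff)
    then show "parent w \<in> ?C" using p(1) that(1) by blast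
  qed
  have "ancestor_closed ?C" unfolding ancestor_closed_def using T c by auto
  moreover have "T = span_tree ?C"
  proof (cases "?C = {}")
    case True
    then have "T = {v0}" using c T by blast
    then show ?thesis using True by (simp add: span_tree_def)
  next
    case False
    then have st: "span_tree ?C = ?C \<union> (\<Union>v\<in>?C. children v)"
      unfolding span_tree_def by (rule if_not_P)
    have sub: "?C \<union> (\<Union>v\<in>?C. children v) \<subseteq> T" using T(4) by blast
    have cov: "w \<in> ?C \<union> (\<Union>v\<in>?C. children v)" if w: "w \<in> T" for w
    proof (cases "w = v0")
      case False then show ?thesis using c w by blast
    next
      case True
      have "v0 \<in> ?C" using ancestor_closed_root \<open>ancestor_closed ?C\<close> False by blast
      then show ?thesis using True by blast
    qed
    show ?thesis unfolding st by (rule subset_antisym[OF subsetI sub]) (rule cov)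
  qed
  ultimately show ?thesis by (rule_tac exI[of _ ?C] conjI)+
qed

lemma leaves_span_tree:
  assumes "ancestor_closed C"
  shows "leaves (span_tree C) = span_tree C - C"
proof (cases "C = {}")
  case True
  then show ?thesis using root_not_child by (auto simp: leaves_def span_tree_def)
next
  case False
  have "children v \<inter> span_tree C = {}" if "v \<in> span_tree C" "v \<notin> C" for v
  proof -
    have "w \<notin> span_tree C" if w: "w \<in> children v" for w
    proof
      assume "w \<in> span_tree C"
      then consider "w \<in> C" | u where "u \<in> C" "w \<in> children u"
        using False by (auto simp: span_tree_def)
      then show False
        using ancestor_closedD(4)[OF assms w] child_unique[OF w] \<open>v \<notin> C\<close> by cases auto
    qed
    then show ?thesis by blast
  qed
  moreover have "children v \<noteq> {}" if "v \<in> C" for v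
    using that card_children[of v] card_children_root ancestor_closedD(2)[OF assms] d_ge_2
    by (cases "v = v0") auto
  moreover have "children v \<subseteq> span_tree C" "v \<in> span_tree C" if "v \<in> C" for v
    using False that by (auto simp: span_tree_def)
  ultimately show ?thesis unfolding leaves_def by blast
qed

lemma ancestor_closed_empty: "ancestor_closed C \<Longrightarrow> v0 \<notin> C \<Longrightarrow> C = {}"
  using ancestor_closed_root by blast

lemma forest_verts_span_tree:
  assumes C: "ancestor_closed C"
  shows "forest_verts (span_tree C) = pverts G - C"
proof
  show "forest_verts (span_tree C) \<subseteq> pverts G - C"
  proof
    fix w assume "w \<in> forest_verts (span_tree C)"
    then obtain l where l: "l \<in> span_tree C - C" "w \<in> subtree l"
      unfolding forest_verts_def leaves_span_tree[OF C] by blast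
    have "l \<in> pverts G" using l(1) span_tree_complete[OF C] by (auto simp: complete_subtree_def)
    then show "w \<in> pverts G - C" using ancestor_closed_subtree[OF C _ l(2)] l subtree_verts by blast
  qed
  have "w \<notin> C \<longrightarrow> (\<exists>l\<in>span_tree C - C. w \<in> subtree l)" if "w \<in> pverts G" for w
    using that
  proof (induct w rule: tree_induct)
    case root
    show ?case
    proof
      assume "v0 \<notin> C"
      then have "C = {}" using ancestor_closed_empty C by blast
      then show "\<exists>l\<in>span_tree C - C. v0 \<in> subtree l" using subtree_self[OF root_vert] by (simp add: span_tree_def)
    qed
  next
    case (step w)
    show ?case
    proof
      assume w: "w \<notin> C"
      show "\<exists>l\<in>span_tree C - C. w \<in> subtree l"
      proof (cases "parent w \<in> C")
        case True
        then have "w \<in> span_tree C - C" using w parent_props(4)[OF step(1,2)] by (auto simp: span_tree_def)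
        then show ?thesis using subtree_self step(1) by blast
      next
        case False
        then obtain l where l: "l \<in> span_tree C - C" "parent w \<in> subtree l" using step by blast
        have "l \<in> pverts G" using l(1) span_tree_complete[OF C] by (auto simp: complete_subtree_def)
        then show ?thesis using l subtree_child parent_props(4)[OF step(1,2)] by blast
      qed
    qed
  qed
  then show "pverts G - C \<subseteq> forest_verts (span_tree C)"
    unfolding forest_verts_def leaves_span_tree[OF C] by blast
qed

text \<open>One end of an edge is a child of the other, so an edge that avoids \<open>C\<close>
  stays within one component of the forest; the component need not be mentioned.\<close>

lemma forest_arcs_span_tree:
  assumes C: "ancestor_closed C"
  shows "forest_arcs (span_tree C) = {(u, w). w \<in> nbrs u \<and> u \<notin> C \<and> w \<notin> C}"
proof -
  have lv: "l \<in> pverts G" if "l \<in> leaves (span_tree C)" for l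
    using that span_tree_complete[OF C] by (auto simp: leaves_def complete_subtree_def)
  have 1: "\<exists>l\<in>leaves (span_tree C). u \<in> subtree l \<and> w \<in> subtree l"
    if "w \<in> children u" "u \<notin> C" for u w
  proof -
    have "u \<in> forest_verts (span_tree C)"
      using that children_verts(2) by (simp add: forest_verts_span_tree[OF C])
    then obtain l where "l \<in> leaves (span_tree C)" "u \<in> subtree l" by (auto simp: forest_verts_def)
    then show ?thesis using subtree_child lv that by blast
  qed
  have 2: "\<exists>l\<in>leaves (span_tree C). u \<in> subtree l \<and> w \<in> subtree l"
    if "w \<in> nbrs u" "u \<notin> C" "w \<notin> C" for u w
  proof (cases "w \<in> children u")
    case True then show ?thesis using 1 that by blast
  next
    case False
    then have "u \<in> children w" using that(1) nb_cases[of w u] parent_props(4)[of u] by blast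
    then show ?thesis using 1[of u w] that by blast
  qed
  have 3: "u \<notin> C" if "l \<in> leaves (span_tree C)" "u \<in> subtree l" for l u
    using that forest_verts_span_tree[OF C] by (auto simp: forest_verts_def)
  have "(u, w) \<in> forest_arcs (span_tree C) \<longleftrightarrow> w \<in> nbrs u \<and> u \<notin> C \<and> w \<notin> C" for u w
  proof
    assume "(u, w) \<in> forest_arcs (span_tree C)"
    then obtain l where "l \<in> leaves (span_tree C)" "u \<in> subtree l" "w \<in> subtree l" "w \<in> nbrs u"
      unfolding forest_arcs_def nbrs_def by blast
    then show "w \<in> nbrs u \<and> u \<notin> C \<and> w \<notin> C" using 3 by blast
  next
    assume *: "w \<in> nbrs u \<and> u \<notin> C \<and> w \<notin> C"
    then obtain l where "l \<in> leaves (span_tree C)" "u \<in> subtree l" "w \<in> subtree l" using 2 by blast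
    then show "(u, w) \<in> forest_arcs (span_tree C)" using * unfolding forest_arcs_def nbrs_def by blast
  qed
  then show ?thesis by auto
qed

end

section \<open>Maps that are almost automorphisms\<close>

context branching_tree
begin

text \<open>Mentions neither the root nor a complete subtree, so finite changes, composition and
  inversion require no bookkeeping of trees. The rooted form \<open>good\<close> is the one from
  which honest almost automorphisms are made.\<close>

definition near :: "('v \<Rightarrow> 'v) \<Rightarrow> bool" where
  "near g \<longleftrightarrow> (\<exists>E. finite E \<and> inj_on g (pverts G - E) \<and> g ` (pverts G - E) \<subseteq> pverts G \<and>
     finite (pverts G - g ` (pverts G - E)) \<and> (\<forall>w\<in>pverts G - E. g ` nbrs w = nbrs (g w)))"

definition good :: "('v \<Rightarrow> 'v) \<Rightarrow> 'v set \<Rightarrow> bool" where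
  "good g C \<longleftrightarrow> ancestor_closed C \<and> v0 \<in> C \<and> inj_on g (pverts G - C) \<and>
     g ` (pverts G - C) \<subseteq> pverts G \<and> finite (pverts G - g ` (pverts G - C)) \<and>
     (\<forall>w\<in>pverts G - C. g ` children w = children (g w))"

text \<open>The codomain is arbitrary because partial maps are compared as well as total
  ones.\<close>

definition almost_eq :: "('v \<Rightarrow> 'a) \<Rightarrow> ('v \<Rightarrow> 'a) \<Rightarrow> bool" where
  "almost_eq g h \<longleftrightarrow> finite {v \<in> pverts G. g v \<noteq> h v}"

lemma nearE:
  assumes "near g"
  obtains E where "finite E" "inj_on g (pverts G - E)" "g ` (pverts G - E) \<subseteq> pverts G"
    "finite (pverts G - g ` (pverts G - E))" "\<forall>w\<in>pverts G - E. g ` nbrs w = nbrs (g w)"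
  using assms unfolding near_def
  by (elim exE conjE, intro that)

lemma goodD:
  assumes "good g C"
  shows "ancestor_closed C" "v0 \<in> C" "inj_on g (pverts G - C)" "g ` (pverts G - C) \<subseteq> pverts G"
    "finite (pverts G - g ` (pverts G - C))"
    "w \<in> pverts G \<Longrightarrow> w \<notin> C \<Longrightarrow> g ` children w = children (g w)"
    "w \<in> pverts G \<Longrightarrow> w \<notin> C \<Longrightarrow> g w \<in> pverts G"
    "x \<in> pverts G \<Longrightarrow> x \<notin> C \<Longrightarrow> y \<in> pverts G \<Longrightarrow> y \<notin> C \<Longrightarrow> g x = g y \<Longrightarrow> x = y"
    "finite C" "C \<subseteq> pverts G" "w \<in> pverts G \<Longrightarrow> w \<notin> C \<Longrightarrow> w \<noteq> v0"
proof -
  show 1: "ancestor_closed C" "v0 \<in> C" "inj_on g (pverts G - C)" "g ` (pverts G - C) \<subseteq> pverts G"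
    "finite (pverts G - g ` (pverts G - C))"
    using assms unfolding good_def by simp_all
  show "w \<in> pverts G \<Longrightarrow> w \<notin> C \<Longrightarrow> g ` children w = children (g w)"
    using assms unfolding good_def by simp
  show "w \<in> pverts G \<Longrightarrow> w \<notin> C \<Longrightarrow> g w \<in> pverts G" using 1(4) by blast
  show "x \<in> pverts G \<Longrightarrow> x \<notin> C \<Longrightarrow> y \<in> pverts G \<Longrightarrow> y \<notin> C \<Longrightarrow> g x = g y \<Longrightarrow> x = y"
    using inj_onD[OF 1(3), of x y] by simp
  show "finite C" "C \<subseteq> pverts G" using ancestor_closedD[OF 1(1)] by simp_all
  show "w \<in> pverts G \<Longrightarrow> w \<notin> C \<Longrightarrow> w \<noteq> v0" using 1(2) by blast
qed

lemma finite_range_compl: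
  assumes "finite (S - g ` (S - E))" "finite E'" "E \<subseteq> E'"
  shows "finite (S - g ` (S - E'))"
proof -
  have "S - g ` (S - E') \<subseteq> (S - g ` (S - E)) \<union> g ` E'" by blast
  then show ?thesis using assms by (meson finite_Un finite_imageI finite_subset)
qed

lemma finite_preimage:
  assumes "inj_on g (S - E)" "finite E" "finite D"
  shows "finite {w \<in> S. g w \<in> D}"
proof -
  have "finite (g -` D \<inter> (S - E))" using finite_vimage_IntI assms by blast
  moreover have "{w \<in> S. g w \<in> D} \<subseteq> (g -` D \<inter> (S - E)) \<union> E" by blast
  ultimately show ?thesis using assms(2) by (meson finite_Un finite_subset)
qed

lemma near_preimage: "near g \<Longrightarrow> finite D \<Longrightarrow> finite {w \<in> pverts G. g w \<in> D}"
  using finite_preimage[of g "pverts G"] by (meson nearE)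

lemma near_verts: "near g \<Longrightarrow> finite {w \<in> pverts G. g w \<notin> pverts G}"
proof -
  assume "near g"
  then obtain E where "finite E" "g ` (pverts G - E) \<subseteq> pverts G" by (rule nearE)
  moreover from this(2) have "{w \<in> pverts G. g w \<notin> pverts G} \<subseteq> E" by blast
  ultimately show ?thesis by (meson finite_subset)
qed

text \<open>The root has \<open>d + 1\<close> children, and \<open>w\<close> has too few to cover
  them.\<close>

lemma not_root_below:
  assumes "w \<in> pverts G" "w \<noteq> v0" "g ` children w = children (g w)"
  shows "g w \<noteq> v0"
proof
  assume "g w = v0"
  then have "card (g ` children w) = d + 1" using assms(3) card_children_root by simp
  moreover have "card (g ` children w) \<le> d"
    using card_image_le[OF finite_children, of g w] card_children[OF assms(1,2)] by simp
  ultimately show False by simp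
qed

lemma good_not_root: "good g C \<Longrightarrow> w \<in> pverts G \<Longrightarrow> w \<notin> C \<Longrightarrow> g w \<noteq> v0"
  using not_root_below[of w g] goodD(6)[of g C w] goodD(11)[of g C w] by blast

text \<open>
  If the edge from the parent of \<open>w\<close> to \<open>w\<close> is turned upside down, so is one of the edges below
  \<open>w\<close>, until the root is reached.
\<close>

lemma flipped_edge:
  assumes C: "ancestor_closed C" and nbrs: "\<And>w. w \<in> pverts G \<Longrightarrow> w \<notin> C \<Longrightarrow> g ` nbrs w = nbrs (g w)"
    and V: "\<And>w. w \<in> pverts G \<Longrightarrow> w \<notin> C \<Longrightarrow> g w \<in> pverts G"
  shows "w \<in> pverts G \<Longrightarrow> w \<notin> C \<Longrightarrow> w \<noteq> v0 \<Longrightarrow> g (parent w) \<in> pverts G \<Longrightarrow> g (parent w) \<noteq> v0 \<Longrightarrow>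
    g w = parent (g (parent w)) \<Longrightarrow> \<exists>x\<in>subtree w. x \<notin> C \<and> g x = v0"
proof (induct "depth (g w)" arbitrary: w rule: less_induct)
  case less
  note w = less(2-7)
  show ?case
  proof (cases "g w = v0")
    case True then show ?thesis using subtree_self w by blast
  next
    case False
    have gw: "g w \<in> pverts G" using V w by blast
    have "parent (g w) \<in> g ` nbrs w" using parent_props(2)[OF gw False] nbrs[OF w(1,2)] by simp
    then obtain y where y: "y \<in> nbrs w" "g y = parent (g w)" by auto
    have d1: "depth (g (parent w)) = depth (g w) + 1" using depth_parent[OF w(4,5)] w(6) by simp
    have d2: "depth (g w) = depth (g y) + 1" using depth_parent[OF gw False] y by simp
    \<comment> \<open>The image of the parent is deeper than \<open>g w\<close> and the image of
      \<open>y\<close> is less deep. So the neighbour that is mapped upwards is a child of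
      \<open>w\<close>, and the edge to that child is turned over in its turn.\<close>
    have "y \<noteq> parent w" using d1 d2 by auto
    then have yc: "y \<in> children w" using nb_cases[of y w] y(1) by blast
    then have yv: "y \<in> pverts G" "y \<noteq> v0" "parent y = w" by (auto simp: child_iff)
    have yC: "y \<notin> C" using ancestor_closedD(4)[OF C yc] w(2) by blast
    have "depth (g y) < depth (g w)" using d2 by simp
    then obtain x where x: "x \<in> subtree y" "x \<notin> C" "g x = v0"
      using less(1)[of y] yv yC gw False y(2) by auto
    have "y \<in> subtree w" using subtree_child[OF w(1) subtree_self[OF w(1)] yc] .
    then show ?thesis using subtree_trans[OF w(1) _ x(1)] x by blast
  qed
qed

text \<open>The task is to show that children go to children. Let \<open>C\<close> contain all
  preimages of the root and all ancestors of these. If a child \<open>y\<close> of a vertex outside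
  \<open>C\<close> were mapped upwards, \<open>flipped_edge\<close> would yield a preimage of the
  root below \<open>y\<close>, which puts \<open>y\<close> into \<open>C\<close>. Equality of the
  sets of children then follows by counting.\<close>

lemma near_good:
  assumes "near g" shows "\<exists>C. good g C"
proof -
  obtain E where E: "finite E" "inj_on g (pverts G - E)" "g ` (pverts G - E) \<subseteq> pverts G"
    "finite (pverts G - g ` (pverts G - E))" "\<forall>w\<in>pverts G - E. g ` nbrs w = nbrs (g w)"
    using assms by (rule nearE)
  obtain C0 where C0: "ancestor_closed C0" "v0 \<in> C0" "E \<inter> pverts G \<subseteq> C0"
    using closure_ex[of "E \<inter> pverts G"] E(1) by auto
  \<comment> \<open>These vertices must be interior: below them an edge may be turned upside
    down.\<close>
  define X where "X = {x \<in> pverts G. g x \<in> {v0}}"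
  have "finite X" unfolding X_def using finite_preimage[OF E(2,1)] by blast
  then have "finite (X \<union> C0)" "X \<union> C0 \<subseteq> pverts G" using ancestor_closedD[OF C0(1)] by (auto simp: X_def)
  then obtain C where C: "ancestor_closed C" "v0 \<in> C" "X \<union> C0 \<subseteq> C" using closure_ex by blast
  have nbrs: "g ` nbrs w = nbrs (g w)" "g w \<in> pverts G" if "w \<in> pverts G" "w \<notin> C0" for w
    using that C0(3) E(3,5) by blast+
  have VC: "pverts G - C \<subseteq> pverts G - E" using C(3) C0(3) by blast
  have inj: "inj_on g (pverts G - C)" using E(2) VC by (meson inj_on_subset)
  have ch: "g ` children w = children (g w)" if w: "w \<in> pverts G" "w \<notin> C" for w
  proof (rule card_subset_eq)
    have w0: "w \<notin> C0" "g w \<noteq> v0" using w C(3) by (auto simp: X_def)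
    have gw: "g w \<in> pverts G" using nbrs w w0 by blast
    show "finite (children (g w))" by (rule finite_children)
    show "g ` children w \<subseteq> children (g w)"
    proof
      fix z assume "z \<in> g ` children w"
      then obtain y where y: "y \<in> children w" "z = g y" by blast
      have yv: "y \<in> pverts G" "y \<noteq> v0" "parent y = w" using y(1) by (auto simp: child_iff)
      have yC: "y \<notin> C" using ancestor_closedD(4)[OF C(1) y(1)] w(2) by blast
      have "y \<in> nbrs w" using y(1) nb_cases by blast
      then have "g y \<in> nbrs (g w)" using nbrs(1)[OF w(1) w0(1)] by blast
      then consider "g y \<in> children (g w)" | "g y = parent (g w)" using nb_cases by blast
      then show "z \<in> children (g w)"
      proof cases
        case 2
        have "\<exists>x\<in>subtree y. x \<notin> C0 \<and> g x = v0"
          by (rule flipped_edge[OF C0(1)]) (use nbrs yv yC C(3) gw w0 2 in auto)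
        then obtain x where x: "x \<in> subtree y" "g x = v0" by blast
        then have "x \<in> C" using subtree_verts[OF x(1)] C(3) by (auto simp: X_def)
        then have "y \<in> C" using ancestor_closed_subtree[OF C(1) yv(1) x(1)] by blast
        then show ?thesis using yC by blast
      qed (use y in simp)
    qed
    have "children w \<subseteq> pverts G - C"
      using ancestor_closedD(4)[OF C(1)] w(2) children_verts(1) by blast
    then have "card (g ` children w) = card (children w)"
      using inj by (meson card_image inj_on_subset)
    moreover have "w \<noteq> v0" using w C(2) by blast
    ultimately show "card (g ` children w) = card (children (g w))"
      using card_children[OF w(1)] card_children[OF gw w0(2)] by simp
  qed
  have "finite (pverts G - g ` (pverts G - C))"
  proof -
    have "pverts G - E = pverts G - E \<inter> pverts G" by blast
    then have "finite (pverts G - g ` (pverts G - E \<inter> pverts G))" using E(4) by simp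
    then show ?thesis
      using finite_range_compl ancestor_closedD(1)[OF C(1)] C0(3) C(3) by blast
  qed
  moreover have "g ` (pverts G - C) \<subseteq> pverts G" using E(3) VC by blast
  ultimately have "good g C" unfolding good_def using C(1,2) inj ch by simp
  then show ?thesis by (rule exI)
qed

lemma good_mono:
  assumes "good g C" "ancestor_closed C'" "C \<subseteq> C'" shows "good g C'"
proof -
  have "pverts G - C' \<subseteq> pverts G - C" using assms(3) by blast
  then have "inj_on g (pverts G - C')" "g ` (pverts G - C') \<subseteq> pverts G"
    using goodD(3,4)[OF assms(1)] by (meson inj_on_subset, blast)
  moreover have "finite (pverts G - g ` (pverts G - C'))"
    using finite_range_compl[OF goodD(5)[OF assms(1)] _ assms(3)] ancestor_closedD(1)[OF assms(2)] .
  moreover have "g ` children w = children (g w)" if "w \<in> pverts G - C'" for w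
    using goodD(6)[OF assms(1), of w] that assms(3) by blast
  ultimately show ?thesis unfolding good_def
    using assms(2,3) goodD(2)[OF assms(1)] by (simp add: subset_iff)
qed

lemma good_ex:
  assumes "near g" "finite A"
  shows "\<exists>C. good g C \<and> A \<inter> pverts G \<subseteq> C"
proof -
  obtain C where C: "good g C" using near_good assms by blast
  have "finite (C \<union> A \<inter> pverts G)" "C \<union> A \<inter> pverts G \<subseteq> pverts G" using goodD(9,10)[OF C] assms by auto
  then obtain C' where C': "ancestor_closed C'" "C \<union> A \<inter> pverts G \<subseteq> C'" using closure_ex by blast
  then have "good g C'" using good_mono[OF C C'(1)] by blast
  then show ?thesis using C' by blast
qed

text \<open>The image is closed under children, since the children of \<open>g w\<close> are the
  images of the children of \<open>w\<close>. Its complement is therefore closed under parents, and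
  it contains the root by \<open>good_not_root\<close>.\<close>

lemma good_range:
  assumes "good g C"
  obtains C' where "ancestor_closed C'" "v0 \<in> C'" "g ` (pverts G - C) = pverts G - C'"
proof -
  let ?C' = "pverts G - g ` (pverts G - C)"
  have "parent x \<in> ?C'" if x: "x \<in> ?C'" "x \<noteq> v0" for x
  proof (rule ccontr)
    assume "parent x \<notin> ?C'"
    moreover have xc: "x \<in> children (parent x)" using x parent_props(4) by blast
    ultimately obtain w where w: "w \<in> pverts G" "w \<notin> C" "parent x = g w"
      using children_verts(2) by blast
    then have "x \<in> g ` children w" using xc goodD(6)[OF assms w(1,2)] by simp
    then obtain y where y: "y \<in> children w" "x = g y" by blast
    then have "y \<in> pverts G - C"
      using children_verts(1)[OF y(1)] ancestor_closedD(4)[OF goodD(1)[OF assms] y(1)] w(2) by blast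
    then show False using x(1) y(2) by blast
  qed
  then have "ancestor_closed ?C'" using goodD(5)[OF assms] by (auto simp: ancestor_closed_def)
  moreover have "v0 \<noteq> g w" if "w \<in> pverts G - C" for w
    using good_not_root[OF assms, of w] that by blast
  then have "v0 \<in> ?C'" using root_vert by blast
  moreover have "g ` (pverts G - C) = pverts G - ?C'" using goodD(4)[OF assms] by blast
  ultimately show ?thesis using that by blast
qed

lemma good_parent:
  assumes "good g C" "w \<in> pverts G" "w \<noteq> v0" "parent w \<notin> C" "w \<notin> C"
  shows "g w \<noteq> v0" "parent (g w) = g (parent w)" "g ` nbrs w = nbrs (g w)"
proof -
  have p: "parent w \<in> pverts G" "w \<in> children (parent w)" using parent_props assms by blast+
  show gw: "g w \<noteq> v0" using good_not_root assms by blast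
  have "g w \<in> children (g (parent w))" using goodD(6)[OF assms(1) p(1) assms(4)] p(2) by blast
  then show pg: "parent (g w) = g (parent w)" by (rule parent_child)
  have "g ` nbrs w = insert (g (parent w)) (g ` children w)"
    unfolding nb_nonroot[OF assms(2,3)] by simp
  then show "g ` nbrs w = nbrs (g w)"
    using nb_nonroot[OF goodD(7)[OF assms(1,2,5)] gw] pg goodD(6)[OF assms(1,2,5)] by simp
qed

lemma good_near:
  assumes "good g C" shows "near g"
proof -
  \<comment> \<open>The children of \<open>C\<close> are added so that outside this set the parent
    is not in \<open>C\<close> either; \<open>good\<close> controls a vertex and its children, and
    its parent only through the children of that parent.\<close>
  let ?E = "C \<union> (\<Union>w\<in>C. children w)"
  have fE: "finite ?E" using goodD(9)[OF assms] finite_children by blast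
  have "w \<noteq> v0" "parent w \<notin> C" "w \<notin> C" if "w \<in> pverts G - ?E" for w
    using that goodD(2)[OF assms] parent_props(4)[of w] by blast+
  then have "g ` nbrs w = nbrs (g w)" if "w \<in> pverts G - ?E" for w
    using good_parent(3)[OF assms, of w] that by blast
  moreover have "inj_on g (pverts G - ?E)" using goodD(3)[OF assms] by (rule inj_on_subset) blast
  moreover have "g ` (pverts G - ?E) \<subseteq> pverts G" using goodD(4)[OF assms] by blast
  moreover have "finite (pverts G - g ` (pverts G - ?E))"
    using finite_range_compl[OF goodD(5)[OF assms] fE] by blast
  ultimately show ?thesis unfolding near_def using fE by blast
qed

section \<open>Stability under finite changes, composition and inversion\<close>

lemma near_almost_eq:
  assumes "near g" "almost_eq g h" shows "near h"
proof -
  obtain E where E: "finite E" "inj_on g (pverts G - E)" "g ` (pverts G - E) \<subseteq> pverts G"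
    "finite (pverts G - g ` (pverts G - E))" "\<forall>w\<in>pverts G - E. g ` nbrs w = nbrs (g w)"
    using assms(1) by (rule nearE)
  let ?D = "{v \<in> pverts G. g v \<noteq> h v}"
  let ?E = "E \<union> ?D \<union> (\<Union>v\<in>?D. nbrs v)"
  have fE: "finite ?E" using E(1) assms(2) finite_nb unfolding almost_eq_def by blast
  have eq: "h w = g w" if "w \<in> pverts G - ?E" for w using that by auto
  have "inj_on g (pverts G - ?E)" using E(2) by (rule inj_on_subset) blast
  then have "inj_on h (pverts G - ?E)" using eq by (metis (no_types, lifting) inj_on_cong)
  moreover have im: "h ` (pverts G - ?E) = g ` (pverts G - ?E)" using eq by (rule image_cong[OF refl])
  moreover have "g ` (pverts G - ?E) \<subseteq> pverts G" using E(3) by blast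
  moreover have "finite (pverts G - g ` (pverts G - ?E))"
    using finite_range_compl[OF E(4) fE] by blast
  moreover have "h ` nbrs w = nbrs (h w)" if w: "w \<in> pverts G - ?E" for w
  proof -
    have "h x = g x" if x: "x \<in> nbrs w" for x
    proof (rule ccontr)
      assume "h x \<noteq> g x"
      then have "x \<in> ?D" using nb_verts(1)[OF x] by auto
      then have "w \<in> ?E" using nb_sym[OF x] by blast
      then show False using w by blast
    qed
    then have "h ` nbrs w = g ` nbrs w" by (rule image_cong[OF refl])
    also have "\<dots> = nbrs (h w)" using bspec[OF E(5), of w] eq[OF w] w by simp
    finally show ?thesis .
  qed
  ultimately show ?thesis unfolding near_def using fE by (intro exI[of _ ?E]) simp
qed

lemma near_comp:
  assumes "near g" "near h" shows "near (g \<circ> h)"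
proof -
  obtain E where E: "finite E" "inj_on g (pverts G - E)" "g ` (pverts G - E) \<subseteq> pverts G"
    "finite (pverts G - g ` (pverts G - E))" "\<forall>w\<in>pverts G - E. g ` nbrs w = nbrs (g w)"
    using assms(1) by (rule nearE)
  obtain B where B: "finite B" "inj_on h (pverts G - B)" "h ` (pverts G - B) \<subseteq> pverts G"
    "finite (pverts G - h ` (pverts G - B))" "\<forall>w\<in>pverts G - B. h ` nbrs w = nbrs (h w)"
    using assms(2) by (rule nearE)
  let ?E = "B \<union> {w \<in> pverts G. h w \<in> E}"
  have fE: "finite ?E" using B(1) near_preimage[OF assms(2) E(1)] by blast
  have h: "h w \<in> pverts G - E" "w \<in> pverts G - B" if "w \<in> pverts G - ?E" for w using that B(3) by blast+
  have "inj_on (g \<circ> h) (pverts G - ?E)"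
  proof (rule inj_onI)
    fix x y assume x: "x \<in> pverts G - ?E" and y: "y \<in> pverts G - ?E" and "(g \<circ> h) x = (g \<circ> h) y"
    then have "h x = h y" using inj_onD[OF E(2)] h(1)[OF x] h(1)[OF y] by simp
    then show "x = y" using inj_onD[OF B(2)] h(2)[OF x] h(2)[OF y] by simp
  qed
  moreover have "(g \<circ> h) ` (pverts G - ?E) \<subseteq> pverts G"
  proof
    fix y assume "y \<in> (g \<circ> h) ` (pverts G - ?E)"
    then obtain w where "w \<in> pverts G - ?E" "y = g (h w)" by auto
    then show "y \<in> pverts G" using h(1) E(3) by blast
  qed
  moreover have "finite (pverts G - (g \<circ> h) ` (pverts G - ?E))"
  proof (rule finite_subset)
    show "pverts G - (g \<circ> h) ` (pverts G - ?E) \<subseteq>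
      (pverts G - g ` (pverts G - E)) \<union> g ` (pverts G - h ` (pverts G - B))"
    proof
      fix y assume y: "y \<in> pverts G - (g \<circ> h) ` (pverts G - ?E)"
      show "y \<in> (pverts G - g ` (pverts G - E)) \<union> g ` (pverts G - h ` (pverts G - B))"
      proof (rule ccontr)
        assume n: "\<not> ?thesis"
        then obtain z where z: "z \<in> pverts G" "z \<notin> E" "y = g z" using y by blast
        then obtain w where "w \<in> pverts G" "w \<notin> B" "z = h w" using n by blast
        then have "w \<in> pverts G - ?E" "y = (g \<circ> h) w" using z by auto
        then show False using y by blast
      qed
    qed
    show "finite ((pverts G - g ` (pverts G - E)) \<union> g ` (pverts G - h ` (pverts G - B)))"
      using E(4) B(4) by simp
  qed
  moreover have "(g \<circ> h) ` nbrs w = nbrs ((g \<circ> h) w)" if "w \<in> pverts G - ?E" for w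
    using h[OF that] bspec[OF B(5), of w] bspec[OF E(5), of "h w"] by (metis comp_apply image_comp)
  ultimately show ?thesis unfolding near_def using fE by blast
qed

lemma near_inv:
  assumes "near g"
  shows "\<exists>g'. near g' \<and> almost_eq (g' \<circ> g) id \<and> almost_eq (g \<circ> g') id"
proof -
  obtain E where E: "finite E" "inj_on g (pverts G - E)" "g ` (pverts G - E) \<subseteq> pverts G"
    "finite (pverts G - g ` (pverts G - E))" "\<forall>w\<in>pverts G - E. g ` nbrs w = nbrs (g w)"
    using assms(1) by (rule nearE)
  let ?g = "inv_into (pverts G - E) g"
  \<comment> \<open>Outside \<open>?E1\<close> all neighbours of a vertex lie in the set on which
    \<open>g\<close> is injective, so the inverse function takes their images back. The exceptional
    set \<open>?E2\<close> of the inverse is the complement of the image of what remains.\<close>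
  let ?E1 = "E \<union> (\<Union>v\<in>E. nbrs v)"
  let ?E2 = "pverts G - g ` (pverts G - ?E1)"
  have gg: "?g (g w) = w" if "w \<in> pverts G - E" for w using inv_into_f_f[OF E(2) that] .
  have fE1: "finite ?E1" using E(1) finite_nb by blast
  have fE2: "finite ?E2" using finite_range_compl[OF E(4) fE1] by blast
  have V2: "pverts G - ?E2 = g ` (pverts G - ?E1)" using E(3) by blast
  have gim: "?g ` g ` A = A" if "A \<subseteq> pverts G - E" for A
    using gg that by (force simp: image_image subset_iff)
  have "inj_on ?g (pverts G - ?E2)" unfolding V2
    by (rule inj_on_inv_into) blast
  moreover have im: "?g ` (pverts G - ?E2) = pverts G - ?E1" unfolding V2 by (rule gim) blast
  moreover have "?g ` nbrs y = nbrs (?g y)" if "y \<in> pverts G - ?E2" for y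
  proof -
    obtain w where w: "w \<in> pverts G" "w \<notin> ?E1" "y = g w" using \<open>y \<in> _\<close> unfolding V2 by blast
    have "nbrs w \<subseteq> pverts G - E" using w(2) nb_sym nb_verts(1) by blast
    then have "?g ` g ` nbrs w = nbrs w" by (rule gim)
    then show ?thesis using bspec[OF E(5), of w] w gg[of w] by simp
  qed
  ultimately have "near ?g" unfolding near_def
    using fE2 finite_subset[OF _ fE1] by (intro exI[of _ ?E2]) (auto simp: Diff_Diff_Int)
  moreover have "almost_eq (?g \<circ> g) id" unfolding almost_eq_def
    by (rule finite_subset[OF _ E(1)]) (use gg in auto)
  moreover have "almost_eq (g \<circ> ?g) id" unfolding almost_eq_def
    by (rule finite_subset[OF _ E(4)]) (auto simp: f_inv_into_f)
  ultimately show ?thesis by blast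
qed

lemma near_id: "near id"
  unfolding near_def by (intro exI[of _ "{}"]) simp

lemma almost_eq_sym: "almost_eq g h \<Longrightarrow> almost_eq h g" by (simp add: almost_eq_def eq_commute)

lemma almost_eq_trans: "almost_eq f g \<Longrightarrow> almost_eq g h \<Longrightarrow> almost_eq f h"
proof -
  assume a: "almost_eq f g" "almost_eq g h"
  have "{v \<in> pverts G. f v \<noteq> h v} \<subseteq> {v \<in> pverts G. f v \<noteq> g v} \<union> {v \<in> pverts G. g v \<noteq> h v}" by auto
  then show ?thesis using a unfolding almost_eq_def by (meson finite_Un finite_subset)
qed

end

section \<open>The group of almost automorphisms\<close>

context branching_tree
begin

definition is_honest :: "('v \<rightharpoonup> 'v) \<Rightarrow> bool" where
  "is_honest \<theta> \<longleftrightarrow> (\<exists>T1 T2. honest T1 T2 \<theta>)"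

definition forest_map :: "'v set \<Rightarrow> ('v \<Rightarrow> 'v) \<Rightarrow> ('v \<rightharpoonup> 'v)" where
  "forest_map C g = (\<lambda>v. if v \<in> pverts G - C then Some (g v) else None)"

text \<open>
  Almost automorphisms are represented by total functions on the vertices, considered up to
  finitely many values.
\<close>

definition cls :: "('v \<Rightarrow> 'v) \<Rightarrow> ('v \<rightharpoonup> 'v) set" where
  "cls g = {\<theta>. is_honest \<theta> \<and> almost_eq \<theta> (Some \<circ> g)}"

lemma honestE:
  assumes "honest T1 T2 \<theta>"
  obtains C1 C2 where "ancestor_closed C1" "ancestor_closed C2" "T1 = span_tree C1" "T2 = span_tree C2"
    "dom \<theta> = pverts G - C1" "ran \<theta> = pverts G - C2" "inj_on \<theta> (pverts G - C1)"
    "\<And>u w. u \<in> pverts G - C1 \<Longrightarrow> w \<in> pverts G - C1 \<Longrightarrow> w \<in> nbrs u \<longleftrightarrow> the (\<theta> w) \<in> nbrs (the (\<theta> u))"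
proof -
  obtain C1 C2 where C: "ancestor_closed C1" "ancestor_closed C2" "T1 = span_tree C1" "T2 = span_tree C2"
    using assms complete_span_tree_ex unfolding honest_def by metis
  have i: "inj_on \<theta> (dom \<theta>)" using assms unfolding honest_def by blast
  have D': "dom \<theta> = pverts G - C1" "ran \<theta> = pverts G - C2"
    using assms forest_verts_span_tree[OF C(1)] forest_verts_span_tree[OF C(2)]
    unfolding honest_def C(3,4) by simp_all
  have D: "dom \<theta> = pverts G - C1" "ran \<theta> = pverts G - C2" "inj_on \<theta> (pverts G - C1)"
    using i D' unfolding D'(1) by simp_all
  have "w \<in> nbrs u \<longleftrightarrow> the (\<theta> w) \<in> nbrs (the (\<theta> u))"
    if u: "u \<in> pverts G - C1" and w: "w \<in> pverts G - C1" for u w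
  proof -
    have "(u, w) \<in> forest_arcs T1 \<longleftrightarrow> (the (\<theta> u), the (\<theta> w)) \<in> forest_arcs T2"
      using assms u w D(1) unfolding honest_def by blast
    moreover have "u \<in> dom \<theta>" "w \<in> dom \<theta>" using u w D(1) by blast+
    then have "the (\<theta> u) \<in> ran \<theta>" "the (\<theta> w) \<in> ran \<theta>" by (auto intro: ranI)
    ultimately show ?thesis
      using u w D(2) unfolding C(3,4) forest_arcs_span_tree[OF C(1)] forest_arcs_span_tree[OF C(2)] by auto
  qed
  then show ?thesis using that C D by blast
qed

text \<open>Honesty only says that neighbours correspond within the forest. Away from the removed
  vertices and their neighbours all \<open>d + 1\<close> neighbours of a vertex are in the forest,
  and an injective map into the \<open>d + 1\<close> neighbours of the image is onto.\<close>

lemma honest_near: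
  assumes "is_honest \<theta>"
  shows "near (the \<circ> \<theta>)" "almost_eq \<theta> (Some \<circ> (the \<circ> \<theta>))"
proof -
  obtain T1 T2 where "honest T1 T2 \<theta>" using assms by (auto simp: is_honest_def)
  then obtain C1 C2 where C: "ancestor_closed C1" "ancestor_closed C2"
    and D: "dom \<theta> = pverts G - C1" "ran \<theta> = pverts G - C2" "inj_on \<theta> (pverts G - C1)"
    and A: "\<And>u w. u \<in> pverts G - C1 \<Longrightarrow> w \<in> pverts G - C1 \<Longrightarrow> w \<in> nbrs u \<longleftrightarrow> the (\<theta> w) \<in> nbrs (the (\<theta> u))"
    by (rule honestE) blast
  let ?g = "the \<circ> \<theta>"
  have some: "\<theta> v = Some (?g v)" if "v \<in> pverts G - C1" for v using that D(1) by force
  have im: "?g ` (pverts G - C1) = pverts G - C2"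
    unfolding D(1)[symmetric] D(2)[symmetric] by (force simp: ran_def dom_def)
  have inj: "inj_on ?g (pverts G - C1)"
  proof (rule inj_onI)
    fix x y assume x: "x \<in> pverts G - C1" and y: "y \<in> pverts G - C1" and "?g x = ?g y"
    then have "\<theta> x = \<theta> y" using some by metis
    then show "x = y" using inj_onD[OF D(3)] x y by blast
  qed
  let ?E = "C1 \<union> (\<Union>v\<in>C1. nbrs v)"
  have fE: "finite ?E" using ancestor_closedD(1)[OF C(1)] finite_nb by blast
  have "?g ` nbrs w = nbrs (?g w)" if w: "w \<in> pverts G - ?E" for w
  proof (rule card_subset_eq)
    have nw: "nbrs w \<subseteq> pverts G - C1" using w nb_sym nb_verts(1) by blast
    have gw: "?g w \<in> pverts G" using im w by blast
    show "finite (nbrs (?g w))" by (rule finite_nb)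
    show "?g ` nbrs w \<subseteq> nbrs (?g w)" using A nw w by auto
    have "card (?g ` nbrs w) = card (nbrs w)" using inj nw by (meson card_image inj_on_subset)
    then show "card (?g ` nbrs w) = card (nbrs (?g w))" using card_nb gw w by simp
  qed
  moreover have "inj_on ?g (pverts G - ?E)" using inj by (rule inj_on_subset) blast
  moreover have "?g ` (pverts G - ?E) \<subseteq> pverts G" using im by blast
  moreover have "finite (pverts G - ?g ` (pverts G - C1))"
    unfolding im by (rule finite_subset[OF _ ancestor_closedD(1)[OF C(2)]]) blast
  then have "finite (pverts G - ?g ` (pverts G - ?E))"
    using finite_range_compl[OF _ fE] by blast
  ultimately show "near ?g" unfolding near_def using fE by blast
  show "almost_eq \<theta> (Some \<circ> ?g)" unfolding almost_eq_def
    by (rule finite_subset[OF _ ancestor_closedD(1)[OF C(1)]]) (use some in force)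
qed

lemma honestI:
  assumes C: "ancestor_closed C" "ancestor_closed C'"
    and g: "inj_on g (pverts G - C)" "g ` (pverts G - C) = pverts G - C'"
    and A: "\<And>u w. u \<in> pverts G - C \<Longrightarrow> w \<in> pverts G - C \<Longrightarrow> w \<in> nbrs u \<longleftrightarrow> g w \<in> nbrs (g u)"
  shows "honest (span_tree C) (span_tree C') (forest_map C g)"
proof -
  have dom: "dom (forest_map C g) = pverts G - C" by (auto simp: forest_map_def dom_def)
  have ran: "ran (forest_map C g) = pverts G - C'"
    unfolding g(2)[symmetric] by (auto simp: forest_map_def ran_def split: if_splits)
  have r: "forest_map C g u = Some (g u)" if "u \<in> pverts G - C" for u using that by (simp add: forest_map_def)
  have "inj_on (forest_map C g) (pverts G - C)"
    using inj_onD[OF g(1)] r by (auto intro!: inj_onI)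
  moreover have "(u, w) \<in> forest_arcs (span_tree C) \<longleftrightarrow>
      (the (forest_map C g u), the (forest_map C g w)) \<in> forest_arcs (span_tree C')"
    if "u \<in> pverts G - C" "w \<in> pverts G - C" for u w
  proof -
    have "g u \<notin> C'" "g w \<notin> C'" using g(2) that by blast+
    then show ?thesis
      using A[OF that] r that unfolding forest_arcs_span_tree[OF C(1)] forest_arcs_span_tree[OF C(2)]
      by simp
  qed
  ultimately show ?thesis
    unfolding honest_def dom ran forest_verts_span_tree[OF C(1)] forest_verts_span_tree[OF C(2)]
    using span_tree_complete C by simp
qed

lemma good_honest:
  assumes "good g C" "ancestor_closed C'" "g ` (pverts G - C) = pverts G - C'"
  shows "honest (span_tree C) (span_tree C') (forest_map C g)"
proof (rule honestI[OF goodD(1)[OF assms(1)] assms(2) goodD(3)[OF assms(1)] assms(3)])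
  fix u w assume u: "u \<in> pverts G - C" and w: "w \<in> pverts G - C"
  have *: "g y \<in> children (g x) \<longleftrightarrow> y \<in> children x" if x: "x \<in> pverts G - C" and y: "y \<in> pverts G - C" for x y
  proof -
    have "children x \<subseteq> pverts G - C"
      using ancestor_closedD(4)[OF goodD(1)[OF assms(1)]] x children_verts(1) by blast
    moreover have "g ` children x = children (g x)" using goodD(6)[OF assms(1)] x by blast
    ultimately show ?thesis using goodD(3)[OF assms(1)] y by (metis inj_on_image_mem_iff)
  qed
  have **: "y \<in> nbrs x \<longleftrightarrow> y \<in> children x \<or> x \<in> children y" for x y
    using nb_cases[of y x] nb_sym[of x y] nb_cases[of x y] nb_sym[of y x] parent_props(4)[of x] by blast
  show "w \<in> nbrs u \<longleftrightarrow> g w \<in> nbrs (g u)" unfolding ** using *[OF u w] *[OF w u] by blast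
qed

lemma good_hon: "good g C \<Longrightarrow> is_honest (forest_map C g)"
  using good_range[of g C] good_honest[of g C] unfolding is_honest_def by metis

lemma forest_map_almost_eq: "finite C \<Longrightarrow> almost_eq (forest_map C g) (Some \<circ> g)"
  unfolding almost_eq_def forest_map_def by (rule finite_subset[of _ C]) auto

lemma good_restr_cls: "good g C \<Longrightarrow> forest_map C g \<in> cls g"
  unfolding cls_def using good_hon forest_map_almost_eq goodD(9) by blast

lemma almost_eq_Some: "almost_eq (Some \<circ> g) (Some \<circ> h) \<longleftrightarrow> almost_eq g h"
  by (simp add: almost_eq_def)

lemma cls_nonempty: "near g \<Longrightarrow> \<exists>C. good g C \<and> forest_map C g \<in> cls g"
  using near_good good_restr_cls by blast

lemma cls_almost_eq: "almost_eq g h \<Longrightarrow> cls g = cls h"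
  unfolding cls_def using almost_eq_trans almost_eq_sym almost_eq_Some by blast

text \<open>Every finite set of vertices lies in the interior of some complete subtree, so agreement
  beyond a complete subtree is agreement up to finitely many vertices.\<close>

lemma honest_equiv_iff:
  "(\<phi>, \<psi>) \<in> honest_equiv \<longleftrightarrow> is_honest \<phi> \<and> is_honest \<psi> \<and> almost_eq \<phi> \<psi>"
proof
  assume "(\<phi>, \<psi>) \<in> honest_equiv"
  then obtain T where h: "is_honest \<phi>" "is_honest \<psi>" and T: "complete_subtree T" "\<forall>v\<in>forest_verts T. \<phi> v = \<psi> v"
    unfolding honest_equiv_def is_honest_def by blast
  obtain C where C: "ancestor_closed C" "T = span_tree C" using complete_span_tree_ex T by blast
  have "{v \<in> pverts G. \<phi> v \<noteq> \<psi> v} \<subseteq> C" using T(2) forest_verts_span_tree[OF C(1)] C(2) by blast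
  then have "almost_eq \<phi> \<psi>" unfolding almost_eq_def using ancestor_closedD(1)[OF C(1)] finite_subset by blast
  then show "is_honest \<phi> \<and> is_honest \<psi> \<and> almost_eq \<phi> \<psi>" using h by blast
next
  assume "is_honest \<phi> \<and> is_honest \<psi> \<and> almost_eq \<phi> \<psi>"
  then obtain T1 T2 T1' T2' where h: "honest T1 T2 \<phi>" "honest T1' T2' \<psi>" and a: "almost_eq \<phi> \<psi>"
    unfolding is_honest_def by blast
  let ?A = "T1 \<union> T1' \<union> {v \<in> pverts G. \<phi> v \<noteq> \<psi> v}"
  have A: "finite ?A" "?A \<subseteq> pverts G"
    using h a unfolding honest_def complete_subtree_def almost_eq_def by auto
  obtain C where C: "ancestor_closed C" "?A \<subseteq> C" "v0 \<in> C" using closure_ex[OF A] by (elim exE conjE) (rule that)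
  have "C \<subseteq> span_tree C" by (auto simp: span_tree_def)
  then have "T1 \<union> T1' \<subseteq> span_tree C" using C(2) by blast
  moreover have "\<phi> v = \<psi> v" if "v \<in> forest_verts (span_tree C)" for v
    using that C(2) unfolding forest_verts_span_tree[OF C(1)] by blast
  ultimately show "(\<phi>, \<psi>) \<in> honest_equiv"
    unfolding honest_equiv_def using h span_tree_complete[OF C(1)] by blast
qed

section \<open>The group of classes and the embedding of automorphisms\<close>

lemma class_cls: "\<phi> \<in> cls g \<Longrightarrow> honest_equiv `` {\<phi>} = cls g"
  unfolding cls_def Image_singleton honest_equiv_iff using almost_eq_trans almost_eq_sym by blast

lemma carrier_AAut: "carrier AAut = {cls g | g. near g}"
proof
  show "carrier AAut \<subseteq> {cls g | g. near g}"
  proof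
    fix X assume "X \<in> carrier AAut"
    then obtain \<phi> where "is_honest \<phi>" "X = honest_equiv `` {\<phi>}"
      unfolding AAut_def is_honest_def by (auto elim!: quotientE)
    then show "X \<in> {cls g | g. near g}"
      using honest_near[of \<phi>] class_cls[of \<phi> "the \<circ> \<phi>"] unfolding cls_def by blast
  qed
  show "{cls g | g. near g} \<subseteq> carrier AAut"
  proof clarify
    fix g assume "near g"
    then obtain C where C: "good g C" "forest_map C g \<in> cls g" using cls_nonempty by blast
    then show "cls g \<in> carrier AAut"
      using class_cls[OF C(2)] good_hon[OF C(1)]
        quotientI[of "forest_map C g" "{\<phi>. \<exists>T1 T2. honest T1 T2 \<phi>}" honest_equiv]
      by (simp add: AAut_def is_honest_def)
  qed
qed

text \<open>Supplies composable representatives. The domain of \<open>h\<close> is shrunk until its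
  image avoids the exceptional set of \<open>g\<close>; the domain of \<open>g\<close> is then
  shrunk to exactly that image.\<close>

lemma good_comp_ex:
  assumes "near g" "near h" "finite A"
  shows "\<exists>B C. good h B \<and> good g C \<and> h ` (pverts G - B) = pverts G - C \<and> A \<inter> pverts G \<subseteq> B"
proof -
  obtain C where C: "good g C" using near_good assms by blast
  have "finite (A \<union> {w \<in> pverts G. h w \<in> C})" using near_preimage[OF assms(2) goodD(9)[OF C]] assms(3) by blast
  then obtain B where B: "good h B" "(A \<union> {w \<in> pverts G. h w \<in> C}) \<inter> pverts G \<subseteq> B"
    using good_ex[OF assms(2)] by blast
  obtain C' where C': "ancestor_closed C'" "v0 \<in> C'" "h ` (pverts G - B) = pverts G - C'"
    using good_range[OF B(1)] .
  have "h w \<notin> C" if "w \<in> pverts G - B" for w using that B(2) by blast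
  then have "h ` (pverts G - B) \<inter> C = {}" by blast
  then have "C \<subseteq> C'" using goodD(10)[OF C] unfolding C'(3) by blast
  then have "good g C'" using good_mono[OF C C'(1)] by blast
  then show ?thesis using B C'(3) by (rule_tac exI[of _ B], rule_tac exI[of _ C']) blast
qed

lemma cls_mult:
  assumes g: "near g" and h: "near h"
  shows "cls g \<otimes>\<^bsub>AAut\<^esub> cls h = cls (g \<circ> h)"
proof
  show "cls g \<otimes>\<^bsub>AAut\<^esub> cls h \<subseteq> cls (g \<circ> h)"
  proof
    fix \<theta> assume "\<theta> \<in> cls g \<otimes>\<^bsub>AAut\<^esub> cls h"
    then obtain \<phi> \<psi> where p: "\<phi> \<in> cls g" "\<psi> \<in> cls h" "(\<phi> \<circ>\<^sub>m \<psi>, \<theta>) \<in> honest_equiv"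
      unfolding AAut_def by auto
    let ?D = "{v \<in> pverts G. \<phi> v \<noteq> Some (g v)}"
    have fD: "finite ?D" using p(1) by (simp add: cls_def almost_eq_def)
    \<comment> \<open>The third exceptional set is there because closeness of \<phi> to
      \<open>g\<close> says nothing at arguments that are not vertices.\<close>
    have "{v \<in> pverts G. (\<phi> \<circ>\<^sub>m \<psi>) v \<noteq> Some (g (h v))} \<subseteq>
      {v \<in> pverts G. \<psi> v \<noteq> Some (h v)} \<union> {v \<in> pverts G. h v \<in> ?D} \<union> {v \<in> pverts G. h v \<notin> pverts G}"
      by (auto simp: map_comp_def)
    moreover have "finite {v \<in> pverts G. \<psi> v \<noteq> Some (h v)}" using p(2) by (simp add: cls_def almost_eq_def)
    ultimately have "almost_eq (\<phi> \<circ>\<^sub>m \<psi>) (Some \<circ> (g \<circ> h))"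
      using near_preimage[OF h fD] near_verts[OF h] unfolding almost_eq_def comp_def
      by (meson finite_Un finite_subset)
    then show "\<theta> \<in> cls (g \<circ> h)"
      using p(3) almost_eq_trans almost_eq_sym unfolding honest_equiv_iff cls_def by blast
  qed
  show "cls (g \<circ> h) \<subseteq> cls g \<otimes>\<^bsub>AAut\<^esub> cls h"
  proof
    fix \<theta> assume t: "\<theta> \<in> cls (g \<circ> h)"
    obtain B C where BC: "good h B" "good g C" "h ` (pverts G - B) = pverts G - C"
      using good_comp_ex[OF g h finite.emptyI] by blast
    let ?\<phi> = "forest_map C g" and ?\<psi> = "forest_map B h"
    have "dom ?\<phi> = pverts G - C" by (auto simp: forest_map_def dom_def)
    moreover have "ran ?\<psi> = h ` (pverts G - B)" by (auto simp: forest_map_def ran_def split: if_splits)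
    ultimately have "dom ?\<phi> = ran ?\<psi>" using BC(3) by simp
    have c: "?\<phi> \<circ>\<^sub>m ?\<psi> = forest_map B (g \<circ> h)"
    proof
      fix v
      have "h v \<in> pverts G - C" if "v \<in> pverts G - B" using that BC(3) by blast
      then show "(?\<phi> \<circ>\<^sub>m ?\<psi>) v = forest_map B (g \<circ> h) v" by (simp add: forest_map_def map_comp_def)
    qed
    obtain C' where C': "ancestor_closed C'" "v0 \<in> C'" "g ` (pverts G - C) = pverts G - C'"
      using good_range[OF BC(2)] .
    have im: "(g \<circ> h) ` (pverts G - B) = pverts G - C'" using BC(3) C'(3) by (metis image_comp)
    have "good (g \<circ> h) B" unfolding good_def
    proof (intro conjI ballI)
      show "ancestor_closed B" "v0 \<in> B" using goodD[OF BC(1)] by blast+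
      show "inj_on (g \<circ> h) (pverts G - B)" using goodD(3)[OF BC(1)] goodD(3)[OF BC(2)] BC(3)
        by (simp add: comp_inj_on)
      show "(g \<circ> h) ` (pverts G - B) \<subseteq> pverts G" using im by blast
      show "finite (pverts G - (g \<circ> h) ` (pverts G - B))" unfolding im
        by (rule finite_subset[OF _ ancestor_closedD(1)[OF C'(1)]]) blast
      fix w assume w: "w \<in> pverts G - B"
      then have "h w \<in> pverts G - C" using BC(3) by blast
      then show "(g \<circ> h) ` children w = children ((g \<circ> h) w)"
        using goodD(6)[OF BC(1), of w] goodD(6)[OF BC(2), of "h w"] w
        unfolding image_comp[symmetric] comp_apply by simp
    qed
    then have "forest_map B (g \<circ> h) \<in> cls (g \<circ> h)" by (rule good_restr_cls)
    then have "(?\<phi> \<circ>\<^sub>m ?\<psi>, \<theta>) \<in> honest_equiv"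
      using t class_cls[of "forest_map B (g \<circ> h)" "g \<circ> h"] unfolding c by blast
    moreover have "?\<phi> \<in> cls g" "?\<psi> \<in> cls h" using good_restr_cls BC by blast+
    ultimately show "\<theta> \<in> cls g \<otimes>\<^bsub>AAut\<^esub> cls h"
      unfolding AAut_def using \<open>dom ?\<phi> = ran ?\<psi>\<close> by auto
  qed
qed

lemma Aut_hon:
  assumes "g \<in> Aut" shows "is_honest (forest_map {} g)"
proof -
  have b: "bij_betw g (pverts G) (pverts G)" using assms by (simp add: Aut_def Bij_def)
  have "honest (span_tree {}) (span_tree {}) (forest_map {} g)"
  proof (rule honestI)
    show "ancestor_closed {}" "ancestor_closed {}" by (simp_all add: ancestor_closed_def)
    show "inj_on g (pverts G - {})" "g ` (pverts G - {}) = pverts G - {}"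
      using b by (simp_all add: bij_betw_def)
    show "w \<in> nbrs u \<longleftrightarrow> g w \<in> nbrs (g u)" if "u \<in> pverts G - {}" "w \<in> pverts G - {}" for u w
      using assms that by (simp add: Aut_def nbrs_def)
  qed
  then show ?thesis unfolding is_honest_def by blast
qed

lemma Aut_near: assumes "g \<in> Aut" shows "near g"
proof -
  have "almost_eq (the \<circ> forest_map {} g) g" unfolding almost_eq_def by (simp add: forest_map_def)
  then show ?thesis using honest_near(1)[OF Aut_hon[OF assms]] near_almost_eq by blast
qed

lemma embed_cls: "g \<in> Aut \<Longrightarrow> embed g = cls g"
proof -
  assume g: "g \<in> Aut"
  have "forest_map {} g = (\<lambda>v. if v \<in> pverts G then Some (g v) else None)" by (simp add: forest_map_def)
  then have "embed g = honest_equiv `` {forest_map {} g}" by (simp add: embed_def)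
  also have "\<dots> = cls g"
    by (rule class_cls) (use Aut_hon[OF g] forest_map_almost_eq[of "{}"] in \<open>simp add: cls_def\<close>)
  finally show ?thesis .
qed

lemma id_Aut: "(\<lambda>v\<in>pverts G. v) \<in> Aut"
  by (simp add: Aut_def id_Bij)

lemma one_AAut: "\<one>\<^bsub>AAut\<^esub> = cls id"
proof -
  have "almost_eq (\<lambda>v\<in>pverts G. v) id" by (simp add: almost_eq_def)
  then show ?thesis using embed_cls[OF id_Aut] cls_almost_eq by (simp add: AAut_def)
qed

lemma AAut_group: "group AAut"
proof (rule groupI)
  fix X Y assume "X \<in> carrier AAut" "Y \<in> carrier AAut"
  then show "X \<otimes>\<^bsub>AAut\<^esub> Y \<in> carrier AAut"
    unfolding carrier_AAut using cls_mult near_comp by blast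
next
  show "\<one>\<^bsub>AAut\<^esub> \<in> carrier AAut" unfolding carrier_AAut one_AAut using near_id by blast
next
  fix X Y Z assume "X \<in> carrier AAut" "Y \<in> carrier AAut" "Z \<in> carrier AAut"
  then obtain f g h where "X = cls f" "near f" "Y = cls g" "near g" "Z = cls h" "near h"
    unfolding carrier_AAut by blast
  then show "(X \<otimes>\<^bsub>AAut\<^esub> Y) \<otimes>\<^bsub>AAut\<^esub> Z = X \<otimes>\<^bsub>AAut\<^esub> (Y \<otimes>\<^bsub>AAut\<^esub> Z)"
    by (simp add: cls_mult near_comp comp_assoc)
next
  fix X assume "X \<in> carrier AAut"
  then obtain g where g: "X = cls g" "near g" unfolding carrier_AAut by blast
  then show "\<one>\<^bsub>AAut\<^esub> \<otimes>\<^bsub>AAut\<^esub> X = X" by (simp add: one_AAut cls_mult near_id)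
  obtain g' where "near g'" "almost_eq (g' \<circ> g) id" using near_inv[OF g(2)] by blast
  then have "cls g' \<otimes>\<^bsub>AAut\<^esub> X = \<one>\<^bsub>AAut\<^esub>" using g by (simp add: one_AAut cls_mult cls_almost_eq)
  then show "\<exists>Y\<in>carrier AAut. Y \<otimes>\<^bsub>AAut\<^esub> X = \<one>\<^bsub>AAut\<^esub>"
    using \<open>near g'\<close> unfolding carrier_AAut by blast
qed

section \<open>Subgroups given by a local condition at almost all vertices\<close>

definition mostly :: "(('v \<Rightarrow> 'v) \<Rightarrow> 'v \<Rightarrow> bool) \<Rightarrow> ('v \<rightharpoonup> 'v) set set" where
  "mostly P = {cls g | g. near g \<and> finite {w \<in> pverts G. \<not> P g w}}"

text \<open>A product satisfies the condition vertex by vertex, apart from the preimages of finitely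
  many exceptions. The clause on inverses speaks of whole maps, because the condition for
  \<open>g'\<close> at a vertex has to be read off from \<open>g\<close> around its preimage;
  \<open>near_inv_local\<close> does this.\<close>

lemma mostly_subgroup:
  assumes one: "finite {w \<in> pverts G. \<not> P id w}"
    and mult: "\<And>g h w. w \<in> pverts G \<Longrightarrow> h w \<in> pverts G \<Longrightarrow> P h w \<Longrightarrow> P g (h w) \<Longrightarrow> P (g \<circ> h) w"
    and inv: "\<And>g g'. near g \<Longrightarrow> near g' \<Longrightarrow> almost_eq (g \<circ> g') id \<Longrightarrow> almost_eq (g' \<circ> g) id \<Longrightarrow>
      finite {w \<in> pverts G. \<not> P g w} \<Longrightarrow> finite {w \<in> pverts G. \<not> P g' w}"
  shows "subgroup (mostly P) AAut"
proof -
  interpret A: group AAut by (rule AAut_group)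
  show ?thesis
  proof (rule A.subgroupI)
    show "mostly P \<subseteq> carrier AAut" unfolding mostly_def carrier_AAut by blast
    show "mostly P \<noteq> {}" unfolding mostly_def using one near_id by blast
    fix X assume "X \<in> mostly P"
    then obtain g where g: "X = cls g" "near g" "finite {w \<in> pverts G. \<not> P g w}"
      unfolding mostly_def by blast
    obtain g' where g': "near g'" "almost_eq (g' \<circ> g) id" "almost_eq (g \<circ> g') id" using near_inv[OF g(2)] by blast
    have "inv\<^bsub>AAut\<^esub> X = cls g'"
    proof (rule A.inv_equality)
      show "cls g' \<otimes>\<^bsub>AAut\<^esub> X = \<one>\<^bsub>AAut\<^esub>" using g g' by (simp add: one_AAut cls_mult cls_almost_eq)
    qed (use g g' in \<open>auto simp: carrier_AAut\<close>)
    then show "inv\<^bsub>AAut\<^esub> X \<in> mostly P"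
      unfolding mostly_def using g'(1) inv[OF g(2) g'(1,3,2) g(3)] by blast
    fix Y assume "Y \<in> mostly P"
    then obtain h where h: "Y = cls h" "near h" "finite {w \<in> pverts G. \<not> P h w}"
      unfolding mostly_def by blast
    have "{w \<in> pverts G. \<not> P (g \<circ> h) w} \<subseteq> {w \<in> pverts G. \<not> P h w} \<union> {w \<in> pverts G. h w \<notin> pverts G}
      \<union> {w \<in> pverts G. h w \<in> {w \<in> pverts G. \<not> P g w}}" using mult by blast
    then have "finite {w \<in> pverts G. \<not> P (g \<circ> h) w}"
      using h(3) near_verts[OF h(2)] near_preimage[OF h(2) g(3)] by (meson finite_Un finite_subset)
    then show "X \<otimes>\<^bsub>AAut\<^esub> Y \<in> mostly P"
      unfolding mostly_def using g h cls_mult near_comp by blast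
  qed
qed

end

section \<open>Words and prefix exchanges\<close>

text \<open>
  A vertex of the tree is coded by the word of the normalised colours along the path from the root.
  The label of a vertex is the orbit \<open>orb\<close> of its last letter, and the only letter that is not
  allowed after \<open>a\<close> is the reference colour \<open>rf a\<close>, the colour of the edge to the parent.
\<close>

locale typed_words =
  fixes d :: nat and orb :: "nat \<Rightarrow> nat set" and rf :: "nat \<Rightarrow> nat"
  assumes d_ge_2: "d \<ge> 2"
    and orb_self: "c \<le> d \<Longrightarrow> c \<in> orb c"
    and orb_le: "c \<le> d \<Longrightarrow> c' \<in> orb c \<Longrightarrow> c' \<le> d"
    and orb_eq: "c \<le> d \<Longrightarrow> c' \<in> orb c \<Longrightarrow> orb c' = orb c"
    and rf_orb: "c \<le> d \<Longrightarrow> rf c \<in> orb c"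
    and rf_cong: "c \<le> d \<Longrightarrow> c' \<le> d \<Longrightarrow> orb c = orb c' \<Longrightarrow> rf c = rf c'"
begin

definition W :: "nat list set" where
  "W = {w. set w \<subseteq> {0..d} \<and> successively (\<lambda>a b. b \<noteq> rf a) w}"

definition lab :: "nat list \<Rightarrow> nat set" where
  "lab w = orb (last w)"

lemma W_append: "u @ x \<in> W \<longleftrightarrow> u \<in> W \<and> x \<in> W \<and> (u = [] \<or> x = [] \<or> hd x \<noteq> rf (last u))"
  by (auto simp: W_def successively_append_iff)

lemma W_last: "u \<in> W \<Longrightarrow> u \<noteq> [] \<Longrightarrow> last u \<le> d"
  using last_in_set by (fastforce simp: W_def)

lemma W_snoc: "u \<in> W \<Longrightarrow> u \<noteq> [] \<Longrightarrow> u @ [c] \<in> W \<longleftrightarrow> c \<le> d \<and> c \<noteq> rf (last u)"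
  unfolding W_append by (auto simp: W_def)

lemma W_single: "[c] \<in> W \<longleftrightarrow> c \<le> d"
  by (simp add: W_def)

lemma W_Nil [simp]: "[] \<in> W"
  by (simp add: W_def)

lemma W_prefix: "w \<in> W \<Longrightarrow> prefix u w \<Longrightarrow> u \<in> W"
  by (auto simp: prefix_def W_append)

text \<open>Which letters may follow a nonempty word depends only on its label, since
  \<open>rf\<close> is constant on orbits.\<close>

lemma W_replace:
  assumes "u @ x \<in> W" "v \<in> W" "u \<noteq> []" "v \<noteq> []" "lab u = lab v"
  shows "v @ x \<in> W"
proof -
  have "u \<in> W" using assms(1) W_append by blast
  then have "rf (last u) = rf (last v)" using rf_cong W_last assms by (simp add: lab_def)
  then show ?thesis using assms by (auto simp: W_append)
qed

lemma lab_append: "u \<noteq> [] \<Longrightarrow> v \<noteq> [] \<Longrightarrow> lab u = lab v \<Longrightarrow> lab (u @ x) = lab (v @ x)"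
  by (cases "x = []") (simp_all add: lab_def)

text \<open>The infinitesimal form of a prefix replacement: if it holds at \<open>w\<close> and at
  all words that extend \<open>w\<close>, then \<open>g\<close> replaces the prefix \<open>w\<close>
  by \<open>g w\<close>.\<close>

definition canonical_at :: "(nat list \<Rightarrow> nat list) \<Rightarrow> nat list \<Rightarrow> bool" where
  "canonical_at g w \<longleftrightarrow> w \<noteq> [] \<and> g w \<noteq> [] \<and> g w \<in> W \<and> lab (g w) = lab w \<and>
     (\<forall>c. w @ [c] \<in> W \<longrightarrow> g (w @ [c]) = g w @ [c])"

lemma canonical_at_comp: "w \<in> W \<Longrightarrow> canonical_at h w \<Longrightarrow> canonical_at g (h w) \<Longrightarrow> canonical_at (g \<circ> h) w"
  unfolding canonical_at_def using W_replace by auto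

section \<open>Exchanges of two disjoint subtrees\<close>

definition swappable :: "nat list \<Rightarrow> nat list \<Rightarrow> bool" where
  "swappable u v \<longleftrightarrow> u \<in> W \<and> v \<in> W \<and> u \<noteq> [] \<and> v \<noteq> [] \<and> parallel u v \<and> lab u = lab v"

definition swap :: "nat list \<Rightarrow> nat list \<Rightarrow> nat list \<Rightarrow> nat list" where
  "swap u v w = (if prefix u w then v @ drop (length u) w
     else if prefix v w then u @ drop (length v) w else w)"

lemma swap_left [simp]: "swap u v (u @ x) = v @ x"
  by (simp add: swap_def)

lemma par_prefix: "parallel u v \<Longrightarrow> prefix u w \<Longrightarrow> \<not> prefix v w"
  using prefix_same_cases by blast

lemma swap_right: "parallel u v \<Longrightarrow> swap u v (v @ x) = u @ x"
  using par_prefix[of u v "v @ x"] by (auto simp: swap_def)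

lemma swap_other: "\<not> prefix u w \<Longrightarrow> \<not> prefix v w \<Longrightarrow> swap u v w = w"
  by (simp add: swap_def)

lemma swap_cases:
  obtains x where "w = u @ x" | x where "w = v @ x" | "\<not> prefix u w" "\<not> prefix v w"
  by (meson prefixE)

lemma swap_swap: "parallel u v \<Longrightarrow> swap u v (swap u v w) = w"
  by (rule swap_cases[where w = w and u = u and v = v]) (auto simp: swap_right swap_other)

lemma swap_commute: "parallel u v \<Longrightarrow> swap u v = swap v u"
  using par_prefix[of u v] by (auto simp: swap_def fun_eq_iff)

lemma swappable_sym: "swappable u v \<Longrightarrow> swappable v u"
  by (auto simp: swappable_def)

lemma swap_W:
  assumes "swappable u v" "w \<in> W" shows "swap u v w \<in> W"
proof (rule swap_cases[where w = w and u = u and v = v])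
  fix x assume "w = u @ x"
  then show ?thesis using assms W_replace[of u x v] by (simp add: swappable_def)
next
  fix x assume "w = v @ x"
  then show ?thesis using assms W_replace[of v x u] by (simp add: swappable_def swap_right)
qed (use assms in \<open>simp add: swap_other\<close>)

lemma swap_ne: "swappable u v \<Longrightarrow> swap u v w = [] \<longleftrightarrow> w = []"
  by (rule swap_cases[where w = w and u = u and v = v]) (auto simp: swappable_def swap_right swap_other)

lemma swap_lab:
  assumes "swappable u v" shows "lab (swap u v w) = lab w"
proof (rule swap_cases[where w = w and u = u and v = v])
  fix x assume "w = u @ x"
  then show ?thesis using assms lab_append[of u v x] by (simp add: swappable_def)
next
  fix x assume "w = v @ x"
  then show ?thesis using assms lab_append[of u v x] by (simp add: swappable_def swap_right)
qed (simp add: swap_other)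

text \<open>Strict prefixes of \<open>u\<close> and \<open>v\<close> must be excluded: they are
  fixed, while some of their extensions are moved.\<close>

lemma swap_append:
  assumes "parallel u v" "\<not> strict_prefix w u" "\<not> strict_prefix w v"
  shows "swap u v (w @ x) = swap u v w @ x"
proof (rule swap_cases[where w = w and u = u and v = v])
  assume n: "\<not> prefix u w" "\<not> prefix v w"
  have "\<not> prefix u (w @ x)" "\<not> prefix v (w @ x)"
    using n assms(2,3) prefix_same_cases[of _ "w @ x" w] by (metis prefixI prefix_order.le_less)+
  then show ?thesis using n by (simp add: swap_other)
qed (auto simp: swap_right assms(1))

lemma swap_can:
  assumes "swappable u v" "w \<in> W" "w \<noteq> []" "\<not> strict_prefix w u" "\<not> strict_prefix w v"
  shows "canonical_at (swap u v) w"
  unfolding canonical_at_def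
  using assms swap_W swap_ne swap_lab swap_append by (simp add: swappable_def)

primrec comps :: "(nat list \<times> nat list) list \<Rightarrow> nat list \<Rightarrow> nat list" where
  "comps [] = id" |
  "comps (p # ps) = swap (fst p) (snd p) \<circ> comps ps"

lemma comps_append: "comps (ps @ qs) = comps ps \<circ> comps qs"
  by (induct ps) (simp_all add: comp_assoc)

section \<open>Maps that are canonical outside finite trees\<close>

definition prefix_closed :: "nat list set \<Rightarrow> bool" where
  "prefix_closed C \<longleftrightarrow> finite C \<and> [] \<in> C \<and> C \<subseteq> W \<and> (\<forall>w\<in>C. butlast w \<in> C)"

lemma prefix_closed_prefix: "prefix_closed C \<Longrightarrow> w \<in> C \<Longrightarrow> prefix u w \<Longrightarrow> u \<in> C"
proof (induct w rule: rev_induct)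
  case (snoc c w)
  then show ?case by (auto simp: prefix_closed_def prefix_snoc)
qed (simp add: prefix_closed_def)

definition canonical_between :: "(nat list \<Rightarrow> nat list) \<Rightarrow> nat list set \<Rightarrow> nat list set \<Rightarrow> bool" where
  "canonical_between g C C' \<longleftrightarrow> prefix_closed C \<and> prefix_closed C' \<and> bij_betw g (W - C) (W - C') \<and> (\<forall>w\<in>W - C. canonical_at g w)"

text \<open>The leaves of the complete subtree with interior \<open>C\<close>.\<close>

definition front :: "nat list set \<Rightarrow> nat list set" where
  "front C = {w \<in> W - C. butlast w \<in> C}"

lemma snoc_cases: "w \<noteq> [] \<Longrightarrow> w = butlast w @ [last w]"
  by simp

text \<open>Outside \<open>C\<close> the map commutes with the removal of the last letter, and so
  does its inverse because words with one label admit the same next letters. Hence the words whose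
  predecessor has been removed correspond to each other.\<close>

lemma front_bij:
  assumes "canonical_between g C C'"
  shows "bij_betw g (front C) (front C')"
proof -
  have C: "prefix_closed C" "prefix_closed C'" and b: "inj_on g (W - C)" "g ` (W - C) = W - C'"
    and canonical_at: "\<And>w. w \<in> W - C \<Longrightarrow> canonical_at g w"
    using assms by (auto simp: canonical_between_def bij_betw_def)
  have iff: "g w \<in> front C' \<longleftrightarrow> w \<in> front C" if w: "w \<in> W - C" for w
  proof
    assume gw: "g w \<in> front C'"
    show "w \<in> front C"
    proof (rule ccontr)
      assume "w \<notin> front C"
      then have y: "butlast w \<in> W - C"
        using w W_prefix[of w "butlast w"] prefixeq_butlast by (auto simp: front_def)
      have ne: "w \<noteq> []" using w C(1) by (auto simp: prefix_closed_def)
      have "butlast w @ [last w] \<in> W" using w ne by simp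
      then have "g (butlast w @ [last w]) = g (butlast w) @ [last w]"
        using canonical_at[OF y] unfolding canonical_at_def by blast
      then have "butlast (g w) = g (butlast w)" using ne by simp
      then show False using gw b(2) y by (auto simp: front_def)
    qed
  next
    assume wf: "w \<in> front C"
    show "g w \<in> front C'"
    proof (rule ccontr)
      have gw: "g w \<in> W - C'" using b(2) w by blast
      assume "g w \<notin> front C'"
      then have "butlast (g w) \<in> W - C'"
        using gw W_prefix[of "g w" "butlast (g w)"] prefixeq_butlast by (auto simp: front_def)
      then obtain y where y: "y \<in> W - C" "butlast (g w) = g y" using b(2) by (metis imageE)
      have ne: "g w \<noteq> []" using gw C(2) by (auto simp: prefix_closed_def)
      then have gy: "g w = g y @ [last (g w)]" using y(2) by (metis append_butlast_last_id)
      have cy: "canonical_at g y" using canonical_at y by blast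
      have "y @ [last (g w)] \<in> W"
        using W_replace[of "g y" "[last (g w)]" y] gy gw cy y(1) by (simp add: canonical_at_def)
      then have "g (y @ [last (g w)]) = g w" using cy gy by (simp add: canonical_at_def)
      moreover have "y @ [last (g w)] \<in> W - C"
        using \<open>y @ _ \<in> W\<close> prefix_closed_prefix[OF C(1), of "y @ [last (g w)]" y] y(1) by auto
      ultimately have "w = y @ [last (g w)]" using inj_onD[OF b(1)] w by metis
      then have "butlast w = y" by (metis butlast_snoc)
      then show False using wf y(1) by (simp add: front_def)
    qed
  qed
  have sub: "front C \<subseteq> W - C" "front C' \<subseteq> g ` (W - C)" unfolding b(2) by (auto simp: front_def)
  have "g ` front C = front C'"
  proof
    show "g ` front C \<subseteq> front C'" using iff sub(1) by blast
    show "front C' \<subseteq> g ` front C"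
    proof
      fix z assume z: "z \<in> front C'"
      then obtain x where "x \<in> W - C" "z = g x" using sub(2) by blast
      then show "z \<in> g ` front C" using iff z by blast
    qed
  qed
  moreover have "inj_on g (front C)" using b(1) by (rule inj_on_subset) (auto simp: front_def)
  ultimately show ?thesis by (simp add: bij_betw_def)
qed

section \<open>Counting leaves by label\<close>

lemma card_children_lab:
  assumes "e \<le> d" "y \<in> W"
  shows "card {c. y @ [c] \<in> W \<and> orb c = orb e} + (if y \<noteq> [] \<and> lab y = orb e then 1 else 0) = card (orb e)"
proof -
  have fin: "finite (orb e)" using orb_le[OF assms(1)] by (meson finite_nat_set_iff_bounded_le)
  have o: "c \<in> orb e \<longleftrightarrow> c \<le> d \<and> orb c = orb e" for c
    using assms orb_self orb_le orb_eq by blast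
  show ?thesis
  proof (cases "y = []")
    case True
    then have "{c. y @ [c] \<in> W \<and> orb c = orb e} = orb e" using o by (auto simp: W_single)
    then show ?thesis using True by simp
  next
    case False
    let ?r = "rf (last y)"
    have l: "last y \<le> d" using W_last assms False by blast
    have "{c. y @ [c] \<in> W \<and> orb c = orb e} = orb e - {?r}"
      unfolding W_snoc[OF assms(2) False] using o by auto
    \<comment> \<open>The forbidden letter belongs to the orbit of the last letter of
      \<open>y\<close>. It therefore costs a child with label \<open>orb e\<close> exactly when
      \<open>y\<close> itself has that label.\<close>
    moreover have "?r \<in> orb e \<longleftrightarrow> lab y = orb e"
      using rf_orb[OF l] orb_eq[OF l] o orb_le[OF l] by (auto simp: lab_def)
    moreover have "?r \<in> orb e \<Longrightarrow> card (orb e) > 0" using fin card_gt_0_iff by blast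
    ultimately show ?thesis using False fin by (auto simp: card_Diff_singleton)
  qed
qed

lemma card_children_all:
  assumes "y \<in> W"
  shows "card {c. y @ [c] \<in> W} = (if y = [] then d + 1 else d)"
proof (cases "y = []")
  case True
  then have "{c. y @ [c] \<in> W} = {0..d}" by (auto simp: W_single)
  then show ?thesis using True by simp
next
  case False
  have l: "last y \<le> d" using W_last assms False by blast
  have "{c. y @ [c] \<in> W} = {0..d} - {rf (last y)}"
    unfolding W_snoc[OF assms False] by auto
  moreover have "rf (last y) \<in> {0..d}" using orb_le[OF l rf_orb[OF l]] by simp
  ultimately show ?thesis using False by simp
qed

lemma card_snoc_image:
  assumes "finite C" "\<And>y. y \<in> C \<Longrightarrow> finite {c. P y c}"
  shows "card {w. w \<noteq> [] \<and> butlast w \<in> C \<and> P (butlast w) (last w)} = (\<Sum>y\<in>C. card {c. P y c})"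
    and "finite {w. w \<noteq> [] \<and> butlast w \<in> C \<and> P (butlast w) (last w)}"
proof -
  have e: "{w. w \<noteq> [] \<and> butlast w \<in> C \<and> P (butlast w) (last w)} = (\<lambda>(y, c). y @ [c]) ` (SIGMA y:C. {c. P y c})"
    by (force simp: image_iff intro: snoc_cases)
  have "inj_on (\<lambda>(y, c). y @ [c]) (SIGMA y:C. {c. P y c})" by (auto simp: inj_on_def)
  then show "card {w. w \<noteq> [] \<and> butlast w \<in> C \<and> P (butlast w) (last w)} = (\<Sum>y\<in>C. card {c. P y c})"
    unfolding e using assms by (simp add: card_image card_SigmaI)
  show "finite {w. w \<noteq> [] \<and> butlast w \<in> C \<and> P (butlast w) (last w)}"
    unfolding e using assms by (intro finite_imageI finite_SigmaI) auto
qed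

lemma finite_next: "finite {c. y @ [c] \<in> W \<and> Q c}"
  by (rule finite_subset[of _ "{0..d}"]) (auto simp: W_append W_single)

lemma front_split:
  assumes "prefix_closed C"
  shows "{w \<in> W. w \<noteq> [] \<and> butlast w \<in> C \<and> Q (last w)} =
    {w \<in> front C. Q (last w)} \<union> {w \<in> C - {[]}. Q (last w)}"
  using assms by (auto simp: front_def prefix_closed_def)

text \<open>Count the nonempty words with this label whose predecessor is in \<open>C\<close> in two
  ways. They are the leaves and the nonempty interior words with the label; on the other hand every
  word of \<open>C\<close> has \<open>card (orb e)\<close> such children, except that one is missing
  when the word has the label itself. So an interior word with the label enters twice.\<close>

lemma card_front_lab:
  assumes "prefix_closed C" "e \<le> d"
  shows "card {w \<in> front C. lab w = orb e} + 2 * card {w \<in> C - {[]}. lab w = orb e} = card (orb e) * card C"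
    and "finite (front C)"
proof -
  have C: "finite C" "C \<subseteq> W" using assms by (auto simp: prefix_closed_def)
  have rw: "{w \<in> W. w \<noteq> [] \<and> butlast w \<in> C \<and> Q (last w)} =
    {w. w \<noteq> [] \<and> butlast w \<in> C \<and> (butlast w @ [last w] \<in> W \<and> Q (last w))}" for Q by auto
  have fin: "finite {w \<in> W. w \<noteq> [] \<and> butlast w \<in> C \<and> Q (last w)}" for Q
    unfolding rw by (rule card_snoc_image(2)[OF C(1)]) (rule finite_next)
  have "front C \<subseteq> {w \<in> W. w \<noteq> [] \<and> butlast w \<in> C \<and> True}"
    using assms(1) by (auto simp: front_def prefix_closed_def)
  then show ff: "finite (front C)" using fin[of "\<lambda>_. True"] by (rule finite_subset)
  have "card {w \<in> W. w \<noteq> [] \<and> butlast w \<in> C \<and> orb (last w) = orb e} =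
    (\<Sum>y\<in>C. card {c. y @ [c] \<in> W \<and> orb c = orb e})"
    unfolding rw[of "\<lambda>c. orb c = orb e"] by (rule card_snoc_image(1)[OF C(1)]) (rule finite_next)
  moreover have "card {w \<in> W. w \<noteq> [] \<and> butlast w \<in> C \<and> orb (last w) = orb e} =
    card {w \<in> front C. lab w = orb e} + card {w \<in> C - {[]}. lab w = orb e}"
    unfolding front_split[OF assms(1), of "\<lambda>c. orb c = orb e"] lab_def
  proof (rule card_Un_disjoint)
    show "finite {w \<in> front C. orb (last w) = orb e}" using ff by simp
    show "finite {w \<in> C - {[]}. orb (last w) = orb e}" using C by simp
  qed (auto simp: front_def)
  moreover have "(\<Sum>y\<in>C. card {c. y @ [c] \<in> W \<and> orb c = orb e}) + card {w \<in> C - {[]}. lab w = orb e}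
    = card (orb e) * card C"
  proof -
    have "card {w \<in> C - {[]}. lab w = orb e} = (\<Sum>y\<in>C. if y \<noteq> [] \<and> lab y = orb e then 1 else 0)"
    proof -
      have "{w \<in> C - {[]}. lab w = orb e} = {w \<in> C. w \<noteq> [] \<and> lab w = orb e}" by blast
      then show ?thesis
        using sum.inter_filter[OF C(1), of "\<lambda>_. 1 :: nat" "\<lambda>w. w \<noteq> [] \<and> lab w = orb e"]
        by (simp only: card_eq_sum)
    qed
    then have "(\<Sum>y\<in>C. card {c. y @ [c] \<in> W \<and> orb c = orb e}) + card {w \<in> C - {[]}. lab w = orb e}
      = (\<Sum>y\<in>C. card {c. y @ [c] \<in> W \<and> orb c = orb e} + (if y \<noteq> [] \<and> lab y = orb e then 1 else 0))"
      by (simp add: sum.distrib)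
    also have "\<dots> = (\<Sum>y\<in>C. card (orb e))"
      by (rule sum.cong[OF refl]) (use card_children_lab[OF assms(2)] C(2) in blast)
    finally show ?thesis by simp
  qed
  ultimately show "card {w \<in> front C. lab w = orb e} + 2 * card {w \<in> C - {[]}. lab w = orb e} = card (orb e) * card C"
    by linarith
qed

text \<open>The same double count without labels. The constant 2 comes from the root, which has one
  child more than the other words and is itself nobody's child.\<close>

lemma card_front:
  assumes "prefix_closed C"
  shows "card (front C) = (d - 1) * card C + 2"
proof -
  have C: "finite C" "C \<subseteq> W" "[] \<in> C" using assms by (auto simp: prefix_closed_def)
  have ff: "finite (front C)" using card_front_lab(2)[OF assms, of 0] by simp
  have rw: "{w \<in> W. w \<noteq> [] \<and> butlast w \<in> C \<and> True} =
    {w. w \<noteq> [] \<and> butlast w \<in> C \<and> (butlast w @ [last w] \<in> W \<and> True)}" by auto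
  have "card {w \<in> W. w \<noteq> [] \<and> butlast w \<in> C \<and> True} = (\<Sum>y\<in>C. card {c. y @ [c] \<in> W \<and> True})"
    unfolding rw by (rule card_snoc_image(1)[OF C(1)]) (rule finite_next)
  also have "\<dots> = (\<Sum>y\<in>C. d + (if y = [] then 1 else 0))"
    by (rule sum.cong[OF refl]) (use card_children_all C(2) in \<open>simp add: subset_iff\<close>)
  also have "\<dots> = d * card C + 1" using C by (simp add: sum.distrib)
  finally have 1: "card {w \<in> W. w \<noteq> [] \<and> butlast w \<in> C \<and> True} = d * card C + 1" .
  have "card {w \<in> W. w \<noteq> [] \<and> butlast w \<in> C \<and> True} = card (front C) + card (C - {[]})"
  proof -
    have "{w \<in> W. w \<noteq> [] \<and> butlast w \<in> C \<and> True} = front C \<union> (C - {[]})"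
      using front_split[OF assms, of "\<lambda>_. True"] by auto
    moreover have "front C \<inter> (C - {[]}) = {}" by (auto simp: front_def)
    ultimately show ?thesis using ff C by (simp only: card_Un_disjoint finite_Diff)
  qed
  moreover have "card (C - {[]}) + 1 = card C" using C by (metis Suc_eq_plus1 card_Suc_Diff1)
  moreover have "d * card C = (d - 1) * card C + card C"
    using d_ge_2 by (metis Suc_diff_1 add.commute mult_Suc not_numeral_le_zero not_gr_zero)
  ultimately show ?thesis using 1 by linarith
qed

text \<open>
  Counting the leaves by label determines the number of interior vertices with that label: a vertex
  labelled \<open>t\<close> has one child labelled \<open>t\<close> less than the other vertices.
\<close>

lemma canonical_between_card:
  assumes "canonical_between g C C'"
  shows "card C = card C'"
    and "e \<le> d \<Longrightarrow> card {w \<in> C - {[]}. lab w = orb e} = card {w \<in> C' - {[]}. lab w = orb e}"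
proof -
  have C: "prefix_closed C" "prefix_closed C'" and canonical_at: "\<And>w. w \<in> W - C \<Longrightarrow> canonical_at g w"
    using assms by (auto simp: canonical_between_def)
  have b: "bij_betw g (front C) (front C')" by (rule front_bij[OF assms])
  have "card (front C) = card (front C')" using b by (rule bij_betw_same_card)
  \<comment> \<open>The factor \<open>d - 1\<close> is positive. The equality must come first, since
    the counts by label contain the total number of interior words.\<close>
  then show c: "card C = card C'"
    using card_front[OF C(1)] card_front[OF C(2)] d_ge_2 by simp
  assume e: "e \<le> d"
  have l: "lab (g w) = lab w" if "w \<in> front C" for w
    using canonical_at[of w] that by (simp add: front_def canonical_at_def)
  have "bij_betw g {w \<in> front C. lab w = orb e} {w \<in> front C'. lab w = orb e}"
    using b l unfolding bij_betw_def inj_on_def by (auto simp: image_iff) (metis imageE)+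
  then have "card {w \<in> front C. lab w = orb e} = card {w \<in> front C'. lab w = orb e}"
    by (rule bij_betw_same_card)
  then show "card {w \<in> C - {[]}. lab w = orb e} = card {w \<in> C' - {[]}. lab w = orb e}"
    using card_front_lab(1)[OF C(1) e] card_front_lab(1)[OF C(2) e] c by simp
qed

section \<open>Factorisation into exchanges\<close>

lemma prefix_closed_swap:
  assumes C: "prefix_closed C" and s: "swappable u v" and u: "u \<notin> C" "butlast u \<in> C" and v: "v \<in> C"
  shows "prefix_closed (swap u v ` C)"
proof -
  have par: "parallel u v" and ne: "u \<noteq> []" "v \<noteq> []" using s by (auto simp: swappable_def)
  have fixed: "swap u v x = x" if "\<not> prefix u x" "\<not> prefix v x" for x using that by (rule swap_other)
  have nu: "\<not> prefix u x" if "x \<in> C" for x using prefix_closed_prefix[OF C that] u(1) by blast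
  have "butlast (swap u v y) \<in> swap u v ` C" if y: "y \<in> C" for y
  proof (cases "prefix v y")
    case True
    then obtain x where x: "y = v @ x" by (auto elim: prefixE)
    show ?thesis
    proof (cases "x = []")
      case True
      have "\<not> prefix v (butlast u)"
        using par prefix_order.trans[OF _ prefixeq_butlast, of v u] by (auto simp: parallel_def)
      then have "swap u v (butlast u) = butlast u" using fixed nu[OF u(2)] by blast
      moreover have "swap u v y = u" using x True swap_right[OF par, of "[]"] by simp
      ultimately show ?thesis using u(2) by (metis image_eqI)
    next
      case False
      then have "swap u v y = u @ x" "butlast (swap u v y) = u @ butlast x"
        using x swap_right[OF par] by (simp_all add: butlast_append)
      moreover have "v @ butlast x = butlast y" using x False by (simp add: butlast_append)
      then have "v @ butlast x \<in> C" using C y by (auto simp: prefix_closed_def)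
      ultimately show ?thesis using swap_right[OF par, of "butlast x"] by (metis image_eqI)
    qed
  next
    case False
    then have "swap u v y = y" using fixed nu y by blast
    moreover have "butlast y \<in> C" using C y by (auto simp: prefix_closed_def)
    moreover have "\<not> prefix v (butlast y)" using False prefix_order.trans[OF _ prefixeq_butlast] by blast
    ultimately show ?thesis using fixed nu by (metis image_eqI)
  qed
  moreover have "finite (swap u v ` C)" "swap u v ` C \<subseteq> W" using C swap_W[OF s] by (auto simp: prefix_closed_def)
  moreover have "[] \<in> swap u v ` C" using swap_ne[OF s, of "[]"] C by (metis image_eqI prefix_closed_def)
  ultimately show ?thesis unfolding prefix_closed_def by blast
qed

lemma swap_bij_W: "swappable u v \<Longrightarrow> bij_betw (swap u v) W W"
  by (rule bij_betwI[where g="swap u v"]) (auto simp: swap_W swap_swap swappable_def)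

lemma swap_bij_compl:
  assumes "swappable u v" "C \<subseteq> W"
  shows "bij_betw (swap u v) (W - swap u v ` C) (W - C)"
proof -
  have par: "parallel u v" using assms by (simp add: swappable_def)
  have "bij_betw (swap u v) (swap u v ` C) C"
    by (rule bij_betwI[where g="swap u v"]) (auto simp: swap_swap[OF par])
  moreover have "swap u v ` C \<subseteq> W" using assms swap_W by blast
  ultimately show ?thesis
    using swap_bij_W[OF assms(1)] assms(2) bij_betw_DiffI[of "swap u v" W W "swap u v ` C" C] by blast
qed

lemma strict_prefix_butlast: "strict_prefix w u \<Longrightarrow> prefix w (butlast u)"
  by (metis append_butlast_last_id prefix_order.less_le prefix_snoc strict_prefix_simps(1))

text \<open>The interior part at and below \<open>v\<close> is transplanted to the leaf
  \<open>u\<close> of the same tree. The parent of \<open>u\<close> is interior and, since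
  \<open>u\<close> and \<open>v\<close> are parallel, does not lie below \<open>v\<close>; hence the
  result is again the interior of a tree. The second tree is not touched.\<close>

lemma canonical_between_move:
  assumes g: "canonical_between g C C'" and s: "swappable u v" and u: "u \<notin> C" "butlast u \<in> C" and v: "v \<in> C"
  shows "canonical_between (g \<circ> swap u v) (swap u v ` C) C'"
proof -
  have C: "prefix_closed C" "prefix_closed C'" "C \<subseteq> W" and b: "bij_betw g (W - C) (W - C')"
    and canonical_at: "\<And>w. w \<in> W - C \<Longrightarrow> canonical_at g w"
    using g by (auto simp: canonical_between_def prefix_closed_def)
  have par: "parallel u v" using s by (simp add: swappable_def)
  have prefix_closed: "prefix_closed (swap u v ` C)" by (rule prefix_closed_swap[OF C(1) s u v])
  have bs: "bij_betw (swap u v) (W - swap u v ` C) (W - C)" by (rule swap_bij_compl[OF s C(3)])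
  have "canonical_at (g \<circ> swap u v) w" if w: "w \<in> W - swap u v ` C" for w
  proof -
    have "u \<in> swap u v ` C" using v swap_right[OF par, of "[]"] by (metis append_Nil2 image_eqI)
    then have 1: "\<not> strict_prefix w u" using prefix_closed_prefix[OF prefix_closed] w by (meson DiffD2 prefix_order.less_imp_le)
    have 2: "\<not> strict_prefix w v"
    proof
      assume "strict_prefix w v"
      then have "w \<in> C" "\<not> prefix v w" using prefix_closed_prefix[OF C(1) v] by auto
      moreover have "\<not> prefix u w" using prefix_closed_prefix[OF C(1)] u(1) \<open>w \<in> C\<close> by blast
      ultimately have "w \<in> swap u v ` C" using swap_other by (metis image_eqI)
      then show False using w by blast
    qed
    have "w \<noteq> []" using w prefix_closed by (auto simp: prefix_closed_def)
    then have "canonical_at (swap u v) w" using swap_can[OF s _ _ 1 2] w by blast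
    moreover have "canonical_at g (swap u v w)" using canonical_at bs w by (auto simp: bij_betw_def)
    ultimately show ?thesis using canonical_at_comp w by blast
  qed
  then show ?thesis unfolding canonical_between_def using prefix_closed C(2) bij_betw_trans[OF bs b] by blast
qed

lemma front_parallel:
  assumes "prefix_closed C" "l \<in> front C" "m \<in> front C" "l \<noteq> m" shows "parallel l m"
proof -
  have "\<not> prefix a b" if "a \<in> front C" "b \<in> front C" "a \<noteq> b" for a b
  proof
    assume "prefix a b"
    then have "prefix a (butlast b)" using that(3) strict_prefix_butlast[of a b] by (simp add: strict_prefix_def)
    then have "a \<in> C" using prefix_closed_prefix[OF assms(1)] that by (auto simp: front_def)
    then show False using that by (simp add: front_def)
  qed
  then show ?thesis using assms by (auto simp: parallel_def)
qed

lemma front_fixed: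
  assumes g: "canonical_between g C C" and f: "\<And>l. l \<in> front C \<Longrightarrow> g l = l"
  shows "w \<in> W \<Longrightarrow> w \<notin> C \<Longrightarrow> g w = w"
proof (induct w rule: rev_induct)
  case Nil
  then show ?case using g by (simp add: canonical_between_def prefix_closed_def)
next
  case (snoc c w)
  show ?case
  proof (cases "w \<in> C")
    case True
    then show ?thesis using f snoc by (simp add: front_def)
  next
    case False
    have "w \<in> W" using snoc W_append by blast
    then have "g w = w" "canonical_at g w" using snoc False g by (auto simp: canonical_between_def)
    then show ?thesis using snoc by (simp add: canonical_at_def)
  qed
qed

lemma finite_front: "prefix_closed C \<Longrightarrow> finite (front C)"
  using card_front_lab(2)[of C 0] by simp

text \<open>Over one and the same tree the map permutes the leaves and is determined by this below
  them. As in the factorisation of a permutation into transpositions, the exchange of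
  \<open>l\<close> and \<open>g l\<close> brings \<open>l\<close> home and leaves the fixed leaves
  fixed.\<close>

lemma leaf_permutation:
  assumes "canonical_between g C C"
  shows "\<exists>ps. (\<forall>p\<in>set ps. swappable (fst p) (snd p)) \<and> (\<forall>w\<in>W - C. g w = comps ps w)"
  using assms
proof (induct "card {l \<in> front C. g l \<noteq> l}" arbitrary: g rule: less_induct)
  case less
  note g = less(2)
  have C: "prefix_closed C" "C \<subseteq> W" and canonical_at: "\<And>w. w \<in> W - C \<Longrightarrow> canonical_at g w" and b: "bij_betw g (W - C) (W - C)"
    using g by (auto simp: canonical_between_def prefix_closed_def)
  show ?case
  proof (cases "\<exists>l\<in>front C. g l \<noteq> l")
    case False
    then have "g w = w" if "w \<in> W - C" for w using front_fixed[OF g] that by blast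
    then show ?thesis by (intro exI[of _ "[]"]) simp
  next
    case True
    then obtain l where l: "l \<in> front C" "g l \<noteq> l" by blast
    define m where "m = g l"
    have fb: "bij_betw g (front C) (front C)" by (rule front_bij[OF g])
    have m: "m \<in> front C" using fb l unfolding m_def bij_betw_def by blast
    have lm: "l \<in> W - C" "m \<in> W - C" using l m by (auto simp: front_def)
    have par: "parallel l m" using front_parallel[OF C(1) l(1) m] l(2) m_def by simp
    have s: "swappable l m" unfolding swappable_def
      using lm par canonical_at[OF lm(1)] C(1) unfolding canonical_at_def m_def by (auto simp: prefix_closed_def)
    let ?s = "swap l m"
    have ns: "\<not> strict_prefix w k" if "w \<in> W - C" "k \<in> front C" for w k
    proof
      assume "strict_prefix w k"
      then have "prefix w (butlast k)" by (rule strict_prefix_butlast)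
      then show False using prefix_closed_prefix[OF C(1)] that by (auto simp: front_def)
    qed
    have fixC: "?s w = w" if "w \<in> C" for w
      using prefix_closed_prefix[OF C(1) that] lm swap_other by blast
    then have "?s ` C = C" by simp
    then have bs: "bij_betw ?s (W - C) (W - C)" using swap_bij_compl[OF s C(2)] by simp
    have "canonical_between (?s \<circ> g) C C" unfolding canonical_between_def
    proof (intro conjI ballI)
      show "bij_betw (?s \<circ> g) (W - C) (W - C)" by (rule bij_betw_trans[OF b bs])
      fix w assume w: "w \<in> W - C"
      have gw: "g w \<in> W - C" using b w by (auto simp: bij_betw_def)
      have "g w \<noteq> []" using gw C(1) by (auto simp: prefix_closed_def)
      then have "canonical_at ?s (g w)" using swap_can[OF s, of "g w"] gw ns l(1) m by blast
      then show "canonical_at (?s \<circ> g) w" using canonical_at_comp canonical_at w by blast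
    qed (use C in auto)
    moreover have "card {k \<in> front C. (?s \<circ> g) k \<noteq> k} < card {k \<in> front C. g k \<noteq> k}"
    proof (rule psubset_card_mono)
      show "finite {k \<in> front C. g k \<noteq> k}" using finite_front C(1) by simp
      have sl: "?s (g l) = l" using swap_right[OF par, of "[]"] by (simp add: m_def)
      moreover have "(?s \<circ> g) k = k" if k: "k \<in> front C" "g k = k" for k
      proof -
        have "k \<noteq> l" using k l by blast
        moreover have "k \<noteq> m" using k l fb m_def inj_onD[of g "front C" k l] by (auto simp: bij_betw_def)
        ultimately have "parallel l k" "parallel m k"
          using front_parallel[OF C(1)] l(1) m k(1) by blast+
        then show ?thesis using k swap_other[of l k m] by (simp add: parallel_def)
      qed
      ultimately show "{k \<in> front C. (?s \<circ> g) k \<noteq> k} \<subset> {k \<in> front C. g k \<noteq> k}"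
        using l by auto
    qed
    ultimately obtain ps where ps: "\<forall>p\<in>set ps. swappable (fst p) (snd p)" "\<forall>w\<in>W - C. (?s \<circ> g) w = comps ps w"
      using less(1) by blast
    have "g w = comps ((l, m) # ps) w" if "w \<in> W - C" for w
      using ps(2) that swap_swap[OF par, of "g w"] by (metis comp_apply comps.simps(2) fst_conv snd_conv)
    then show ?thesis using ps(1) s by (intro exI[of _ "(l, m) # ps"]) simp
  qed
qed

text \<open>
  Both trees have the same number of interior vertices of each type, so an interior vertex \<open>v\<close> of
  the first tree outside the second is exchanged with a leaf \<open>u\<close> of the first tree that is
  interior in the second.
\<close>

lemma canonical_between_swaps:
  assumes "canonical_between g C C'"
  shows "\<exists>ps. (\<forall>p\<in>set ps. swappable (fst p) (snd p)) \<and> (\<forall>w\<in>W - C. g w = comps ps w)"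
  using assms
proof (induct "card (C' - C)" arbitrary: g C rule: less_induct)
  case less
  note g = less(2)
  have C: "prefix_closed C" "prefix_closed C'" "C \<subseteq> W" "C' \<subseteq> W" "finite C" "finite C'" using g by (auto simp: canonical_between_def prefix_closed_def)
  have cc: "card C = card C'" by (rule canonical_between_card(1)[OF g])
  show ?case
  proof (cases "C' \<subseteq> C")
    case True
    then have "C' = C" using card_subset_eq[OF C(5) True] cc by simp
    then show ?thesis using leaf_permutation g by simp
  next
    case False
    then obtain x where "x \<in> C' - C" by blast
    \<comment> \<open>The predecessor of a shortest such word is in \<open>C'\<close>, hence in
      \<open>C\<close> by minimality; this makes \<open>u\<close> a leaf of the first tree.\<close>
    then obtain u where u: "u \<in> C' - C" and min: "\<And>y. y \<in> C' - C \<Longrightarrow> length u \<le> length y"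
      using ex_has_least_nat[of "\<lambda>x. x \<in> C' - C" x length] by blast
    have une: "u \<noteq> []" using u C(1) by (auto simp: prefix_closed_def)
    have bu: "butlast u \<in> C" using min[of "butlast u"] u C(2) une by (auto simp: prefix_closed_def) (metis One_nat_def diff_less length_greater_0_conv lessI not_le)
    have ud: "last u \<le> d" using W_last u C(4) une by blast
    let ?t = "orb (last u)"
    have ne: "{w \<in> C - {[]}. lab w = ?t} \<noteq> {w \<in> C' - {[]}. lab w = ?t}"
      using u une by (auto simp: lab_def)
    \<comment> \<open>The two sets have the same size by the count of interior words by label, and
      they differ at \<open>u\<close>. So one of them cannot contain the other, which provides the
      partner \<open>v\<close>.\<close>
    have "\<not> {w \<in> C - {[]}. lab w = ?t} \<subseteq> {w \<in> C' - {[]}. lab w = ?t}"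
    proof
      assume sub: "{w \<in> C - {[]}. lab w = ?t} \<subseteq> {w \<in> C' - {[]}. lab w = ?t}"
      have "finite {w \<in> C' - {[]}. lab w = ?t}" using C(6) by simp
      from card_subset_eq[OF this sub canonical_between_card(2)[OF g ud]] show False using ne by contradiction
    qed
    then obtain v where v: "v \<in> C" "v \<notin> C'" "v \<noteq> []" "lab v = ?t" using C by blast
    have par: "parallel u v"
      using prefix_closed_prefix[OF C(1) v(1), of u] prefix_closed_prefix[OF C(2), of u v] u v(2) by (auto simp: parallel_def)
    have s: "swappable u v" unfolding swappable_def using u v C une par by (auto simp: lab_def)
    have m: "canonical_between (g \<circ> swap u v) (swap u v ` C) C'" using canonical_between_move[OF g s _ bu v(1)] u by blast
    \<comment> \<open>Words common to both trees extend neither \<open>u\<close> nor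
      \<open>v\<close> and stay in place, while \<open>u\<close> is gained in exchange for
      \<open>v\<close>.\<close>
    have "C' - swap u v ` C \<subset> C' - C"
    proof
      have "x \<in> swap u v ` C" if x: "x \<in> C" "x \<in> C'" for x
      proof -
        have "\<not> prefix u x" "\<not> prefix v x"
          using prefix_closed_prefix[OF C(1) x(1)] prefix_closed_prefix[OF C(2) x(2)] u v(2) by blast+
        then show ?thesis using x swap_other by (metis image_eqI)
      qed
      then show "C' - swap u v ` C \<subseteq> C' - C" by blast
      have "swap u v v = u" using swap_right[OF par, of "[]"] by simp
      then have "u \<in> swap u v ` C" using v(1) by force
      then show "C' - swap u v ` C \<noteq> C' - C" using u by blast
    qed
    then have "card (C' - swap u v ` C) < card (C' - C)" using C(6) by (simp add: psubset_card_mono)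
    then obtain ps where ps: "\<forall>p\<in>set ps. swappable (fst p) (snd p)"
      "\<forall>w\<in>W - swap u v ` C. (g \<circ> swap u v) w = comps ps w" using less(1) m by blast
    have "g w = comps (ps @ [(u, v)]) w" if w: "w \<in> W - C" for w
    proof -
      have "swap u v w \<in> W - swap u v ` C"
        using w swap_W[OF s] swap_swap[OF par] by (auto) (metis)
      then have "(g \<circ> swap u v) (swap u v w) = comps ps (swap u v w)" using ps(2) by blast
      then show ?thesis using swap_swap[OF par, of w] by (simp add: comps_append)
    qed
    then show ?thesis using ps(1) s by (intro exI[of _ "ps @ [(u, v)]"]) auto
  qed
qed

section \<open>Reduction to finitely many exchanges\<close>

lemma swap_conj:
  assumes pq: "parallel p q" and uv: "parallel u v"
    and u: "\<not> strict_prefix u p" "\<not> strict_prefix u q" and v: "\<not> strict_prefix v p" "\<not> strict_prefix v q"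
  shows "swap u v = swap p q \<circ> (swap (swap p q u) (swap p q v) \<circ> swap p q)"
    and "parallel (swap p q u) (swap p q v)"
proof -
  let ?s = "swap p q"
  have ss: "?s (?s w) = w" for w by (rule swap_swap[OF pq])
  \<comment> \<open>As \<open>u\<close> and \<open>v\<close> are not strictly above \<open>p\<close>
    or \<open>q\<close>, the exchange of \<open>p\<close> and \<open>q\<close> acts on the subtrees
    at \<open>u\<close> and \<open>v\<close> by replacing prefixes. Conjugation then carries the
    exchange of two subtrees to the exchange of their images.\<close>
  have su: "?s (u @ x) = ?s u @ x" for x using swap_append[OF pq u] .
  have sv: "?s (v @ x) = ?s v @ x" for x using swap_append[OF pq v] .
  have pu: "prefix u w \<longleftrightarrow> prefix (?s u) (?s w)" if "\<And>x. ?s (u @ x) = ?s u @ x" "\<And>x. ?s (?s u @ x) = u @ x" for u w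
    using that ss by (metis prefix_def)
  have su': "?s (?s u @ x) = u @ x" for x using su ss by metis
  have sv': "?s (?s v @ x) = v @ x" for x using sv ss by metis
  show par: "parallel (?s u) (?s v)"
    using uv pu[OF su su', of v] pu[OF sv sv', of u] by (simp add: parallel_def)
  show "swap u v = ?s \<circ> (swap (?s u) (?s v) \<circ> ?s)"
  proof
    fix w
    show "swap u v w = (?s \<circ> (swap (?s u) (?s v) \<circ> ?s)) w"
    proof (rule swap_cases[where w = w and u = u and v = v])
      fix x assume "w = u @ x" then show ?thesis by (simp add: su sv')
    next
      fix x assume "w = v @ x" then show ?thesis by (simp add: sv su' swap_right[OF par] swap_right[OF uv])
    next
      assume n: "\<not> prefix u w" "\<not> prefix v w"
      then have "\<not> prefix (?s u) (?s w)" "\<not> prefix (?s v) (?s w)"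
        using pu[OF su su', of w] pu[OF sv sv', of w] by auto
      then show ?thesis using n ss by (simp add: swap_other)
    qed
  qed
qed

text \<open>The strict prefixes of \<open>u\<close> and \<open>v\<close> form the interior of the
  smallest complete subtree that has \<open>u\<close> and \<open>v\<close> among its leaves. They
  are all fixed, so the tree is the same on both sides.\<close>

lemma canonical_between_swap:
  assumes s: "swappable u v"
  shows "canonical_between (swap u v) {w. strict_prefix w u \<or> strict_prefix w v} {w. strict_prefix w u \<or> strict_prefix w v}"
    (is "canonical_between _ ?A ?A")
proof -
  have par: "parallel u v" and W: "u \<in> W" "v \<in> W" "u \<noteq> []" using s by (auto simp: swappable_def)
  have AW: "?A \<subseteq> W" using W W_prefix by (auto simp: strict_prefix_def)
  have "finite {w. prefix w u}" "finite {w. prefix w v}"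
    by (simp_all flip: set_prefixes_eq)
  then have "finite ?A" by (rule_tac finite_subset[of _ "{w. prefix w u} \<union> {w. prefix w v}"]) auto
  moreover have "butlast w \<in> ?A" if "w \<in> ?A" for w
    using that prefixeq_butlast[of w] prefix_order.le_less_trans by blast
  moreover have nil: "[] \<in> ?A" using W by (simp add: strict_prefix_def)
  ultimately have "prefix_closed ?A" unfolding prefix_closed_def using AW by blast
  moreover have "swap u v w = w" if "w \<in> ?A" for w
    by (rule swap_other) (use that par in \<open>auto simp: parallel_def strict_prefix_def dest: prefix_order.antisym prefix_order.trans\<close>)
  then have "swap u v ` ?A = ?A" by simp
  then have "bij_betw (swap u v) (W - ?A) (W - ?A)" using swap_bij_compl[OF s AW] by simp
  moreover have "canonical_at (swap u v) w" if "w \<in> W - ?A" for w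
    by (rule swap_can[OF s]) (use that nil in auto)
  ultimately show ?thesis by (simp add: canonical_between_def)
qed

text \<open>The bound 3 is forced by \<open>type_below\<close>: a replacement with a given label can
  need two letters, so prefixes of length three are the shortest that can always be shortened in
  this way.\<close>

definition short_swappable :: "nat list \<times> nat list \<Rightarrow> bool" where
  "short_swappable p \<longleftrightarrow> swappable (fst p) (snd p) \<and> length (fst p) \<le> 3 \<and> length (snd p) \<le> 3"

text \<open>If \<open>c\<close> does not have the desired label itself, then \<open>e\<close> may
  follow \<open>c\<close>, because the only letter forbidden after \<open>c\<close> lies in the
  orbit of \<open>c\<close>.\<close>

lemma type_below:
  assumes "c \<le> d" "e \<le> d"
  shows "\<exists>q\<in>W. q \<noteq> [] \<and> hd q = c \<and> length q \<le> 2 \<and> lab q = orb e"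
proof (cases "orb c = orb e")
  case True
  then show ?thesis using assms by (intro bexI[of _ "[c]"]) (auto simp: W_single lab_def)
next
  case False
  have "e \<noteq> rf c" using False rf_orb[OF assms(1)] orb_eq[OF assms(1)] by metis
  then have "[c] @ [e] \<in> W" using assms by (subst W_snoc) (auto simp: W_single)
  then show ?thesis by (intro bexI[of _ "[c, e]"]) (auto simp: lab_def)
qed

text \<open>
  Conjugate with the exchange of an ancestor \<open>p\<close> of \<open>u\<close> and a vertex \<open>q\<close> that is closer to the root
  and lies below a child of the root that is above neither \<open>u\<close> nor \<open>v\<close>.
\<close>

lemma swap_shorten:
  assumes s: "swappable u v" and len: "length u \<ge> 4"
  obtains p q u' v' where "short_swappable (p, q)" "swappable u' v'" "length u' < length u" "length v' \<le> length v"
    "swap u v = swap p q \<circ> (swap u' v' \<circ> swap p q)"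
proof -
  have uv: "u \<in> W" "v \<in> W" "u \<noteq> []" "v \<noteq> []" "parallel u v" "lab u = lab v" using s by (auto simp: swappable_def)
  have "card ({0..d} - {hd u, hd v}) \<ge> card {0..d} - card {hd u, hd v}" by (rule diff_card_le_card_Diff) simp
  moreover have "card {hd u, hd v} \<le> 2" by (simp add: card_insert_if)
  ultimately have "card ({0..d} - {hd u, hd v}) > 0" using d_ge_2 by simp
  then obtain c where c: "c \<le> d" "c \<noteq> hd u" "c \<noteq> hd v" by (force simp: card_gt_0_iff)
  define p where "p = take 3 u"
  have p: "p \<in> W" "p \<noteq> []" "length p = 3" "hd p = hd u" "prefix p u"
    using W_prefix[OF uv(1), of p] len uv(3) by (auto simp: p_def take_is_prefix)
  have "last p \<le> d" using W_last p by blast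
  then obtain q where q: "q \<in> W" "q \<noteq> []" "hd q = c" "length q \<le> 2" "lab q = lab p"
    using type_below[OF c(1)] by (auto simp: lab_def)
  have hd: "hd a = hd b" if "prefix a b" "a \<noteq> []" for a b :: "nat list" using that by (auto simp: prefix_def)
  have pq: "parallel p q" using hd[of p q] hd[of q p] p q c by (auto simp: parallel_def)
  have spq: "swappable p q" using p q pq by (simp add: swappable_def)
  let ?s = "swap p q"
  have nu: "\<not> strict_prefix u p" "\<not> strict_prefix u q"
    using p len q hd[of u q] uv(3) c by (auto simp: strict_prefix_def prefix_length_le dest: prefix_length_le)
  have nv: "\<not> strict_prefix v p" "\<not> strict_prefix v q"
    using uv(4,5) p(5) q c hd[of v q] by (auto simp: strict_prefix_def parallel_def dest: prefix_order.trans)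
  have sw: "swappable (?s u) (?s v)" unfolding swappable_def
    using swap_W[OF spq] swap_ne[OF spq] swap_lab[OF spq] uv swap_conj(2)[OF pq uv(5) nu nv] by simp
  have "?s u = q @ drop 3 u" using p(3,5) by (simp add: swap_def)
  then have 1: "length (?s u) < length u" using q(4) len by simp
  \<comment> \<open>If \<open>v\<close> lay below \<open>q\<close>, the conjugation would make it
    longer; the choice of the first letter of \<open>q\<close> prevents this.\<close>
  have "\<not> prefix q v" using hd[of q v] q c by auto
  then have "?s v = (if prefix p v then q @ drop 3 v else v)" using p(3) by (simp add: swap_def)
  then have 2: "length (?s v) \<le> length v" using q(4) p(3) prefix_length_le[of p v] by auto
  show ?thesis
    by (rule that[OF _ sw 1 2 swap_conj(1)[OF pq uv(5) nu nv]]) (use spq p q in \<open>simp add: short_swappable_def\<close>)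
qed

lemma short_swaps:
  assumes "swappable u v"
  shows "\<exists>ps. (\<forall>p\<in>set ps. short_swappable p) \<and> swap u v = comps ps"
  using assms
proof (induct "length u + length v" arbitrary: u v rule: less_induct)
  case less
  \<comment> \<open>Only the total length is compared with that of \<open>u\<close> and
    \<open>v\<close>, so that the claim can be applied to the pair in either order.\<close>
  have main: "\<exists>ps. (\<forall>p\<in>set ps. short_swappable p) \<and> swap a b = comps ps"
    if s: "swappable a b" and len: "length a \<ge> 4" and l: "length a + length b = length u + length v" for a b
  proof -
    obtain p q a' b' where *: "short_swappable (p, q)" "swappable a' b'" "length a' < length a" "length b' \<le> length b"
      "swap a b = swap p q \<circ> (swap a' b' \<circ> swap p q)" using swap_shorten[OF s len] .
    have "length a' + length b' < length u + length v" using *(3,4) l by linarith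
    then obtain ps where ps: "\<forall>p\<in>set ps. short_swappable p" "swap a' b' = comps ps" using less(1) *(2) by blast
    have "swap a b = comps ((p, q) # ps @ [(p, q)])" using *(5) ps(2) by (simp add: comps_append)
    then show ?thesis using ps(1) *(1) by (intro exI[of _ "(p, q) # ps @ [(p, q)]"]) auto
  qed
  consider "length u \<ge> 4" | "length v \<ge> 4" | "length u \<le> 3" "length v \<le> 3" by linarith
  then show ?case
  proof cases
    case 1 then show ?thesis using main less(2) by blast
  next
    case 2
    then have "\<exists>ps. (\<forall>p\<in>set ps. short_swappable p) \<and> swap v u = comps ps"
      using main[of v u] swappable_sym less(2) by simp
    moreover have "swap u v = swap v u" using swap_commute[of u v] less(2) by (simp add: swappable_def)
    ultimately show ?thesis by simp
  next
    case 3
    then have "short_swappable (u, v)" using less(2) by (simp add: short_swappable_def)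
    then show ?thesis by (intro exI[of _ "[(u, v)]"]) simp
  qed
qed

lemma comps_short:
  "(\<forall>p\<in>set ps. swappable (fst p) (snd p)) \<Longrightarrow> \<exists>qs. (\<forall>p\<in>set qs. short_swappable p) \<and> comps ps = comps qs"
proof (induct ps)
  case Nil then show ?case by (intro exI[of _ "[]"]) simp
next
  case (Cons p ps)
  then obtain qs where "\<forall>p\<in>set qs. short_swappable p" "comps ps = comps qs" by auto
  moreover obtain rs where "\<forall>p\<in>set rs. short_swappable p" "swap (fst p) (snd p) = comps rs"
    using short_swaps[of "fst p" "snd p"] Cons by auto
  ultimately show ?case by (intro exI[of _ "rs @ qs"]) (auto simp: comps_append)
qed

theorem canonical_between_short_swaps:
  assumes "canonical_between g C C'"
  shows "\<exists>ps. (\<forall>p\<in>set ps. short_swappable p) \<and> (\<forall>w\<in>W - C. g w = comps ps w)"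
  using canonical_between_swaps[OF assms] comps_short by metis

lemma finite_short_swappable: "finite {p. short_swappable p}"
proof (rule finite_subset)
  show "{p. short_swappable p} \<subseteq> {w. set w \<subseteq> {0..d} \<and> length w \<le> 3} \<times> {w. set w \<subseteq> {0..d} \<and> length w \<le> 3}"
    by (auto simp: short_swappable_def swappable_def W_def)
  show "finite ({w. set w \<subseteq> {0..d} \<and> length w \<le> 3} \<times> {w. set w \<subseteq> {0..d} \<and> length w \<le> 3})"
    by (intro finite_cartesian_product finite_lists_length_le) simp_all
qed

end

section \<open>Coding of the vertices by words\<close>

text \<open>The least element that moves cannot be the value of a smaller one, as those are fixed.
  If it were the value of a larger one, it would itself be sent to a smaller element, which is
  fixed, against monotonicity.\<close>

lemma strict_mono_bij_id:
  fixes \<sigma> :: "nat \<Rightarrow> nat"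
  assumes "\<sigma> ` A = A" and mono: "\<And>a b. a \<in> A \<Longrightarrow> b \<in> A \<Longrightarrow> a < b \<Longrightarrow> \<sigma> a < \<sigma> b"
  shows "a \<in> A \<Longrightarrow> \<sigma> a = a"
proof (induct a rule: less_induct)
  case (less a)
  have below: "\<sigma> b = b" if "b \<in> A" "b < a" for b using less that by blast
  obtain b where b: "b \<in> A" "a = \<sigma> b" using assms(1) less(2) by blast
  have "\<not> b < a" using below[OF b(1)] b(2) by auto
  moreover have "\<not> a < b"
  proof
    assume "a < b"
    then have "\<sigma> a < a" using mono less(2) b by metis
    moreover have "\<sigma> a \<in> A" using assms(1) less(2) by blast
    ultimately have "\<sigma> (\<sigma> a) = \<sigma> a" "\<sigma> (\<sigma> a) < \<sigma> a" using below mono less(2) by blast+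
    then show False by simp
  qed
  ultimately show ?case using b by simp
qed

locale typed_tree = branching_tree G v0 d col
  for G :: "'v pair_pre_digraph" and v0 :: 'v and d :: nat and col :: "'v \<times> 'v \<Rightarrow> nat" +
  fixes F :: "(nat \<Rightarrow> nat) set" and ref :: "nat set \<Rightarrow> nat" and f :: "nat \<Rightarrow> nat \<Rightarrow> nat"
  assumes F_subgroup: "subgroup F (BijGroup {0..d})"
    and reference: "reference_choice d F ref f"
begin

abbreviation orb :: "nat \<Rightarrow> nat set" where
  "orb \<equiv> colour_orbit F"

section \<open>The colour group and its orbits\<close>

lemma F_bij: "p \<in> F \<Longrightarrow> bij_betw p {0..d} {0..d}"
  using subgroup.subset[OF F_subgroup] by (auto simp: BijGroup_def Bij_def)

lemma F_range: "p \<in> F \<Longrightarrow> c \<le> d \<Longrightarrow> p c \<le> d"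
  using bij_betwE[OF F_bij, of p] by auto

lemma F_inj: "p \<in> F \<Longrightarrow> a \<le> d \<Longrightarrow> b \<le> d \<Longrightarrow> p a = p b \<Longrightarrow> a = b"
  using bij_betw_imp_inj_on[OF F_bij, of p] inj_onD[of p "{0..d}" a b] by auto

lemma F_id: "(\<lambda>c\<in>{0..d}. c) \<in> F"
  using subgroup.one_closed[OF F_subgroup] by (simp add: BijGroup_def)

lemma F_comp:
  assumes "p \<in> F" "q \<in> F"
  shows "\<exists>r\<in>F. \<forall>c\<le>d. r c = p (q c)"
proof -
  have B: "p \<in> Bij {0..d}" "q \<in> Bij {0..d}"
    using subgroup.subset[OF F_subgroup] assms by (auto simp: BijGroup_def)
  have "p \<otimes>\<^bsub>BijGroup {0..d}\<^esub> q \<in> F" using subgroup.m_closed[OF F_subgroup] assms by blast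
  then have "compose {0..d} p q \<in> F" using B by (simp add: BijGroup_def)
  then show ?thesis by (rule bexI[rotated]) (simp add: compose_def)
qed

lemma F_inv:
  assumes "p \<in> F"
  shows "\<exists>r\<in>F. \<forall>c\<le>d. r (p c) = c \<and> p (r c) = c"
proof -
  have B: "p \<in> Bij {0..d}" using subgroup.subset[OF F_subgroup] assms by (auto simp: BijGroup_def)
  let ?r = "\<lambda>c\<in>{0..d}. inv_into {0..d} p c"
  have "inv\<^bsub>BijGroup {0..d}\<^esub> p \<in> F" using subgroup.m_inv_closed[OF F_subgroup] assms by blast
  then have "?r \<in> F" using B by (simp add: inv_BijGroup)
  moreover have "?r (p c) = c" "p (?r c) = c" if "c \<le> d" for c
    using that F_range[OF assms] F_bij[OF assms]
    by (simp_all add: bij_betw_inv_into_left bij_betw_inv_into_right)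
  ultimately show ?thesis by blast
qed

lemma orb_self: "c \<le> d \<Longrightarrow> c \<in> orb c"
  unfolding colour_orbit_def using F_id by (intro CollectI exI[of _ "\<lambda>c\<in>{0..d}. c"]) simp

lemma orb_apply: "p \<in> F \<Longrightarrow> c \<le> d \<Longrightarrow> orb (p c) = orb c"
proof -
  assume p: "p \<in> F" and c: "c \<le> d"
  obtain r where r: "r \<in> F" "r (p c) = c" using F_inv[OF p] c by blast
  have "q (p c) \<in> orb c" if q: "q \<in> F" for q
  proof -
    obtain s where "s \<in> F" "s c = q (p c)" using F_comp[OF q p] c by blast
    then show ?thesis unfolding colour_orbit_def by (intro CollectI exI[of _ s]) simp
  qed
  moreover have "q c \<in> orb (p c)" if q: "q \<in> F" for q
  proof -
    obtain s where "s \<in> F" "s (p c) = q c" using F_comp[OF q r(1)] r(2) F_range[OF p c] by metis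
    then show ?thesis unfolding colour_orbit_def by (intro CollectI exI[of _ s]) simp
  qed
  ultimately have "orb (p c) \<subseteq> orb c" "orb c \<subseteq> orb (p c)"
    unfolding colour_orbit_def[of F "p c"] colour_orbit_def[of F c] by blast+
  then show ?thesis by (rule subset_antisym)
qed

lemma orb_memD: "c \<le> d \<Longrightarrow> c' \<in> orb c \<Longrightarrow> c' \<le> d \<and> orb c' = orb c"
proof -
  assume c: "c \<le> d" and "c' \<in> orb c"
  then obtain p where "p \<in> F" "c' = p c" unfolding colour_orbit_def by blast
  then show ?thesis using orb_apply F_range c by simp
qed

lemma f_props:
  assumes "c \<le> d"
  shows "f c \<in> F" "f c c = ref (orb c)" "ref (orb c) \<in> orb c"
  using reference assms by (auto simp: reference_choice_def)

sublocale words: typed_words d "colour_orbit F" "\<lambda>c. ref (colour_orbit F c)"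
proof
  show "2 \<le> d" by (rule d_ge_2)
  show "c \<in> orb c" if "c \<le> d" for c using orb_self that .
  show "c' \<le> d" "orb c' = orb c" if "c \<le> d" "c' \<in> orb c" for c c' using orb_memD that by blast+
  show "ref (orb c) \<in> orb c" if "c \<le> d" for c using f_props(3) that .
  show "ref (orb c) = ref (orb c')" if "c \<le> d" "c' \<le> d" "orb c = orb c'" for c c' using that by simp
qed

text \<open>The colour of the edge from the parent of \<open>x\<close> to \<open>x\<close>, as seen by the order on siblings.\<close>

definition norm_col :: "'v \<Rightarrow> nat" where
  "norm_col x = (if parent x = v0 then col (v0, x)
     else f (col (parent x, parent (parent x))) (col (parent x, x)))"

section \<open>The bijection between vertices and words\<close>

primrec code_up :: "nat \<Rightarrow> 'v \<Rightarrow> nat list" where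
  "code_up 0 v = []" |
  "code_up (Suc n) v = code_up n (parent v) @ [norm_col v]"

definition code :: "'v \<Rightarrow> nat list" where
  "code v = code_up (depth v) v"

lemma code_root [simp]: "code v0 = []"
  by (simp add: code_def)

lemma code_child: "w \<in> children v \<Longrightarrow> code w = code v @ [norm_col w]"
  using depth_child[of w v] parent_child[of w v] by (simp add: code_def)

lemma code_nonroot: "w \<in> pverts G \<Longrightarrow> w \<noteq> v0 \<Longrightarrow> code w = code (parent w) @ [norm_col w]"
  using code_child parent_props(4) by blast

lemma code_Nil_iff: "w \<in> pverts G \<Longrightarrow> code w = [] \<longleftrightarrow> w = v0"
  using code_nonroot[of w] by (cases "w = v0") auto

lemma parent_col_le: "w \<in> pverts G \<Longrightarrow> w \<noteq> v0 \<Longrightarrow> col (w, parent w) \<le> d"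
  using col_range[OF parent_props(2)] by auto

lemma norm_col_below: "y \<noteq> v0 \<Longrightarrow> x \<in> children y \<Longrightarrow> norm_col x = f (col (y, parent y)) (col (y, x))"
  using parent_child[of x y] by (simp add: norm_col_def)

lemma norm_col_root: "x \<in> children v0 \<Longrightarrow> norm_col x = col (v0, x)"
  using parent_child[of x v0] by (simp add: norm_col_def)

lemma child_nb: "x \<in> children y \<Longrightarrow> x \<in> nbrs y"
  by (simp add: children_altdef)

lemma child_col_le: "x \<in> children y \<Longrightarrow> col (y, x) \<le> d"
  using col_range[OF child_nb] by auto

lemma col_parent: "x \<in> children y \<Longrightarrow> col (x, parent x) = col (y, x)"
  using col_sym[OF child_nb, of x y] parent_child[of x y] by simp

lemma norm_col_props:
  assumes x: "x \<in> children y"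
  shows "norm_col x \<le> d" "orb (norm_col x) = label F x"
proof -
  have c: "col (y, x) \<le> d" by (rule child_col_le[OF x])
  have l: "label F x = orb (col (y, x))" using col_parent[OF x] by (simp add: label_def)
  have "norm_col x \<le> d \<and> orb (norm_col x) = orb (col (y, x))"
  proof (cases "y = v0")
    case True then show ?thesis using norm_col_root x c by simp
  next
    case False
    have "col (y, parent y) \<le> d" using parent_col_le[OF children_verts(2)[OF x] False] .
    then show ?thesis using norm_col_below[OF False x] f_props(1) F_range c orb_apply by simp
  qed
  then show "norm_col x \<le> d" "orb (norm_col x) = label F x" using l by auto
qed

lemma label_code: "w \<in> pverts G \<Longrightarrow> w \<noteq> v0 \<Longrightarrow> words.lab (code w) = label F w"
  using norm_col_props(2)[OF parent_props(4)] code_nonroot by (simp add: words.lab_def)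

lemma ref_label: "w \<in> pverts G \<Longrightarrow> w \<noteq> v0 \<Longrightarrow> f (col (w, parent w)) (col (w, parent w)) = ref (label F w)"
  using f_props(2)[OF parent_col_le] by (simp add: label_def)

text \<open>The permutation \<open>f \<chi>\<close> takes the parent's colour to the reference
  colour, so the colours that remain for the children are normalised to a set that depends only on
  the label of \<open>y\<close>. This is what allows vertices to be coded by words with one
  forbidden letter.\<close>

lemma norm_col_bij:
  assumes y: "y \<in> pverts G" "y \<noteq> v0"
  shows "bij_betw norm_col (children y) ({0..d} - {ref (label F y)})"
proof -
  let ?\<chi> = "col (y, parent y)"
  have p: "f ?\<chi> \<in> F" by (rule f_props(1)[OF parent_col_le[OF y]])
  have r: "f ?\<chi> ?\<chi> = ref (label F y)" by (rule ref_label[OF y])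
  have "bij_betw (\<lambda>x. col (y, x)) (nbrs y - {parent y}) ({0..d} - {?\<chi>})"
    by (rule bij_betw_subset[OF col_bij[OF y(1)]])
      (use col_bij[OF y(1)] parent_props(2)[OF y] in \<open>auto simp: bij_betw_def inj_on_def\<close>)
  moreover have "nbrs y - {parent y} = children y"
    using nb_nonroot[OF y] parent_notin_children[OF y] by blast
  moreover have "bij_betw (f ?\<chi>) ({0..d} - {?\<chi>}) ({0..d} - {ref (label F y)})"
    by (rule bij_betw_subset[OF F_bij[OF p]])
      (use F_bij[OF p] r parent_col_le[OF y] in \<open>auto simp: bij_betw_def inj_on_def\<close>)
  ultimately have "bij_betw (f ?\<chi> \<circ> (\<lambda>x. col (y, x))) (children y) ({0..d} - {ref (label F y)})"
    using bij_betw_trans by metis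
  then show ?thesis
    using norm_col_below[OF y(2)] by (simp cong: bij_betw_cong)
qed

lemma norm_col_bij_root: "bij_betw norm_col (children v0) {0..d}"
proof -
  have "bij_betw (\<lambda>x. col (v0, x)) (children v0) {0..d}" using col_bij[OF root_vert] by (simp add: nb_root)
  then show ?thesis using norm_col_root by (simp cong: bij_betw_cong)
qed

lemma norm_col_inj: "x \<in> children y \<Longrightarrow> x' \<in> children y \<Longrightarrow> norm_col x = norm_col x' \<Longrightarrow> x = x'"
proof -
  assume x: "x \<in> children y" "x' \<in> children y" "norm_col x = norm_col x'"
  have "inj_on norm_col (children y)"
    using norm_col_bij norm_col_bij_root children_verts(2)[OF x(1)] by (cases "y = v0") (auto simp: bij_betw_def)
  then show ?thesis using x inj_onD by metis
qed

lemma code_W: "v \<in> pverts G \<Longrightarrow> code v \<in> words.W"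
proof (induct v rule: tree_induct)
  case root then show ?case by simp
next
  case (step w)
  let ?y = "parent w"
  have x: "w \<in> children ?y" and yv: "?y \<in> pverts G" using parent_props step by blast+
  have cw: "code w = code ?y @ [norm_col w]" by (rule code_nonroot[OF step(1,2)])
  show ?case
  proof (cases "?y = v0")
    case True
    then show ?thesis using cw norm_col_props(1)[OF x] words.W_single by simp
  next
    case False
    have "norm_col w \<noteq> ref (label F ?y)" using norm_col_bij[OF yv False] x by (auto simp: bij_betw_def)
    moreover have "orb (last (code ?y)) = label F ?y" using label_code[OF yv False] by (simp add: words.lab_def)
    ultimately show ?thesis
      unfolding cw using words.W_snoc[OF step(3)] code_Nil_iff[OF yv] False norm_col_props(1)[OF x] by simp
  qed
qed

lemma child_ex:
  assumes "y \<in> pverts G" "code y @ [c] \<in> words.W"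
  shows "\<exists>x\<in>children y. norm_col x = c"
proof (cases "y = v0")
  case True
  then have "c \<in> {0..d}" using assms words.W_single by simp
  then show ?thesis using norm_col_bij_root True unfolding bij_betw_def by (metis imageE)
next
  case False
  have "orb (last (code y)) = label F y" using label_code[OF assms(1) False] by (simp add: words.lab_def)
  then have "c \<in> {0..d} - {ref (label F y)}"
    using words.W_snoc[OF code_W[OF assms(1)]] assms code_Nil_iff[OF assms(1)] False by auto
  then show ?thesis using norm_col_bij[OF assms(1) False] unfolding bij_betw_def by (metis imageE)
qed

lemma code_inj: "v \<in> pverts G \<Longrightarrow> w \<in> pverts G \<Longrightarrow> code v = code w \<Longrightarrow> v = w"
proof (induct v arbitrary: w rule: tree_induct)
  case root then show ?case using code_Nil_iff[of w] by simp
next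
  case (step v)
  have w0: "w \<noteq> v0" using step code_Nil_iff[of v] by auto
  have "code (parent v) = code (parent w)" "norm_col v = norm_col w"
    using step(5) code_nonroot[OF step(1,2)] code_nonroot[OF step(4) w0] by auto
  then show ?case
    using step(3)[OF parent_props(1)[OF step(4) w0]] norm_col_inj parent_props(4)[OF step(1,2)] parent_props(4)[OF step(4) w0] by metis
qed

lemma code_surj: "w \<in> words.W \<Longrightarrow> \<exists>v\<in>pverts G. code v = w"
proof (induct w rule: rev_induct)
  case Nil then show ?case using root_vert code_root by blast
next
  case (snoc c w)
  then obtain y where y: "y \<in> pverts G" "code y = w" using words.W_append by blast
  then obtain x where "x \<in> children y" "norm_col x = c" using child_ex snoc by blast
  then show ?case using code_child y(2) children_verts(1) by blast
qed

lemma code_bij: "bij_betw code (pverts G) words.W"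
  unfolding bij_betw_def inj_on_def using code_inj code_W code_surj by blast

definition decode :: "nat list \<Rightarrow> 'v" where
  "decode = inv_into (pverts G) code"

lemma decode_code [simp]: "v \<in> pverts G \<Longrightarrow> decode (code v) = v"
  unfolding decode_def using bij_betw_inv_into_left[OF code_bij] .

lemma code_dec [simp]: "w \<in> words.W \<Longrightarrow> code (decode w) = w"
  unfolding decode_def using bij_betw_inv_into_right[OF code_bij] .

lemma decode_vert: "w \<in> words.W \<Longrightarrow> decode w \<in> pverts G"
  using code_surj decode_code by metis

lemma decode_bij: "bij_betw decode words.W (pverts G)"
  unfolding decode_def by (rule bij_betw_inv_into[OF code_bij])

lemma child_code: "x \<in> pverts G \<Longrightarrow> y \<in> pverts G \<Longrightarrow> x \<in> children y \<longleftrightarrow> (\<exists>c. code x = code y @ [c])"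
proof
  assume v: "x \<in> pverts G" "y \<in> pverts G" and "\<exists>c. code x = code y @ [c]"
  then obtain c where c: "code x = code y @ [c]" by blast
  then obtain z where z: "z \<in> children y" "norm_col z = c" using child_ex code_W[OF v(1)] v by metis
  then have "code z = code x" using code_child c by simp
  then show "x \<in> children y" using code_inj v children_verts(1)[OF z(1)] z(1) by metis
qed (use code_child in blast)

section \<open>V_F as a group of locally canonical maps\<close>

definition canon :: "('v \<Rightarrow> 'v) \<Rightarrow> 'v \<Rightarrow> bool" where
  "canon g w \<longleftrightarrow> w \<noteq> v0 \<and> g w \<in> pverts G \<and> g w \<noteq> v0 \<and> label F (g w) = label F w \<and>
     (\<forall>x\<in>children w. g x \<in> children (g w) \<and> norm_col (g x) = norm_col x)"

text \<open>The children of \<open>w\<close> and those of \<open>g w\<close> have the same set of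
  normalised colours, because the labels agree or both vertices are the root. The map induced on
  this set is increasing and onto, hence the identity.\<close>

lemma order_preserving_nc:
  assumes g: "inj_on g (children w)" "g ` children w = children (g w)" and w: "w \<in> pverts G" "g w \<in> pverts G"
    and l: "w = v0 \<and> g w = v0 \<or> w \<noteq> v0 \<and> g w \<noteq> v0 \<and> label F (g w) = label F w"
    and mono: "\<And>x y. x \<in> children w \<Longrightarrow> y \<in> children w \<Longrightarrow> norm_col x < norm_col y \<Longrightarrow> norm_col (g x) < norm_col (g y)"
    and x: "x \<in> children w"
  shows "norm_col (g x) = norm_col x"
proof -
  let ?A = "norm_col ` children w"
  have A: "norm_col ` children (g w) = ?A"
    using l bij_betw_imp_surj_on[OF norm_col_bij[OF w(1)]] bij_betw_imp_surj_on[OF norm_col_bij[OF w(2)]] by metis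
  define \<sigma> where "\<sigma> = (\<lambda>c. norm_col (g (inv_into (children w) norm_col c)))"
  have inj: "inj_on norm_col (children w)" using norm_col_inj by (auto simp: inj_on_def)
  have s: "\<sigma> (norm_col y) = norm_col (g y)" if "y \<in> children w" for y
    using inv_into_f_f[OF inj that] by (simp add: \<sigma>_def)
  have "\<sigma> ` ?A = norm_col ` g ` children w" using s by (force simp: image_image)
  then have "\<sigma> ` ?A = ?A" using g(2) A by simp
  moreover have "\<sigma> a < \<sigma> b" if "a \<in> ?A" "b \<in> ?A" "a < b" for a b using that s mono by auto
  ultimately have "\<sigma> (norm_col x) = norm_col x" using strict_mono_bij_id[of \<sigma> ?A] x by blast
  then show ?thesis using s[OF x] by simp
qed

lemma child_less_nc:
  assumes "w1 \<in> children v" "w2 \<in> children v"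
  shows "child_less f v w1 w2 \<longleftrightarrow> norm_col w1 < norm_col w2"
  using assms norm_col_root[of w1] norm_col_root[of w2] norm_col_below[of v w1] norm_col_below[of v w2] col_parent[of w1 v] col_parent[of w2 v]
  by (auto simp: child_less_def)

lemma V_supset: "mostly canon \<subseteq> V F f"
proof
  fix X assume "X \<in> mostly canon"
  then obtain g where g: "X = cls g" "near g" "finite {w \<in> pverts G. \<not> canon g w}" by (auto simp: mostly_def)
  then obtain C where C: "good g C" "{w \<in> pverts G. \<not> canon g w} \<inter> pverts G \<subseteq> C" using good_ex by blast
  have canonical_at: "canon g w" if "w \<in> pverts G - C" for w using C(2) that by blast
  obtain C' where C': "ancestor_closed C'" "v0 \<in> C'" "g ` (pverts G - C) = pverts G - C'"
    using good_range[OF C(1)] .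
  have cl: "ancestor_closed C" by (rule goodD(1)[OF C(1)])
  have h: "honest (span_tree C) (span_tree C') (forest_map C g)" by (rule good_honest[OF C(1) C'(1,3)])
  have r: "the (forest_map C g v) = g v" if "v \<in> pverts G - C" for v using that by (simp add: forest_map_def)
  have below: "children v \<subseteq> pverts G - C" if "v \<in> pverts G - C" for v
    using that ancestor_closedD(4)[OF cl] children_verts(1) by blast
  have "label_preserving F f (forest_map C g)"
    unfolding label_preserving_def
  proof (rule exI[of _ "span_tree C"], rule exI[of _ "span_tree C'"],
      unfold forest_verts_span_tree[OF cl], intro conjI ballI impI disjI2)
    show "honest (span_tree C) (span_tree C') (forest_map C g)" by (rule h)
    fix v assume v: "v \<in> pverts G - C"
    have gc: "g ` children v = children (g v)" using goodD(6)[OF C(1)] v by blast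
    have "(\<lambda>w. the (forest_map C g w)) ` children v = g ` children v"
      using below[OF v] r by (intro image_cong) auto
    then show "(\<lambda>w. the (forest_map C g w)) ` children v = children (the (forest_map C g v))" using gc r[OF v] by simp
    fix w1 w2 assume w: "w1 \<in> children v" "w2 \<in> children v" "child_less f v w1 w2"
    have "g w1 \<in> children (g v)" "g w2 \<in> children (g v)" "norm_col (g w1) = norm_col w1" "norm_col (g w2) = norm_col w2"
      using canonical_at[OF v] w by (auto simp: canon_def)
    then have "child_less f (g v) (g w1) (g w2)" using child_less_nc w by simp
    then show "child_less f (the (forest_map C g v)) (the (forest_map C g w1)) (the (forest_map C g w2))"
      using r[OF v] r[of w1, OF subsetD[OF below[OF v] w(1)]] r[of w2, OF subsetD[OF below[OF v] w(2)]] by simp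
  next
    fix v assume "v \<in> leaves (span_tree C)"
    then have "v \<in> pverts G - C"
      unfolding leaves_span_tree[OF cl] using span_tree_complete[OF cl] by (auto simp: complete_subtree_def)
    then show "label F v = label F (the (forest_map C g v))" using r canonical_at by (simp add: canon_def)
  qed
  moreover have "forest_map C g \<in> X" using good_restr_cls[OF C(1)] g(1) by simp
  moreover have "X \<in> carrier AAut" unfolding carrier_AAut using g by blast
  ultimately show "X \<in> V F f" unfolding V_def by blast
qed

lemma V_subset: "V F f \<subseteq> mostly canon"
proof
  fix X assume "X \<in> V F f"
  then obtain \<phi> where X: "X \<in> carrier AAut" "\<phi> \<in> X" "label_preserving F f \<phi>" by (auto simp: V_def)
  then obtain T1 T2 where h: "honest T1 T2 \<phi>"
    and ch: "\<And>v. v \<in> forest_verts T1 \<Longrightarrow> (\<lambda>w. the (\<phi> w)) ` children v = children (the (\<phi> v))"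
    and mono: "\<And>v w1 w2. v \<in> forest_verts T1 \<Longrightarrow> w1 \<in> children v \<Longrightarrow> w2 \<in> children v \<Longrightarrow>
      child_less f v w1 w2 \<Longrightarrow> child_less f (the (\<phi> v)) (the (\<phi> w1)) (the (\<phi> w2))"
    and lab: "T1 = {v0} \<and> T2 = {v0} \<or> (\<forall>v\<in>leaves T1. label F v = label F (the (\<phi> v)))"
    unfolding label_preserving_def by (elim exE conjE) (rule that; blast)
  define g where "g = the \<circ> \<phi>"
  obtain C1 C2 where C: "ancestor_closed C1" "ancestor_closed C2" "T1 = span_tree C1" "T2 = span_tree C2"
    and D: "dom \<phi> = pverts G - C1" "ran \<phi> = pverts G - C2" "inj_on \<phi> (pverts G - C1)"
    using h by (rule honestE) (rule that)
  have fv: "forest_verts T1 = pverts G - C1" using forest_verts_span_tree[OF C(1)] C(3) by simp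
  have is_honest: "is_honest \<phi>" using h by (auto simp: is_honest_def)
  have ng: "near g" "\<phi> \<in> cls g" using honest_near[OF is_honest] is_honest by (simp_all add: g_def cls_def)
  have some: "\<phi> v = Some (g v)" if "v \<in> pverts G - C1" for v using that D(1) by (force simp: g_def)
  have gv: "g v \<in> pverts G" if "v \<in> pverts G - C1" for v
    using some[OF that] D(2) by (metis DiffD1 ranI)
  have inj: "inj_on g (pverts G - C1)"
    using D(3) some by (metis (no_types, lifting) inj_on_def)
  have gch: "g ` children v = children (g v)" if "v \<in> pverts G - C1" for v
    using ch[of v] that fv by (simp add: g_def comp_def)
  have below: "children v \<subseteq> pverts G - C1" if "v \<in> pverts G - C1" for v
    using that ancestor_closedD(4)[OF C(1)] children_verts(1) by blast
  have norm_col: "norm_col (g x) = norm_col x" if v: "v \<in> pverts G - C1" and x: "x \<in> children v"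
    and l: "v = v0 \<and> g v = v0 \<or> v \<noteq> v0 \<and> g v \<noteq> v0 \<and> label F (g v) = label F v" for v x
  proof (rule order_preserving_nc[OF _ gch[OF v] _ gv[OF v] l _ x])
    show "inj_on g (children v)" using inj below[OF v] by (rule inj_on_subset)
    show "v \<in> pverts G" using v by blast
    fix x y assume xy: "x \<in> children v" "y \<in> children v" "norm_col x < norm_col y"
    then have "child_less f v x y" using child_less_nc by blast
    then have "child_less f (g v) (g x) (g y)" using mono[of v x y] v fv xy by (simp add: g_def)
    moreover have "g x \<in> children (g v)" "g y \<in> children (g v)" using gch[OF v] xy by blast+
    ultimately show "norm_col (g x) < norm_col (g y)" using child_less_nc by blast
  qed
  \<comment> \<open>This covers the case of the tree \<open>{v0}\<close>, in which no label is
    prescribed: only the root has \<open>d + 1\<close> children.\<close>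
  have root: "g v0 = v0" if "v0 \<notin> C1"
  proof (rule ccontr)
    assume "g v0 \<noteq> v0"
    have v: "v0 \<in> pverts G - C1" using that root_vert by blast
    have "card (g ` children v0) = d + 1"
      using card_image[of g "children v0"] inj below[OF v] card_children_root inj_on_subset by metis
    then show False using gch[OF v] card_children[OF gv[OF v] \<open>g v0 \<noteq> v0\<close>] by simp
  qed
  \<comment> \<open>Labels are prescribed at the leaves only. They propagate downwards, since a
    normalised colour lies in the orbit that is the label of its vertex and normalised colours of
    children are kept.\<close>
  have lv: "w \<notin> C1 \<longrightarrow> w \<noteq> v0 \<longrightarrow> label F (g w) = label F w" if "w \<in> pverts G" for w
    using that
  proof (induct w rule: tree_induct)
    case root then show ?case by simp
  next
    case (step w)
    show ?case
    proof (intro impI)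
      assume w: "w \<notin> C1" "w \<noteq> v0"
      have x: "w \<in> children (parent w)" and pv: "parent w \<in> pverts G" using parent_props step by blast+
      show "label F (g w) = label F w"
      proof (cases "parent w \<in> C1")
        case True
        then have "span_tree C1 \<noteq> {v0}" using x w by (auto simp: span_tree_def)
        moreover have "w \<in> leaves T1" using True w x unfolding C(3) leaves_span_tree[OF C(1)] by (auto simp: span_tree_def)
        ultimately show ?thesis using lab C(3) by (auto simp: g_def)
      next
        case False
        then have p: "parent w \<in> pverts G - C1" using pv by blast
        have l: "parent w = v0 \<and> g (parent w) = v0 \<or>
          parent w \<noteq> v0 \<and> g (parent w) \<noteq> v0 \<and> label F (g (parent w)) = label F (parent w)"
          using root False step(3) not_root_below[OF pv _ gch[OF p]] by auto
        have "norm_col (g w) = norm_col w" by (rule norm_col[OF p x l])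
        moreover have "g w \<in> children (g (parent w))" using gch[OF p] x by blast
        ultimately show ?thesis using norm_col_props(2) x by metis
      qed
    qed
  qed
  have "canon g w" if w: "w \<in> pverts G - C1" "w \<noteq> v0" for w
  proof -
    have n: "g w \<noteq> v0" using not_root_below[OF _ w(2) gch[OF w(1)]] w(1) by blast
    have l: "label F (g w) = label F w" using lv w by blast
    have "g x \<in> children (g w) \<and> norm_col (g x) = norm_col x" if "x \<in> children w" for x
      using gch[OF w(1)] that norm_col[OF w(1) that] n l w(2) by blast
    then show ?thesis unfolding canon_def using n l w gv by blast
  qed
  then have "{w \<in> pverts G. \<not> canon g w} \<subseteq> insert v0 C1" by blast
  then have "finite {w \<in> pverts G. \<not> canon g w}"
    using ancestor_closedD(1)[OF C(1)] by (meson finite_insert finite_subset)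
  moreover have "X = cls g"
  proof -
    obtain h where "X = cls h" using X(1) unfolding carrier_AAut by blast
    then show ?thesis using class_cls X(2) ng(2) by metis
  qed
  ultimately show "X \<in> mostly canon" using ng(1) by (auto simp: mostly_def)
qed

lemma V_mostly: "V F f = mostly canon"
  using V_supset V_subset by blast

text \<open>Provides the common part of the two proofs that inverses satisfy a local condition:
  almost every vertex \<open>y\<close> is the image of a vertex \<open>w\<close> outside
  \<open>A\<close> such that the whole neighbourhood of \<open>y\<close> is pulled back to that of
  \<open>w\<close>.\<close>

lemma near_inv_local:
  assumes g: "near g" "almost_eq (g' \<circ> g) id" and A: "finite A"
  shows "\<exists>B. finite B \<and> (\<forall>y\<in>pverts G - B. \<exists>w\<in>pverts G - A. y = g w \<and> g' y = w \<and> w \<noteq> v0 \<and> y \<noteq> v0 \<and>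
    nbrs y = g ` nbrs w \<and> children y = g ` children w \<and> (\<forall>x\<in>nbrs w. g' (g x) = x))"
proof -
  let ?D = "{w \<in> pverts G. g' (g w) \<noteq> w}"
  have "finite (A \<union> ?D)" using A g(2) by (simp add: almost_eq_def)
  then obtain C where C: "good g C" "(A \<union> ?D) \<inter> pverts G \<subseteq> C" using good_ex[OF g(1)] by blast
  obtain C' where C': "ancestor_closed C'" "v0 \<in> C'" "g ` (pverts G - C) = pverts G - C'"
    using good_range[OF C(1)] .
  \<comment> \<open>The images of the children of \<open>C\<close> are removed as well, so that the
    parent of the preimage is outside \<open>C\<close> and the edge to it is under control.\<close>
  let ?B = "C' \<union> g ` (\<Union>v\<in>C. children v)"
  have "finite ?B" using ancestor_closedD(1)[OF C'(1)] goodD(9)[OF C(1)] finite_children by simp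
  moreover have "\<exists>w\<in>pverts G - A. y = g w \<and> g' y = w \<and> w \<noteq> v0 \<and> y \<noteq> v0 \<and>
    nbrs y = g ` nbrs w \<and> children y = g ` children w \<and> (\<forall>x\<in>nbrs w. g' (g x) = x)" if y: "y \<in> pverts G - ?B" for y
  proof -
    have "y \<in> g ` (pverts G - C)" using y C'(3) by blast
    then obtain w where w: "w \<in> pverts G" "w \<notin> C" "y = g w" by blast
    have w0: "w \<noteq> v0" using w goodD(2)[OF C(1)] by blast
    have inv: "g' (g x) = x" if "x \<in> pverts G" "x \<notin> C" for x using C(2) that by blast
    have p: "parent w \<notin> C" using y w parent_props(4)[OF w(1) w0] by blast
    have "x \<in> pverts G" "x \<notin> C" if x: "x \<in> nbrs w" for x
    proof -
      show "x \<in> pverts G" using nb_verts(1)[OF x] .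
      show "x \<notin> C"
        using x p ancestor_closedD(4)[OF goodD(1)[OF C(1)], of x w] w(2) nb_cases[of x w] by blast
    qed
    then have "\<forall>x\<in>nbrs w. g' (g x) = x" using inv by blast
    moreover have "w \<in> pverts G - A" using w C(2) by blast
    ultimately show ?thesis
      using w w0 inv[OF w(1,2)] good_parent[OF C(1) w(1) w0 p w(2)] goodD(6)[OF C(1) w(1,2)] by blast
  qed
  ultimately show ?thesis by (intro exI[of _ ?B] conjI ballI) assumption
qed

lemma V_subgroup_AAut: "subgroup (V F f) AAut"
  unfolding V_mostly
proof (rule mostly_subgroup)
  have "canon id w" if "w \<in> pverts G" "w \<noteq> v0" for w using that by (simp add: canon_def)
  then have "{w \<in> pverts G. \<not> canon id w} \<subseteq> {v0}" by blast
  then show "finite {w \<in> pverts G. \<not> canon id w}" by (rule finite_subset) simp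
next
  fix g h w assume "canon h w" "canon g (h w)"
  then show "canon (g \<circ> h) w" by (auto simp: canon_def)
next
  fix g g' assume g: "near g" "almost_eq (g' \<circ> g) id" "finite {w \<in> pverts G. \<not> canon g w}"
  obtain B where B: "finite B" "\<forall>y\<in>pverts G - B. \<exists>w\<in>pverts G - {w \<in> pverts G. \<not> canon g w}.
    y = g w \<and> g' y = w \<and> w \<noteq> v0 \<and> y \<noteq> v0 \<and> nbrs y = g ` nbrs w \<and> children y = g ` children w \<and> (\<forall>x\<in>nbrs w. g' (g x) = x)"
    using near_inv_local[OF g] by blast
  have "canon g' y" if y: "y \<in> pverts G - B" for y
  proof -
    obtain w where w: "w \<in> pverts G" "canon g w" "y = g w" "g' y = w" "w \<noteq> v0" "y \<noteq> v0"
      "children y = g ` children w" "\<forall>x\<in>nbrs w. g' (g x) = x" using B(2) y by blast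
    have "g' x' \<in> children (g' y) \<and> norm_col (g' x') = norm_col x'" if "x' \<in> children y" for x'
      using that w(2,4,7,8) child_nb by (auto simp: canon_def)
    then show ?thesis using w by (auto simp: canon_def)
  qed
  then show "finite {w \<in> pverts G. \<not> canon g' w}"
    by (rule_tac finite_subset[OF _ B(1)]) blast
qed

section \<open>Transfer between words and vertices; the generators\<close>

definition tree_map :: "(nat list \<Rightarrow> nat list) \<Rightarrow> 'v \<Rightarrow> 'v" where
  "tree_map h = decode \<circ> h \<circ> code"

lemma tree_map_code: "v \<in> pverts G \<Longrightarrow> h (code v) \<in> words.W \<Longrightarrow> code (tree_map h v) = h (code v)"
  by (simp add: tree_map_def)

text \<open>The code of a child is the code of its parent followed by the normalised colour, so
  carrying a letter over means keeping a normalised colour. That all children of the image are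
  reached follows by counting.\<close>

lemma canonical_between_tree:
  assumes h: "words.canonical_between h A A'"
  shows "good (tree_map h) (decode ` A)" "w \<in> pverts G - decode ` A \<Longrightarrow> canon (tree_map h) w"
proof -
  have A: "finite A" "[] \<in> A" "A \<subseteq> words.W" "\<And>w. w \<in> A \<Longrightarrow> butlast w \<in> A" "finite A'" "A' \<subseteq> words.W"
    and b: "bij_betw h (words.W - A) (words.W - A')" and canonical_at: "\<And>w. w \<in> words.W - A \<Longrightarrow> words.canonical_at h w"
    using h by (auto simp: words.canonical_between_def words.prefix_closed_def)
  have cl: "ancestor_closed (decode ` A)" unfolding ancestor_closed_def
  proof (intro conjI ballI impI)
    show "finite (decode ` A)" using A by simp
    show "decode ` A \<subseteq> pverts G" using A(3) decode_vert by blast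
    fix v assume v: "v \<in> decode ` A" "v \<noteq> v0"
    then obtain w where w: "w \<in> A" "v = decode w" by blast
    then have vv: "v \<in> pverts G" "code v = w" using A(3) decode_vert by auto
    have "code (parent v) = butlast w" using code_nonroot[OF vv(1) v(2)] vv(2) by simp
    then have "parent v = decode (butlast w)" using decode_code parent_props(1)[OF vv(1) v(2)] by metis
    then show "parent v \<in> decode ` A" using A(4) w(1) by blast
  qed
  have root: "v0 \<in> decode ` A" using A(2) decode_code[OF root_vert] by force
  have cbij: "bij_betw code (pverts G - decode ` A) (words.W - A)"
  proof -
    have "code ` decode ` A = A" using A(3) by (force simp: image_image subset_iff)
    then have "bij_betw code (decode ` A) A"
      by (rule bij_betw_subset[OF code_bij ancestor_closedD(2)[OF cl]])
    then show ?thesis using bij_betw_DiffI[OF code_bij] A(3) cl by (auto simp: ancestor_closed_def)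
  qed
  have dbij: "bij_betw decode (words.W - A') (pverts G - decode ` A')"
    using bij_betw_DiffI[OF decode_bij bij_betw_subset[OF decode_bij A(6) refl] A(6)] A(6) decode_vert by blast
  have bij: "bij_betw (tree_map h) (pverts G - decode ` A) (pverts G - decode ` A')"
    unfolding tree_map_def using bij_betw_trans[OF bij_betw_trans[OF cbij b] dbij] by (simp add: comp_assoc)
  have cw: "code w \<in> words.W - A" if "w \<in> pverts G - decode ` A" for w using cbij that by (auto simp: bij_betw_def)
  have ct: "code (tree_map h w) = h (code w)" if "w \<in> pverts G - decode ` A" for w
    using tree_map_code cw[OF that] canonical_at[OF cw[OF that]] that by (simp add: words.canonical_at_def)
  have tv: "tree_map h w \<in> pverts G" if "w \<in> pverts G - decode ` A" for w using bij that by (auto simp: bij_betw_def)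
  have below: "children w \<subseteq> pverts G - decode ` A" if "w \<in> pverts G - decode ` A" for w
    using that ancestor_closedD(4)[OF cl] children_verts(1) by blast
  have ext: "code (tree_map h x) = code (tree_map h w) @ [norm_col x]" if w: "w \<in> pverts G - decode ` A" and x: "x \<in> children w" for w x
  proof -
    have xW: "code w @ [norm_col x] \<in> words.W" using code_child[OF x] code_W[OF children_verts(1)[OF x]] by simp
    have "code (tree_map h x) = h (code w @ [norm_col x])" using ct[of x] below[OF w] x code_child[OF x] by auto
    also have "\<dots> = h (code w) @ [norm_col x]" using canonical_at[OF cw[OF w]] xW by (simp add: words.canonical_at_def)
    finally show ?thesis using ct[OF w] by simp
  qed
  have tch: "tree_map h x \<in> children (tree_map h w)" if w: "w \<in> pverts G - decode ` A" and x: "x \<in> children w" for w x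
    using child_code[OF tv[of x] tv[OF w]] below[OF w] x ext[OF w x] by blast
  show cn: "canon (tree_map h) w" if w: "w \<in> pverts G - decode ` A" for w
  proof -
    have w0: "w \<noteq> v0" using root w by blast
    have c: "words.canonical_at h (code w)" by (rule canonical_at[OF cw[OF w]])
    have n: "tree_map h w \<noteq> v0" using ct[OF w] c code_Nil_iff[OF tv[OF w]] by (simp add: words.canonical_at_def)
    have "label F (tree_map h w) = label F w"
      using label_code[OF tv[OF w] n] label_code[of w] w w0 c ct[OF w] by (simp add: words.canonical_at_def)
    moreover have "tree_map h x \<in> children (tree_map h w) \<and> norm_col (tree_map h x) = norm_col x" if x: "x \<in> children w" for x
      using tch[OF w x] ext[OF w x] code_child by force
    ultimately show ?thesis unfolding canon_def using w0 n tv[OF w] by blast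
  qed
  have "tree_map h ` children w = children (tree_map h w)" if w: "w \<in> pverts G - decode ` A" for w
  proof (rule card_subset_eq)
    show "finite (children (tree_map h w))" by (rule finite_children)
    show "tree_map h ` children w \<subseteq> children (tree_map h w)" using tch[OF w] by blast
    have "card (tree_map h ` children w) = card (children w)"
      using bij below[OF w] by (meson bij_betw_def card_image inj_on_subset)
    moreover have "w \<noteq> v0" "tree_map h w \<noteq> v0" using cn[OF w] by (auto simp: canon_def)
    ultimately show "card (tree_map h ` children w) = card (children (tree_map h w))"
      using card_children tv[OF w] w by simp
  qed
  moreover have "finite (pverts G - (pverts G - decode ` A'))"
    using A(5) by (rule_tac finite_subset[of _ "decode ` A'"]) auto
  ultimately show "good (tree_map h) (decode ` A)"
    unfolding good_def using cl root bij by (auto simp: bij_betw_def)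
qed

text \<open>The passage in the opposite direction; it brings an element of V_F into the form to
  which \<open>words.canonical_between_short_swaps\<close> applies.\<close>

lemma canon_cgood:
  assumes g: "good g C" and C': "ancestor_closed C'" "v0 \<in> C'" "g ` (pverts G - C) = pverts G - C'"
    and canonical_at: "\<And>w. w \<in> pverts G - C \<Longrightarrow> canon g w"
  shows "words.canonical_between (code \<circ> g \<circ> decode) (code ` C) (code ` C')"
proof -
  have prefix_closed: "words.prefix_closed (code ` B)" if B: "ancestor_closed B" "v0 \<in> B" for B
    unfolding words.prefix_closed_def
  proof (intro conjI ballI)
    show "finite (code ` B)" using ancestor_closedD(1)[OF B(1)] by simp
    show "[] \<in> code ` B" using B(2) code_root by force
    show "code ` B \<subseteq> words.W" using ancestor_closedD(2)[OF B(1)] code_W by blast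
    fix w assume "w \<in> code ` B"
    then obtain v where v: "v \<in> B" "w = code v" by blast
    show "butlast w \<in> code ` B"
    proof (cases "v = v0")
      case True then show ?thesis using v by (metis butlast.simps(1) code_root image_eqI)
    next
      case False
      have "butlast w = code (parent v)"
        using code_nonroot[OF _ False] v ancestor_closedD(2)[OF B(1)] by auto
      then show ?thesis using ancestor_closedD(3)[OF B(1) v(1) False] by blast
    qed
  qed
  have cb: "bij_betw code (pverts G - B) (words.W - code ` B)" if "ancestor_closed B" for B
    using bij_betw_DiffI[OF code_bij bij_betw_subset[OF code_bij ancestor_closedD(2)[OF that] refl]]
      ancestor_closedD(2)[OF that] code_W by blast
  have cl: "ancestor_closed C" "v0 \<in> C" using goodD[OF g] by blast+
  have db: "bij_betw decode (words.W - code ` C) (pverts G - C)"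
  proof (rule bij_betw_byWitness[where f'=code])
    show "\<forall>a\<in>words.W - code ` C. code (decode a) = a" "\<forall>a\<in>pverts G - C. decode (code a) = a" by simp_all
    show "code ` (pverts G - C) \<subseteq> words.W - code ` C" using cb[OF cl(1)] by (simp add: bij_betw_def)
    show "decode ` (words.W - code ` C) \<subseteq> pverts G - C"
    proof
      fix v assume "v \<in> decode ` (words.W - code ` C)"
      then obtain w where w: "w \<in> words.W" "w \<notin> code ` C" "v = decode w" by blast
      then have "code v = w" "v \<in> pverts G" using decode_vert by simp_all
      then show "v \<in> pverts G - C" using w(2) by blast
    qed
  qed
  have gb: "bij_betw g (pverts G - C) (pverts G - C')" using goodD(3)[OF g] C'(3) by (simp add: bij_betw_def)
  have "words.canonical_at (code \<circ> g \<circ> decode) w" if w: "w \<in> words.W - code ` C" for w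
  proof -
    define x where "x = decode w"
    have x: "x \<in> pverts G - C" "code x = w" using db w code_dec by (auto simp: bij_betw_def x_def)
    have cx: "canon g x" by (rule canonical_at[OF x(1)])
    have gx: "g x \<in> pverts G" "g x \<noteq> v0" "x \<noteq> v0" "label F (g x) = label F x" using cx by (auto simp: canon_def)
    have "(code \<circ> g \<circ> decode) (w @ [c]) = (code \<circ> g \<circ> decode) w @ [c]" if wc: "w @ [c] \<in> words.W" for c
    proof -
      obtain y where y: "y \<in> children x" "norm_col y = c" using child_ex x wc by blast
      have "code y = w @ [c]" using code_child[OF y(1)] x y by simp
      then have dy: "decode (w @ [c]) = y" using decode_code children_verts(1)[OF y(1)] by metis
      have "g y \<in> children (g x)" "norm_col (g y) = c" using cx y by (auto simp: canon_def)
      then show ?thesis using code_child dy by (simp add: x_def)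
    qed
    moreover have "words.lab (code (g x)) = words.lab w"
      using label_code[OF gx(1,2)] label_code[of x] x gx by simp
    ultimately show ?thesis unfolding words.canonical_at_def
      using gx x code_W code_Nil_iff[OF gx(1)] code_Nil_iff[of x] by (simp add: x_def)
  qed
  moreover have "bij_betw (code \<circ> g \<circ> decode) (words.W - code ` C) (words.W - code ` C')"
    using bij_betw_trans[OF db bij_betw_trans[OF gb cb[OF C'(1)]]] by (simp add: comp_assoc)
  ultimately show ?thesis unfolding words.canonical_between_def using prefix_closed cl C'(1,2) by blast
qed

definition gens :: "('v \<rightharpoonup> 'v) set set" where
  "gens = {cls (tree_map (words.swap u v)) | u v. words.short_swappable (u, v)}"

lemma finite_gens: "finite gens"
proof -
  have "gens = (\<lambda>(u, v). cls (tree_map (words.swap u v))) ` {p. words.short_swappable p}"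
    unfolding gens_def by auto
  then show ?thesis using words.finite_short_swappable by simp
qed

lemma swap_tree:
  assumes "words.swappable u v"
  shows "near (tree_map (words.swap u v))" "finite {w \<in> pverts G. \<not> canon (tree_map (words.swap u v)) w}"
proof -
  note h = canonical_between_tree[OF words.canonical_between_swap[OF assms]]
  show "near (tree_map (words.swap u v))" by (rule good_near[OF h(1)])
  show "finite {w \<in> pverts G. \<not> canon (tree_map (words.swap u v)) w}"
    by (rule finite_subset[OF _ goodD(9)[OF h(1)]]) (use h(2) in blast)
qed

lemma gens_V: "gens \<subseteq> V F f"
  unfolding V_mostly mostly_def gens_def words.short_swappable_def using swap_tree by fastforce

lemma comps_W: "\<forall>p\<in>set ps. words.short_swappable p \<Longrightarrow> w \<in> words.W \<Longrightarrow> words.comps ps w \<in> words.W"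
  by (induct ps) (auto simp: words.short_swappable_def intro: words.swap_W)

lemma almost_eqI:
  assumes "\<And>v. v \<in> pverts G \<Longrightarrow> g v = h v" shows "almost_eq g h"
proof -
  have "{v \<in> pverts G. g v \<noteq> h v} = {}" using assms by blast
  then show ?thesis unfolding almost_eq_def by (simp only: finite.emptyI)
qed

lemma comps_generate:
  assumes "\<forall>p\<in>set ps. words.short_swappable p"
  shows "near (tree_map (words.comps ps))" "cls (tree_map (words.comps ps)) \<in> generate AAut gens"
proof -
  have "near (tree_map (words.comps ps)) \<and> cls (tree_map (words.comps ps)) \<in> generate AAut gens"
    using assms
  proof (induct ps)
    case Nil
    have a: "almost_eq id (tree_map (words.comps []))" by (rule almost_eqI) (simp add: tree_map_def)
    then show ?case
      using near_almost_eq[OF near_id a] cls_almost_eq[OF a] generate.one[of AAut gens] unfolding one_AAut by metis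
  next
    case (Cons p ps)
    let ?s = "tree_map (words.swap (fst p) (snd p))" and ?h = "tree_map (words.comps ps)"
    have p: "words.short_swappable (fst p, snd p)" using Cons by simp
    then have s: "near ?s" "cls ?s \<in> gens" using swap_tree(1) by (auto simp: gens_def words.short_swappable_def)
    have h: "near ?h" "cls ?h \<in> generate AAut gens" using Cons by auto
    have "tree_map (words.comps (p # ps)) v = (?s \<circ> ?h) v" if "v \<in> pverts G" for v
      using code_dec[OF comps_W[of ps "code v"]] code_W[OF that] Cons(2) by (simp add: tree_map_def)
    then have a: "almost_eq (?s \<circ> ?h) (tree_map (words.comps (p # ps)))" by (metis almost_eqI)
    have "cls ?s \<otimes>\<^bsub>AAut\<^esub> cls ?h \<in> generate AAut gens"
      using generate.eng[OF generate.incl[OF s(2)] h(2)] .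
    then show ?case using near_almost_eq[OF near_comp[OF s(1) h(1)] a] cls_almost_eq[OF a] cls_mult[OF s(1) h(1)] by metis
  qed
  then show "near (tree_map (words.comps ps))" "cls (tree_map (words.comps ps)) \<in> generate AAut gens" by blast+
qed

lemma V_generate: "generate AAut gens = V F f"
proof
  interpret A: group AAut by (rule AAut_group)
  show "generate AAut gens \<subseteq> V F f" using A.generate_subgroup_incl[OF gens_V V_subgroup_AAut] .
  show "V F f \<subseteq> generate AAut gens"
  proof
    fix X assume "X \<in> V F f"
    then obtain g where g: "X = cls g" "near g" "finite {w \<in> pverts G. \<not> canon g w}"
      unfolding V_mostly mostly_def by blast
    then obtain C where C: "good g C" "{w \<in> pverts G. \<not> canon g w} \<inter> pverts G \<subseteq> C" using good_ex by blast
    have canonical_at: "canon g w" if "w \<in> pverts G - C" for w using C(2) that by blast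
    obtain C' where C': "ancestor_closed C'" "v0 \<in> C'" "g ` (pverts G - C) = pverts G - C'"
      using good_range[OF C(1)] .
    obtain ps where ps: "\<forall>p\<in>set ps. words.short_swappable p"
      "\<forall>w\<in>words.W - code ` C. (code \<circ> g \<circ> decode) w = words.comps ps w"
      using words.canonical_between_short_swaps[OF canon_cgood[OF C(1) C' canonical_at]] by blast
    have "tree_map (words.comps ps) v = g v" if v: "v \<in> pverts G - C" for v
    proof -
      have "code v \<in> words.W - code ` C"
        using v code_W code_inj goodD(10)[OF C(1)] by blast
      then have "words.comps ps (code v) = code (g v)" using ps(2) v by force
      then show ?thesis using goodD(7)[OF C(1)] v by (simp add: tree_map_def)
    qed
    then have "{v \<in> pverts G. tree_map (words.comps ps) v \<noteq> g v} \<subseteq> C" by blast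
    then have "almost_eq (tree_map (words.comps ps)) g" unfolding almost_eq_def using goodD(9)[OF C(1)] finite_subset by blast
    then show "X \<in> generate AAut gens" using cls_almost_eq comps_generate(2)[OF ps(1)] g(1) by simp
  qed
qed

end

section \<open>Local permutations and the group of U(F)-honest maps\<close>

context branching_tree
begin

text \<open>The axioms mention the root only as some vertex. Hence parents, children and induction
  are available with respect to every vertex, which is used for the target of a map and for
  extending a map beyond a subtree.\<close>

lemma reroot: "y \<in> pverts G \<Longrightarrow> branching_tree G y d col"
  using connected acyclic regular col_inverse col_legal d_ge_2 by unfold_locales blast+

text \<open>Since the colouring is legal, the image of a child is the neighbour of the image of its
  parent with the prescribed colour. The prescription \<open>S\<close> also receives the image of
  the vertex, because \<open>correction_ex\<close> chooses the local permutation only when it is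
  known where the vertex has gone.\<close>

lemma build:
  assumes y: "y \<in> pverts G"
    and S: "\<And>w w' c. w \<in> pverts G \<Longrightarrow> w' \<in> pverts G \<Longrightarrow> c \<le> d \<Longrightarrow> S w w' c \<le> d"
  shows "\<exists>h. h v0 = y \<and> (\<forall>w\<in>pverts G. h w \<in> pverts G) \<and>
    (\<forall>w\<in>pverts G. \<forall>x\<in>children w. h x \<in> nbrs (h w) \<and> col (h w, h x) = S w (h w) (col (w, x)))"
proof -
  define nbc where "nbc v c = (SOME x. x \<in> nbrs v \<and> col (v, x) = c)" for v c
  have nbc: "nbc v c \<in> nbrs v \<and> col (v, nbc v c) = c" if "v \<in> pverts G" "c \<le> d" for v c
    unfolding nbc_def by (rule someI_ex) (use col_ex[OF that(1), of c] that(2) in auto)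
  define up where "up = rec_nat (\<lambda>v. y) (\<lambda>n r v. nbc (r (parent v)) (S (parent v) (r (parent v)) (col (parent v, v))))"
  define h where "h v = up (depth v) v" for v
  have h0: "h v0 = y" by (simp add: h_def up_def)
  have hx: "h x = nbc (h w) (S w (h w) (col (w, x)))" if "x \<in> children w" for w x
    using depth_child[OF that] parent_child[OF that] by (simp add: h_def up_def)
  have hv: "h w \<in> pverts G" if "w \<in> pverts G" for w
    using that
  proof (induct w rule: tree_induct)
    case root then show ?case using h0 y by simp
  next
    case (step w)
    have p: "w \<in> children (parent w)" "parent w \<in> pverts G" using parent_props step by blast+
    have "col (parent w, w) \<le> d" using col_range parent_props(3)[OF step(1,2)] by force
    then have "S (parent w) (h (parent w)) (col (parent w, w)) \<le> d" using S p(2) step(3) by blast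
    then have "h w \<in> nbrs (h (parent w))" using nbc[OF step(3)] hx[OF p(1)] by simp
    then show ?case by (rule nb_verts(1))
  qed
  have "h x \<in> nbrs (h w) \<and> col (h w, h x) = S w (h w) (col (w, x))" if "w \<in> pverts G" "x \<in> children w" for w x
  proof -
    have "col (w, x) \<le> d" using col_range[of x w] that(2) by (simp add: children_altdef)
    then have "S w (h w) (col (w, x)) \<le> d" using S that(1) hv by blast
    then show ?thesis using nbc[OF hv[OF that(1)]] hx[OF that(2)] by simp
  qed
  then show ?thesis using h0 hv by blast
qed

text \<open>A covering of a tree by a tree is an isomorphism. With the target rooted at
  \<open>g v0\<close>, local injectivity forbids turning back, so parents go to parents; injectivity
  and surjectivity then follow by induction from the roots.\<close>

lemma local_injection_bij:
  assumes V: "\<And>w. w \<in> pverts G \<Longrightarrow> g w \<in> pverts G"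
    and im: "\<And>w. w \<in> pverts G \<Longrightarrow> g ` nbrs w = nbrs (g w)"
    and inj: "\<And>w. w \<in> pverts G \<Longrightarrow> inj_on g (nbrs w)"
  shows "bij_betw g (pverts G) (pverts G)"
proof -
  interpret R: branching_tree G "g v0" d col by (rule reroot[OF V[OF root_vert]])
  have ch: "g w \<in> R.children (g (parent w))" if "w \<in> pverts G" "w \<noteq> v0" for w
    using that
  proof (induct w rule: tree_induct)
    case root then show ?case by simp
  next
    case (step w)
    let ?y = "parent w"
    have y: "?y \<in> pverts G" "w \<in> nbrs ?y" "w \<in> children ?y" using parent_props step by blast+
    have gw: "g w \<in> nbrs (g ?y)" using im[OF y(1)] y(2) by blast
    show ?case
    proof (cases "?y = v0")
      case True
      then show ?thesis using gw R.nb_root by simp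
    next
      case False
      have py: "parent ?y \<in> nbrs ?y" using parent_props(2)[OF y(1) False] .
      have "w \<noteq> parent ?y" using y(3) parent_notin_children[OF y(1) False] by metis
      then have "g w \<noteq> g (parent ?y)" using inj_onD[OF inj[OF y(1)]] y(2) py by blast
      moreover have "R.parent (g ?y) = g (parent ?y)" by (rule R.parent_child[OF step(3)[OF False]])
      ultimately show ?thesis using gw R.nb_cases[of "g w" "g ?y"] by auto
    qed
  qed
  have "v = w" if "v \<in> pverts G" "w \<in> pverts G" "g v = g w" for v w
    using that
  proof (induct v arbitrary: w rule: tree_induct)
    case root
    then show ?case using ch[of w] R.root_not_child by metis
  next
    case (step v)
    have w0: "w \<noteq> v0" using ch[OF step(1,2)] step(5) R.root_not_child by metis
    have "g (parent v) = g (parent w)"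
      using R.parent_child[OF ch[OF step(1,2)]] R.parent_child[OF ch[OF step(4) w0]] step(5) by simp
    then have "parent v = parent w" using step(3) parent_props(1)[OF step(4) w0] by blast
    then show ?case
      using inj_onD[OF inj[OF parent_props(1)[OF step(1,2)]] step(5)] parent_props(3)[OF step(1,2)]
        parent_props(3)[OF step(4) w0] by simp
  qed
  then have "inj_on g (pverts G)" by (auto simp: inj_on_def)
  moreover have "z \<in> g ` pverts G" if "z \<in> pverts G" for z
    using that
  proof (induct z rule: R.tree_induct)
    case root then show ?case using root_vert by blast
  next
    case (step z)
    then obtain x where x: "x \<in> pverts G" "R.parent z = g x" by blast
    then have "z \<in> g ` nbrs x" using R.parent_props(3)[OF step(1,2)] im[OF x(1)] by simp
    then show ?case using nb_verts(1) by blast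
  qed
  ultimately show ?thesis using V by (auto simp: bij_betw_def)
qed

end

context typed_tree
begin

section \<open>Maps whose local permutations lie in F\<close>

definition local_in_F :: "('v \<Rightarrow> 'v) \<Rightarrow> 'v \<Rightarrow> bool" where
  "local_in_F g w \<longleftrightarrow> g w \<in> pverts G \<and> (\<exists>p\<in>F. \<forall>x\<in>nbrs w. g x \<in> nbrs (g w) \<and> col (g w, g x) = p (col (w, x)))"

lemma nb_col_le: "x \<in> nbrs w \<Longrightarrow> col (w, x) \<le> d"
  using col_range by force

lemma local_in_F_inj: "local_in_F g w \<Longrightarrow> inj_on g (nbrs w)"
proof (rule inj_onI)
  fix x y assume "local_in_F g w" and x: "x \<in> nbrs w" and y: "y \<in> nbrs w" and "g x = g y"
  then obtain p where "p \<in> F" "p (col (w, x)) = p (col (w, y))" unfolding local_in_F_def by metis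
  then have "col (w, x) = col (w, y)" using F_inj nb_col_le x y by blast
  then show "x = y" using col_inj x y by blast
qed

lemma local_in_F_image: assumes "local_in_F g w" "w \<in> pverts G" shows "g ` nbrs w = nbrs (g w)"
proof (rule card_subset_eq)
  show "finite (nbrs (g w))" by (rule finite_nb)
  show "g ` nbrs w \<subseteq> nbrs (g w)" using assms(1) by (auto simp: local_in_F_def)
  have "g w \<in> pverts G" using assms(1) by (simp add: local_in_F_def)
  then show "card (g ` nbrs w) = card (nbrs (g w))"
    using card_image[OF local_in_F_inj[OF assms(1)]] card_nb assms(2) by simp
qed

lemma local_in_F_cong: "local_in_F g w \<Longrightarrow> h w = g w \<Longrightarrow> (\<And>x. x \<in> nbrs w \<Longrightarrow> h x = g x) \<Longrightarrow> local_in_F h w"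
  unfolding local_in_F_def by simp

text \<open>The children of \<open>v\<close> already exhaust the children of \<open>g v\<close>, so
  injectivity leaves only the parent for the parent. The colour of the parent edge is moved by an
  element of \<open>F\<close>, which keeps its orbit.\<close>

lemma local_in_F_parent:
  assumes g: "local_in_F g v" "g ` children v = children (g v)" and v: "v \<in> pverts G" "v \<noteq> v0"
  shows "g v \<noteq> v0" "g (parent v) = parent (g v)" "label F (g v) = label F v"
proof -
  have pv: "parent v \<in> nbrs v" by (rule parent_props(2)[OF v])
  have gp: "g (parent v) \<in> nbrs (g v)" using g(1) pv unfolding local_in_F_def by blast
  show gv: "g v \<noteq> v0" by (rule not_root_below[OF v g(2)])
  have "g (parent v) \<notin> children (g v)"
  proof
    assume "g (parent v) \<in> children (g v)"
    then have "g (parent v) \<in> g ` children v" using g(2) by simp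
    then obtain y where y: "y \<in> children v" "g (parent v) = g y" by blast
    then have "parent v = y" using inj_onD[OF local_in_F_inj[OF g(1)]] pv child_nb by blast
    then show False using y(1) parent_notin_children[OF v] by blast
  qed
  then show *: "g (parent v) = parent (g v)" using gp nb_cases by blast
  obtain p where "p \<in> F" "col (g v, g (parent v)) = p (col (v, parent v))" using g(1) pv unfolding local_in_F_def by blast
  then show "label F (g v) = label F v" using orb_apply parent_col_le[OF v] * by (simp add: label_def)
qed

lemma prm_col:
  assumes "x \<in> nbrs v"
  shows "prm g v (col (v, x)) = col (g v, g x)"
proof -
  have "(v, x) \<in> out_arcs (with_proj G) v" using assms by (simp add: out_arcs_nb)
  moreover have "inj_on col (out_arcs (with_proj G) v)"
    using col_legal[OF nb_verts(2)[OF assms]] by (rule bij_betw_imp_inj_on)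
  ultimately have "inv_into (out_arcs (with_proj G) v) col (col (v, x)) = (v, x)" by (rule inv_into_f_f[rotated])
  then show ?thesis using col_range[OF assms] by (simp add: prm_def)
qed

lemma Aut_verts: "g \<in> Aut \<Longrightarrow> v \<in> pverts G \<Longrightarrow> g v \<in> pverts G"
  unfolding Aut_def Bij_def by (auto dest: bij_betwE)

lemma U_local_in_F:
  assumes "g \<in> U F" "v \<in> pverts G" shows "local_in_F g v"
proof -
  have g: "g \<in> Aut" "prm g v \<in> F" using assms by (auto simp: U_def)
  have "g x \<in> nbrs (g v)" if "x \<in> nbrs v" for x
    using g(1) that nb_verts[OF that] by (simp add: Aut_def nbrs_def)
  then show ?thesis unfolding local_in_F_def using g(2) prm_col Aut_verts[OF g(1) assms(2)] by metis
qed

text \<open>Bijectivity is obtained from the local conditions through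
  \<open>local_injection_bij\<close>. The restriction is taken because automorphisms are extensional
  functions.\<close>

lemma local_in_F_U:
  assumes g: "\<And>v. v \<in> pverts G \<Longrightarrow> local_in_F g v"
  shows "restrict g (pverts G) \<in> U F"
proof -
  let ?g = "restrict g (pverts G)"
  have r: "?g v = g v" if "v \<in> pverts G" for v using that by simp
  have l: "local_in_F ?g v" if v: "v \<in> pverts G" for v
    by (rule local_in_F_cong[OF g[OF v]]) (use r v nb_verts(1) in \<open>metis+\<close>)
  have b: "bij_betw g (pverts G) (pverts G)"
    by (rule local_injection_bij) (use g local_in_F_image local_in_F_inj in \<open>auto simp: local_in_F_def\<close>)
  then have B: "?g \<in> Bij (pverts G)" unfolding Bij_def by (simp cong: bij_betw_cong)
  have "(?g u, ?g v) \<in> parcs G \<longleftrightarrow> (u, v) \<in> parcs G" if u: "u \<in> pverts G" and v: "v \<in> pverts G" for u v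
  proof -
    have "g v \<in> nbrs (g u) \<longleftrightarrow> v \<in> nbrs u"
    proof
      assume "g v \<in> nbrs (g u)"
      then obtain x where x: "x \<in> nbrs u" "g v = g x" using local_in_F_image[OF g[OF u] u] by blast
      then have "v = x" using inj_onD[OF bij_betw_imp_inj_on[OF b] x(2) v nb_verts(1)[OF x(1)]] by simp
      then show "v \<in> nbrs u" using x by simp
    next
      assume "v \<in> nbrs u" then show "g v \<in> nbrs (g u)" using g[OF u] by (auto simp: local_in_F_def)
    qed
    then show ?thesis using r u v by (simp add: nbrs_def)
  qed
  then have A: "?g \<in> Aut" unfolding Aut_def using B by blast
  have "prm ?g v \<in> F" if v: "v \<in> pverts G" for v
  proof -
    obtain p where p: "p \<in> F" "\<And>x. x \<in> nbrs v \<Longrightarrow> col (?g v, ?g x) = p (col (v, x))"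
      using l[OF v] unfolding local_in_F_def by blast
    have "prm ?g v = p"
    proof (rule extensionalityI[where A="{0..d}"])
      show "prm ?g v \<in> extensional {0..d}" by (simp add: prm_def)
      show "p \<in> extensional {0..d}"
        using subgroup.subset[OF F_subgroup] p(1) by (auto simp: BijGroup_def Bij_def)
      fix c assume "c \<in> {0..d}"
      then obtain x where "x \<in> nbrs v" "col (v, x) = c" using col_ex[OF v] by blast
      then show "prm ?g v c = p c" using prm_col[of x v ?g] p(2) by metis
    qed
    then show ?thesis using p(1) by simp
  qed
  then show ?thesis unfolding U_def using A by blast
qed

text \<open>
  Outside the subtree below \<open>v\<close> the extension acts on the colours around every vertex in the same way
  as around \<open>v\<close>.
\<close>

lemma U_extension:
  assumes v: "v \<in> pverts G" and g: "\<And>w. w \<in> subtree v \<Longrightarrow> local_in_F g w"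
  shows "\<exists>k\<in>U F. \<forall>w\<in>subtree v. k w = g w"
proof -
  interpret R: branching_tree G v d col by (rule reroot[OF v])
  have "\<forall>w\<in>subtree v. \<exists>p\<in>F. \<forall>x\<in>nbrs w. col (g w, g x) = p (col (w, x))"
    using g unfolding local_in_F_def by blast
  then obtain p where p: "\<And>w. w \<in> subtree v \<Longrightarrow> p w \<in> F"
    "\<And>w x. w \<in> subtree v \<Longrightarrow> x \<in> nbrs w \<Longrightarrow> col (g w, g x) = p w (col (w, x))" by metis
  have vv: "v \<in> subtree v" by (rule subtree_self[OF v])
  have gn: "g x \<in> nbrs (g w)" "g w \<in> pverts G" if "w \<in> subtree v" "x \<in> nbrs w" for w x
    using g that unfolding local_in_F_def by blast+
  define \<sigma> where "\<sigma> w = (if w \<in> subtree v then p w else p v)" for w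
  have sF: "\<sigma> w \<in> F" for w using p(1) vv by (simp add: \<sigma>_def)
  have gv: "g v \<in> pverts G" using g[OF vv] by (simp add: local_in_F_def)
  have "\<exists>h. h v = g v \<and> (\<forall>w\<in>pverts G. h w \<in> pverts G) \<and>
    (\<forall>w\<in>pverts G. \<forall>x\<in>R.children w. h x \<in> nbrs (h w) \<and> col (h w, h x) = \<sigma> w (col (w, x)))"
    by (rule R.build[OF gv]) (rule F_range[OF sF])
  then obtain h where h: "h v = g v" "\<And>w. w \<in> pverts G \<Longrightarrow> h w \<in> pverts G"
    "\<And>w x. w \<in> pverts G \<Longrightarrow> x \<in> R.children w \<Longrightarrow> h x \<in> nbrs (h w) \<and> col (h w, h x) = \<sigma> w (col (w, x))"
    by blast
  \<comment> \<open>The permutations at the two ends of an edge must agree on its colour. Inside the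
    subtree this holds because \<open>g\<close> gives one colour to the image of the edge; on all
    other edges, including the one between \<open>v\<close> and the outside, both permutations are
    \<open>p v\<close>.\<close>
  have comm: "\<sigma> x (col (w, x)) = \<sigma> w (col (w, x))" if x: "x \<in> nbrs w" for w x
  proof -
    consider "w \<in> subtree v" "x \<in> subtree v" | "w \<notin> subtree v" "x \<notin> subtree v" | "x = v" "w \<notin> subtree v" | "w = v" "x \<notin> subtree v"
      using subtree_enter[OF v x] subtree_enter[OF v nb_sym[OF x]] by blast
    then show ?thesis
    proof cases
      case 1
      have "p x (col (x, w)) = col (g x, g w)" using p(2)[OF 1(2) nb_sym[OF x]] by simp
      also have "\<dots> = col (g w, g x)" using col_sym[OF gn(1)[OF 1(1) x]] .
      also have "\<dots> = p w (col (w, x))" using p(2)[OF 1(1) x] .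
      finally show ?thesis using 1 col_sym[OF x] by (simp add: \<sigma>_def)
    qed (simp_all add: \<sigma>_def vv)
  qed
  have "local_in_F h w" if w: "w \<in> pverts G" for w
  proof -
    have "h x \<in> nbrs (h w) \<and> col (h w, h x) = \<sigma> w (col (w, x))" if x: "x \<in> nbrs w" for x
    proof (cases "x \<in> R.children w")
      case True then show ?thesis using h(3) w by blast
    next
      case False
      then have "w \<noteq> v" "x = R.parent w" using x R.nb_cases[of x w] by auto
      then have wc: "w \<in> R.children x" using R.parent_props(4)[OF w] by simp
      have *: "h w \<in> nbrs (h x)" "col (h x, h w) = \<sigma> x (col (x, w))" using h(3)[OF nb_verts(1)[OF x] wc] by blast+
      have "col (h w, h x) = \<sigma> x (col (w, x))" using *(2) col_sym[OF *(1)] col_sym[OF x] by simp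
      then show ?thesis using nb_sym[OF *(1)] comm[OF x] by simp
    qed
    then show ?thesis unfolding local_in_F_def using sF h(2)[OF w] by blast
  qed
  then have U: "restrict h (pverts G) \<in> U F" by (rule local_in_F_U)
  \<comment> \<open>The map \<open>h\<close> was built from \<open>v\<close> outwards. The second
    conjunct records that below \<open>v\<close> the children in the old sense are children as seen
    from \<open>v\<close>, so that colours determine \<open>h\<close> there in the same way as
    \<open>g\<close>.\<close>
  have eq: "h w = g w \<and> (\<forall>x\<in>children w. x \<in> R.children w)" if "w \<in> subtree v" for w
    using that v
  proof (induct w rule: subtree_induct)
    case self
    have "children v \<subseteq> nbrs v" using child_nb by blast
    then show ?case using h(1) R.nb_root by blast
  next
    case (step u x)
    have uv: "u \<in> pverts G" by (rule children_verts(2)[OF step(2)])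
    have xv: "x \<in> pverts G" by (rule children_verts(1)[OF step(2)])
    have xu: "x \<in> R.children u" using step by blast
    have 1: "h x \<in> nbrs (g u)" "col (g u, h x) = \<sigma> u (col (u, x))" using h(3)[OF uv xu] step(3) by auto
    have "col (g u, g x) = \<sigma> u (col (u, x))" using p(2)[OF step(1) child_nb[OF step(2)]] step(1) by (simp add: \<sigma>_def)
    then have "h x = g x" using col_inj[OF 1(1) gn(1)[OF step(1) child_nb[OF step(2)]]] 1(2) by simp
    moreover have "z \<in> R.children x" if z: "z \<in> children x" for z
    proof -
      have "R.parent x = u" by (rule R.parent_child[OF xu])
      moreover have "parent x = u" "x \<noteq> v0" using step(2) by (auto simp: child_iff)
      ultimately have "z \<noteq> R.parent x" using z parent_notin_children[OF xv] by auto
      then show ?thesis using child_nb[OF z] R.nb_cases[of z x] by blast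
    qed
    ultimately show ?case by blast
  qed
  show ?thesis
  proof (rule bexI[OF _ U], rule ballI)
    fix w assume "w \<in> subtree v"
    then show "restrict h (pverts G) w = g w" using eq subtree_verts by simp
  qed
qed

section \<open>The group N_F in terms of local permutations\<close>

lemma local_in_F_subgroup: "subgroup (mostly local_in_F) AAut"
proof (rule mostly_subgroup)
  have "local_in_F id w" if "w \<in> pverts G" for w
    unfolding local_in_F_def using that nb_col_le by (intro conjI bexI[OF _ F_id]) auto
  then have "{w \<in> pverts G. \<not> local_in_F id w} = {}" by blast
  then show "finite {w \<in> pverts G. \<not> local_in_F id w}" by (simp only: finite.emptyI)
next
  fix g h w assume h: "local_in_F h w" and g: "local_in_F g (h w)"
  obtain p where p: "p \<in> F" "\<forall>x\<in>nbrs w. h x \<in> nbrs (h w) \<and> col (h w, h x) = p (col (w, x))"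
    using h unfolding local_in_F_def by blast
  obtain q where q: "q \<in> F" "\<forall>x\<in>nbrs (h w). g x \<in> nbrs (g (h w)) \<and> col (g (h w), g x) = q (col (h w, x))"
    using g unfolding local_in_F_def by blast
  obtain r where r: "r \<in> F" "\<forall>c\<le>d. r c = q (p c)" using F_comp[OF q(1) p(1)] by blast
  have "(g \<circ> h) x \<in> nbrs ((g \<circ> h) w) \<and> col ((g \<circ> h) w, (g \<circ> h) x) = r (col (w, x))" if "x \<in> nbrs w" for x
    using p(2) q(2) r(2) nb_col_le[OF that] that by simp
  then show "local_in_F (g \<circ> h) w" unfolding local_in_F_def using r(1) g by (auto simp: local_in_F_def)
next
  fix g g' assume g: "near g" "almost_eq (g' \<circ> g) id" "finite {w \<in> pverts G. \<not> local_in_F g w}"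
  obtain B where B: "finite B" "\<forall>y\<in>pverts G - B. \<exists>w\<in>pverts G - {w \<in> pverts G. \<not> local_in_F g w}.
    y = g w \<and> g' y = w \<and> w \<noteq> v0 \<and> y \<noteq> v0 \<and> nbrs y = g ` nbrs w \<and> children y = g ` children w \<and> (\<forall>x\<in>nbrs w. g' (g x) = x)"
    using near_inv_local[OF g] by blast
  have "local_in_F g' y" if y: "y \<in> pverts G - B" for y
  proof -
    obtain w where w: "w \<in> pverts G" "local_in_F g w" "y = g w" "g' y = w"
      "nbrs y = g ` nbrs w" "\<forall>x\<in>nbrs w. g' (g x) = x" using B(2) y by blast
    obtain p where p: "p \<in> F" "\<forall>x\<in>nbrs w. col (g w, g x) = p (col (w, x))" using w(2) unfolding local_in_F_def by blast
    obtain r where r: "r \<in> F" "\<forall>c\<le>d. r (p c) = c \<and> p (r c) = c" using F_inv[OF p(1)] by blast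
    have "g' x' \<in> nbrs (g' y) \<and> col (g' y, g' x') = r (col (y, x'))" if x': "x' \<in> nbrs y" for x'
    proof -
      obtain x where x: "x \<in> nbrs w" "x' = g x" using x' w(5) by blast
      have "col (y, x') = p (col (w, x))" using p(2) x w(3) by simp
      then show ?thesis using x w(4,6) r(2) nb_col_le[OF x(1)] by simp
    qed
    then show ?thesis unfolding local_in_F_def using w(1,4) r(1) by auto
  qed
  then show "finite {w \<in> pverts G. \<not> local_in_F g' w}"
    by (rule_tac finite_subset[OF _ B(1)]) blast
qed

text \<open>The local permutation is \<open>f\<close> of the parent colour at \<open>w\<close>
  followed by the inverse of \<open>f\<close> of the parent colour at \<open>g w\<close>. On edges
  to children this is the preservation of normalised colours; on the parent edge both colours are
  normalised to the reference colour of the common label.\<close>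

lemma canon_local_in_F: "mostly canon \<subseteq> mostly local_in_F"
proof
  fix X assume "X \<in> mostly canon"
  then obtain g where g: "X = cls g" "near g" "finite {w \<in> pverts G. \<not> canon g w}" by (auto simp: mostly_def)
  then obtain C where C: "good g C" "{w \<in> pverts G. \<not> canon g w} \<inter> pverts G \<subseteq> C" using good_ex by blast
  let ?E = "C \<union> (\<Union>v\<in>C. children v)"
  have "local_in_F g w" if w: "w \<in> pverts G" "w \<notin> ?E" for w
  proof -
    have cn: "canon g w" using C(2) w by blast
    have w0: "w \<noteq> v0" using cn by (simp add: canon_def)
    have gw: "g w \<in> pverts G" "g w \<noteq> v0" "label F (g w) = label F w" using cn by (auto simp: canon_def)
    have pC: "parent w \<notin> C" "w \<notin> C" using w parent_props(4)[OF w(1) w0] by blast+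
    have pg: "parent (g w) = g (parent w)" by (rule good_parent(2)[OF C(1) w(1) w0 pC])
    have im: "g ` nbrs w = nbrs (g w)" by (rule good_parent(3)[OF C(1) w(1) w0 pC])
    let ?c = "col (w, parent w)" and ?c' = "col (g w, parent (g w))"
    have f: "f ?c \<in> F" "f ?c' \<in> F" using f_props(1) parent_col_le w(1) w0 gw(1,2) by blast+
    obtain r where r: "r \<in> F" "\<forall>c\<le>d. r (f ?c' c) = c \<and> f ?c' (r c) = c" using F_inv[OF f(2)] by blast
    obtain p where p: "p \<in> F" "\<forall>c\<le>d. p c = r (f ?c c)" using F_comp[OF r(1) f(1)] by blast
    have "g x \<in> nbrs (g w) \<and> col (g w, g x) = p (col (w, x))" if x: "x \<in> nbrs w" for x
    proof -
      have gx: "g x \<in> nbrs (g w)" using im x by blast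
      have "f ?c' (col (g w, g x)) = f ?c (col (w, x))"
      proof (cases "x \<in> children w")
        case True
        then have "g x \<in> children (g w)" "norm_col (g x) = norm_col x" using cn by (auto simp: canon_def)
        then show ?thesis using norm_col_below[OF w0 True] norm_col_below[OF gw(2)] by simp
      next
        case False
        then have "x = parent w" using x nb_cases by blast
        then show ?thesis using ref_label[OF w(1) w0] ref_label[OF gw(1,2)] gw(3) pg by simp
      qed
      then show ?thesis using gx r(2) p(2) nb_col_le[OF gx] nb_col_le[OF x] by metis
    qed
    then show ?thesis unfolding local_in_F_def using gw(1) p(1) by blast
  qed
  then have "{w \<in> pverts G. \<not> local_in_F g w} \<subseteq> ?E" by blast
  moreover have "finite ?E" using goodD(9)[OF C(1)] finite_children by blast
  ultimately have "finite {w \<in> pverts G. \<not> local_in_F g w}" by (rule finite_subset)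
  then show "X \<in> mostly local_in_F" using g by (auto simp: mostly_def)
qed

text \<open>In one direction the restriction of a map to the subtree below each leaf is extended to
  an element of \<open>U F\<close> by \<open>U_extension\<close>. In the other, the local
  permutations are those of elements of \<open>U F\<close> at all vertices outside a complete
  subtree.\<close>

lemma N_carrier: "{X \<in> carrier AAut. \<exists>\<phi>\<in>X. U_honest F \<phi>} = mostly local_in_F"
proof
  show "mostly local_in_F \<subseteq> {X \<in> carrier AAut. \<exists>\<phi>\<in>X. U_honest F \<phi>}"
  proof
    fix X assume "X \<in> mostly local_in_F"
    then obtain g where g: "X = cls g" "near g" "finite {w \<in> pverts G. \<not> local_in_F g w}" by (auto simp: mostly_def)
    then obtain C where C: "good g C" "{w \<in> pverts G. \<not> local_in_F g w} \<inter> pverts G \<subseteq> C" using good_ex by blast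
    obtain C' where C': "ancestor_closed C'" "v0 \<in> C'" "g ` (pverts G - C) = pverts G - C'"
      using good_range[OF C(1)] .
    have cl: "ancestor_closed C" by (rule goodD(1)[OF C(1)])
    have "\<exists>k\<in>U F. \<forall>w\<in>subtree v. forest_map C g w = Some (k w)" if "v \<in> leaves (span_tree C)" for v
    proof -
      have v: "v \<in> pverts G" "v \<notin> C"
        using that span_tree_complete[OF cl] unfolding leaves_span_tree[OF cl] by (auto simp: complete_subtree_def)
      have sub: "w \<in> pverts G - C" if "w \<in> subtree v" for w
        using that subtree_verts ancestor_closed_subtree[OF cl v(1) that] v(2) by blast
      have "local_in_F g w" if "w \<in> subtree v" for w using sub[OF that] C(2) by blast
      then obtain k where "k \<in> U F" "\<forall>w\<in>subtree v. k w = g w" using U_extension[OF v(1)] by blast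
      then show ?thesis using sub by (intro bexI[of _ k]) (simp_all add: forest_map_def)
    qed
    then have "U_honest F (forest_map C g)"
      unfolding U_honest_def using good_honest[OF C(1) C'(1,3)] by blast
    then show "X \<in> {X \<in> carrier AAut. \<exists>\<phi>\<in>X. U_honest F \<phi>}"
      unfolding carrier_AAut using g good_restr_cls[OF C(1)] by blast
  qed
  show "{X \<in> carrier AAut. \<exists>\<phi>\<in>X. U_honest F \<phi>} \<subseteq> mostly local_in_F"
  proof clarify
    fix X \<phi> assume X: "X \<in> carrier AAut" "\<phi> \<in> X" "U_honest F \<phi>"
    obtain T1 T2 where h: "honest T1 T2 \<phi>"
      and k: "\<forall>v\<in>leaves T1. \<exists>g\<in>U F. \<forall>w\<in>subtree v. \<phi> w = Some (g w)"
      using X(3) unfolding U_honest_def by blast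
    have T1: "complete_subtree T1" using h by (simp add: honest_def)
    obtain C where C: "ancestor_closed C" "T1 = span_tree C" using complete_span_tree_ex[OF T1] by blast
    define g where "g = the \<circ> \<phi>"
    have is_honest: "is_honest \<phi>" using h by (auto simp: is_honest_def)
    have ng: "near g" "\<phi> \<in> cls g" using honest_near[OF is_honest] is_honest by (simp_all add: g_def cls_def)
    have "local_in_F g w" if w: "w \<in> pverts G" "w \<notin> T1" for w
    proof -
      have "w \<notin> C" using w(2) C(2) by (auto simp: span_tree_def split: if_splits)
      then have "w \<in> forest_verts T1" using forest_verts_span_tree[OF C(1)] C(2) w(1) by simp
      then obtain l where l: "l \<in> leaves T1" "w \<in> subtree l" by (auto simp: forest_verts_def)
      have lv: "l \<in> T1" "l \<in> pverts G" using l(1) T1 by (auto simp: leaves_def complete_subtree_def)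
      obtain k where k: "k \<in> U F" "\<forall>w\<in>subtree l. \<phi> w = Some (k w)" using k l(1) by blast
      \<comment> \<open>Only the leaf \<open>l\<close> has a neighbour outside its own subtree, and
        \<open>l\<close> belongs to \<open>T1\<close>.\<close>
      have sub: "x \<in> subtree l" if "x \<in> nbrs w" for x
      proof (rule ccontr)
        assume "x \<notin> subtree l"
        then have "w = l" using subtree_enter[OF lv(2) nb_sym[OF that] l(2)] by blast
        then show False using w(2) lv(1) by simp
      qed
      show ?thesis
        by (rule local_in_F_cong[OF U_local_in_F[OF k(1) w(1)]]) (use k(2) l(2) sub in \<open>auto simp: g_def\<close>)
    qed
    then have "{w \<in> pverts G. \<not> local_in_F g w} \<subseteq> T1" by blast
    then have "finite {w \<in> pverts G. \<not> local_in_F g w}" using T1 finite_subset by (auto simp: complete_subtree_def)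
    moreover have "X = cls g"
    proof -
      obtain h where "X = cls h" using X(1) unfolding carrier_AAut by blast
      then show ?thesis using class_cls X(2) ng(2) by metis
    qed
    ultimately show "X \<in> mostly local_in_F" using ng(1) by (auto simp: mostly_def)
  qed
qed

lemma N_eq: "N F = AAut\<lparr>carrier := mostly local_in_F\<rparr>"
  by (simp only: N_def N_carrier)

lemma N_group: "group (N F)"
  unfolding N_eq using subgroup.subgroup_is_group[OF local_in_F_subgroup AAut_group] .

lemma V_finitely_generated: "finitely_generated_subgroup (V F f) (N F)"
proof -
  have VN: "V F f \<subseteq> mostly local_in_F" using canon_local_in_F V_mostly by simp
  have "subgroup (V F f) (N F)"
    unfolding N_eq by (rule group.subgroup_incl[OF AAut_group V_subgroup_AAut local_in_F_subgroup VN])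
  moreover have "generate (N F) gens = V F f"
    unfolding N_eq using group.generate_consistent[OF AAut_group _ local_in_F_subgroup, of gens] gens_V VN V_generate by simp
  ultimately show ?thesis unfolding finitely_generated_subgroup_def using finite_gens gens_V by blast
qed

end

section \<open>Density\<close>

context typed_tree
begin

text \<open>
  Given \<open>g\<close>, an element \<open>h\<close> of \<open>U F\<close> that is the identity on a large finite tree is constructed
  from the root downwards: outside the tree its local permutations are chosen so as to make
  \<open>g \<circ> h\<close> preserve the normalised colours.
\<close>

lemma correction_ex:
  assumes g: "near g" "finite {w \<in> pverts G. \<not> local_in_F g w}" and A: "finite A"
  shows "\<exists>h\<in>U F. (\<forall>v\<in>A \<inter> pverts G. h v = v) \<and> near (g \<circ> h) \<and> finite {w \<in> pverts G. \<not> canon (g \<circ> h) w}"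
proof -
  have "finite (A \<union> {w \<in> pverts G. \<not> local_in_F g w})" using g A by simp
  then obtain C where C: "good g C" "(A \<union> {w \<in> pverts G. \<not> local_in_F g w}) \<inter> pverts G \<subseteq> C"
    using good_ex[OF g(1)] by blast
  have cl: "ancestor_closed C" "v0 \<in> C" using goodD[OF C(1)] by blast+
  have lg: "local_in_F g w" if "w \<in> pverts G" "w \<notin> C" for w using that C(2) by blast
  have gp: "g w \<in> pverts G" "g w \<noteq> v0" "g (parent w) = parent (g w)" "label F (g w) = label F w"
    if w: "w \<in> pverts G" "w \<notin> C" for w
    using local_in_F_parent[OF lg[OF w] goodD(6)[OF C(1) w] w(1) goodD(11)[OF C(1) w]] goodD(7)[OF C(1) w] by blast+
  define \<chi> where "\<chi> w = col (w, parent w)" for w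
  \<comment> \<open>The local permutation wanted for \<open>h\<close> at \<open>w\<close> when
    \<open>w\<close> has gone to \<open>w'\<close>: trivial on the finite tree, and outside it such
    that applying \<open>g\<close> afterwards gives every edge at \<open>w\<close> the normalised
    colour it had. The second clause is imposed on all neighbours, including the parent.\<close>
  define Q where "Q w w' r \<longleftrightarrow> (w \<in> C \<longrightarrow> (\<forall>c\<le>d. r c = c)) \<and>
    (w \<notin> C \<and> w' \<notin> C \<longrightarrow> (\<forall>x\<in>nbrs w'. \<forall>c\<le>d. col (w', x) = r c \<longrightarrow> f (\<chi> (g w')) (col (g w', g x)) = f (\<chi> w) c))"
    for w w' r
  have "\<exists>r. r \<in> F \<and> Q w w' r" if w: "w \<in> pverts G" and w': "w' \<in> pverts G" for w w'
  proof (cases "w \<notin> C \<and> w' \<notin> C")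
    case False
    then show ?thesis unfolding Q_def by (intro exI[of _ "\<lambda>c\<in>{0..d}. c"] conjI F_id) auto
  next
    case True
    obtain p where p: "p \<in> F" "\<forall>x\<in>nbrs w'. col (g w', g x) = p (col (w', x))"
      using lg[OF w'] True unfolding local_in_F_def by blast
    have fw: "f (\<chi> w) \<in> F" "f (\<chi> (g w')) \<in> F"
      unfolding \<chi>_def using f_props(1) parent_col_le w w' True gp(1,2)[OF w'] cl(2) by blast+
    obtain q where q: "q \<in> F" "\<forall>c\<le>d. q c = f (\<chi> (g w')) (p c)" using F_comp[OF fw(2) p(1)] by blast
    obtain q' where q': "q' \<in> F" "\<forall>c\<le>d. q' (q c) = c \<and> q (q' c) = c" using F_inv[OF q(1)] by blast
    \<comment> \<open>Here \<open>q\<close> is the local permutation of \<open>g\<close> at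
      \<open>w'\<close> followed by normalisation at \<open>g w'\<close>; solving the requirement
      for \<open>r\<close> gives normalisation at \<open>w\<close> followed by the inverse of
      \<open>q\<close>.\<close>
    obtain r where r: "r \<in> F" "\<forall>c\<le>d. r c = q' (f (\<chi> w) c)" using F_comp[OF q'(1) fw(1)] by blast
    have "f (\<chi> (g w')) (col (g w', g x)) = f (\<chi> w) c" if x: "x \<in> nbrs w'" "c \<le> d" "col (w', x) = r c" for x c
    proof -
      have "f (\<chi> (g w')) (col (g w', g x)) = q (col (w', x))" using p(2) q(2) x(1) nb_col_le[OF x(1)] by simp
      also have "\<dots> = f (\<chi> w) c" using r(2) q'(2) x(2,3) F_range[OF fw(1) x(2)] by simp
      finally show ?thesis .
    qed
    then have "Q w w' r" unfolding Q_def using True by blast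
    then show ?thesis using r(1) by blast
  qed
  then obtain S where S: "\<And>w w'. w \<in> pverts G \<Longrightarrow> w' \<in> pverts G \<Longrightarrow> S w w' \<in> F \<and> Q w w' (S w w')"
    by metis
  have "\<exists>h. h v0 = v0 \<and> (\<forall>w\<in>pverts G. h w \<in> pverts G) \<and>
    (\<forall>w\<in>pverts G. \<forall>x\<in>children w. h x \<in> nbrs (h w) \<and> col (h w, h x) = S w (h w) (col (w, x)))"
    by (rule build[OF root_vert]) (use S F_range in blast)
  then obtain h where h: "h v0 = v0" "\<And>w. w \<in> pverts G \<Longrightarrow> h w \<in> pverts G"
    "\<And>w x. x \<in> children w \<Longrightarrow> h x \<in> nbrs (h w) \<and> col (h w, h x) = S w (h w) (col (w, x))"
    using children_verts(2) by blast
  have SF: "S w (h w) \<in> F" and SQ: "Q w (h w) (S w (h w))" if "w \<in> pverts G" for w using S that h(2) by blast+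
  \<comment> \<open>The construction prescribes colours along edges to children only. That the edge
    back to the parent also follows the permutation chosen at \<open>w\<close> has to be proved;
    this makes \<open>h\<close> an element of \<open>U F\<close>, and it is needed at once to show
    that the next children are not folded back onto the parent.\<close>
  have main: "(w \<in> C \<longrightarrow> h w = w) \<and> (w \<notin> C \<longrightarrow> h w \<notin> C) \<and>
    (w \<noteq> v0 \<longrightarrow> h w \<in> children (h (parent w)) \<and> label F (h w) = label F w \<and>
      col (h w, h (parent w)) = S w (h w) (col (w, parent w)))" if "w \<in> pverts G" for w
    using that
  proof (induct w rule: tree_induct)
    case root then show ?case using h(1) cl(2) by simp
  next
    case (step x)
    define w where "w = parent x"
    have x: "x \<in> children w" and w: "w \<in> pverts G" using parent_props step(1,2) unfolding w_def by blast+
    note IH = step(3)[folded w_def]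
    have hx: "h x \<in> nbrs (h w)" "col (h w, h x) = S w (h w) (col (w, x))" using h(3)[OF x] by blast+
    have hv: "h x \<in> pverts G" "h w \<in> pverts G" using h(2) step(1) w by blast+
    have hc: "h x \<in> children (h w)"
    proof (rule ccontr)
      assume n: "h x \<notin> children (h w)"
      then have *: "h w \<noteq> v0" "h x = parent (h w)" using hx(1) nb_cases by blast+
      then have w0: "w \<noteq> v0" using h(1) by auto
      then have "h (parent w) = parent (h w)" using IH parent_child by metis
      then have "S w (h w) (col (w, x)) = S w (h w) (col (w, parent w))" using IH w0 hx(2) *(2) by simp
      then have "col (w, x) = col (w, parent w)"
        using F_inj[OF SF[OF w]] child_col_le[OF x] parent_col_le[OF w w0] by blast
      then have "x = parent w" using col_inj[OF child_nb[OF x] parent_props(2)[OF w w0]] by blast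
      then show False using x parent_notin_children[OF w w0] by blast
    qed
    have hp: "parent (h x) = h w" "h x \<noteq> v0" using hc by (auto simp: child_iff)
    have lab: "label F (h x) = label F x"
    proof -
      have "label F (h x) = orb (S w (h w) (col (w, x)))"
        using col_parent[OF hc] hx(2) by (simp add: label_def)
      also have "\<dots> = orb (col (w, x))" using orb_apply[OF SF[OF w] child_col_le[OF x]] .
      also have "\<dots> = label F x" using col_parent[OF x] by (simp add: label_def)
      finally show ?thesis .
    qed
    have same: "h x = x" if "w \<in> C"
    proof -
      have hw: "h w = w" using IH that by blast
      have "S w (h w) (col (w, x)) = col (w, x)" using SQ[OF w] that child_col_le[OF x] unfolding Q_def by blast
      then show ?thesis using col_inj[of "h x" w x] hx hw child_nb[OF x] by simp
    qed
    have inC: "x \<in> C \<Longrightarrow> w \<in> C" using ancestor_closedD(4)[OF cl(1) x] by blast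
    have outC: "h x \<notin> C" if "x \<notin> C"
    proof (cases "w \<in> C")
      case True then show ?thesis using same that by simp
    next
      case False
      then have "h w \<notin> C" using IH by blast
      then show ?thesis using ancestor_closedD(4)[OF cl(1) hc] by blast
    qed
    have "col (h x, h w) = S x (h x) (col (x, w))"
    proof (cases "x \<in> C")
      case True
      then have "S x (h x) (col (x, w)) = col (x, w)"
        using SQ[OF step(1)] nb_col_le[OF nb_sym[OF child_nb[OF x]]] unfolding Q_def by blast
      moreover have "h x = x" "h w = w" using same inC True IH by blast+
      ultimately show ?thesis by simp
    next
      case False
      note hxC = outC[OF False]
      let ?c = "col (x, w)"
      have c: "?c \<le> d" using nb_col_le[OF nb_sym[OF child_nb[OF x]]] .
      have "S x (h x) ?c \<le> d" using F_range[OF SF[OF step(1)] c] .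
      \<comment> \<open>The permutation chosen at \<open>x\<close> sends the parent edge to the edge
        from \<open>h x\<close> to \<open>z\<close>. After \<open>g\<close>, the latter has the
        reference colour of the label of \<open>x\<close> as normalised colour, and so has the
        parent edge of \<open>g (h x)\<close>. Therefore \<open>z\<close> is the parent of
        \<open>h x\<close>.\<close>
      then obtain z where z: "z \<in> nbrs (h x)" "col (h x, z) = S x (h x) ?c" using col_ex[OF hv(1)] by auto
      have ghx: "g (h x) \<in> pverts G" "g (h x) \<noteq> v0" "g (parent (h x)) = parent (g (h x))"
        "label F (g (h x)) = label F (h x)" using gp[OF hv(1) hxC] by blast+
      have \<chi>x: "\<chi> x = ?c" by (simp add: \<chi>_def w_def)
      have "f (\<chi> (g (h x))) (col (g (h x), g z)) = f (\<chi> x) ?c"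
        using SQ[OF step(1)] False hxC z c unfolding Q_def by blast
      also have "\<dots> = ref (label F x)" using ref_label[OF step(1,2)] \<chi>x by (simp add: w_def)
      also have "\<dots> = f (\<chi> (g (h x))) (\<chi> (g (h x)))"
        using ref_label[OF ghx(1,2)] ghx(4) lab by (simp add: \<chi>_def)
      finally have e: "f (\<chi> (g (h x))) (col (g (h x), g z)) = f (\<chi> (g (h x))) (\<chi> (g (h x)))" .
      have gz: "g z \<in> nbrs (g (h x))" using lg[OF hv(1) hxC] z(1) unfolding local_in_F_def by blast
      have gx: "\<chi> (g (h x)) \<le> d" unfolding \<chi>_def using parent_col_le[OF ghx(1,2)] .
      have "col (g (h x), g z) = col (g (h x), parent (g (h x)))"
        using F_inj[OF f_props(1)[OF gx] nb_col_le[OF gz] gx e] by (simp add: \<chi>_def)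
      then have "g z = parent (g (h x))" using col_inj[OF gz parent_props(2)[OF ghx(1,2)]] by blast
      then have "g z = g (parent (h x))" using ghx(3) by simp
      then have "z = parent (h x)"
        using inj_onD[OF local_in_F_inj[OF lg[OF hv(1) hxC]]] z(1) parent_props(2)[OF hv(1) hp(2)] by blast
      then show ?thesis using z(2) hp(1) by simp
    qed
    then show ?case using same inC outC hc lab unfolding w_def by blast
  qed
  have lh: "local_in_F h w" if w: "w \<in> pverts G" for w
  proof -
    have "h x \<in> nbrs (h w) \<and> col (h w, h x) = S w (h w) (col (w, x))" if x: "x \<in> nbrs w" for x
    proof (cases "x \<in> children w")
      case True then show ?thesis using h(3) by blast
    next
      case False
      then have *: "w \<noteq> v0" "x = parent w" using x nb_cases by blast+
      then have "h w \<in> children (h x)" using main[OF w] by blast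
      then show ?thesis using main[OF w] * nb_sym[OF child_nb] by blast
    qed
    then show ?thesis unfolding local_in_F_def using SF[OF w] h(2)[OF w] by blast
  qed
  let ?h = "restrict h (pverts G)"
  have U: "?h \<in> U F" by (rule local_in_F_U[OF lh])
  then have nh: "near ?h" using Aut_near by (simp add: U_def)
  have cn: "canon (g \<circ> ?h) w" if w: "w \<in> pverts G" "w \<notin> C" for w
  proof -
    have w0: "w \<noteq> v0" using w cl by blast
    have hw: "h w \<in> pverts G" "h w \<notin> C" using h(2) main w by blast+
    have lab: "label F (h w) = label F w" using main[OF w(1)] w0 by blast
    have "g (h x) \<in> children (g (h w)) \<and> norm_col (g (h x)) = norm_col x" if x: "x \<in> children w" for x
    proof -
      have xv: "x \<in> pverts G" "x \<noteq> v0" "parent x = w" using x by (auto simp: child_iff)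
      have hc: "h x \<in> children (h w)" using main[OF xv(1)] xv(2,3) by blast
      then have gc: "g (h x) \<in> children (g (h w))" using goodD(6)[OF C(1) hw] by blast
      have "norm_col (g (h x)) = f (\<chi> (g (h w))) (col (g (h w), g (h x)))"
        using norm_col_below[OF gp(2)[OF hw] gc] by (simp add: \<chi>_def)
      also have "\<dots> = f (\<chi> w) (col (w, x))"
        using SQ[OF w(1)] w(2) hw(2) h(3)[OF x] child_col_le[OF x] unfolding Q_def by blast
      also have "\<dots> = norm_col x" using norm_col_below[OF w0 x] by (simp add: \<chi>_def)
      finally show ?thesis using gc by blast
    qed
    moreover have "?h x = h x" if "x \<in> children w" for x using children_verts(1)[OF that] by simp
    ultimately show ?thesis unfolding canon_def
      using w w0 gp[OF hw] lab by simp
  qed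
  have "finite {w \<in> pverts G. \<not> canon (g \<circ> ?h) w}"
    by (rule finite_subset[OF _ goodD(9)[OF C(1)]]) (use cn in blast)
  moreover have "?h v = v" if "v \<in> A \<inter> pverts G" for v
    using that C(2) main by (simp add: subset_iff)
  ultimately show ?thesis using U near_comp[OF g(1) nh] by blast
qed

section \<open>Neighbourhoods of the identity and density\<close>

lemma Aut_compose:
  assumes "g \<in> Aut" "h \<in> Aut" shows "compose (pverts G) g h \<in> Aut"
  unfolding Aut_def
proof (intro CollectI conjI ballI)
  show "compose (pverts G) g h \<in> Bij (pverts G)" using assms by (simp add: Aut_def compose_Bij)
  show "(compose (pverts G) g h u, compose (pverts G) g h v) \<in> parcs G \<longleftrightarrow> (u, v) \<in> parcs G"
    if "u \<in> pverts G" "v \<in> pverts G" for u v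
    using that assms Aut_verts[OF assms(2)] by (simp add: compose_def Aut_def)
qed

lemma identity_nhd:
  assumes "openin Aut_topology S" "(\<lambda>v\<in>pverts G. v) \<in> S"
  shows "\<exists>A. finite A \<and> A \<subseteq> pverts G \<and> fixator A {} \<subseteq> S"
proof -
  let ?B = "{(\<lambda>k. compose (pverts G) g k) ` fixator A B | g A B.
    g \<in> Aut \<and> finite A \<and> A \<subseteq> pverts G \<and> finite B \<and> B \<subseteq> parcs G}"
  have "generate_topology_on ?B S"
    using assms(1) unfolding Aut_topology_def by (simp add: openin_topology_generated_by_iff)
  then show ?thesis using assms(2)
  proof (induct rule: generate_topology_on.induct)
    case Empty then show ?case by simp
  next
    case (Int a b)
    then obtain A B where "finite A" "A \<subseteq> pverts G" "fixator A {} \<subseteq> a"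
      "finite B" "B \<subseteq> pverts G" "fixator B {} \<subseteq> b" by blast
    moreover have "fixator (A \<union> B) {} \<subseteq> fixator A {} \<inter> fixator B {}" by (auto simp: fixator_def)
    ultimately show ?case by (intro exI[of _ "A \<union> B"]) auto
  next
    case (UN K)
    then obtain k where k: "k \<in> K" "(\<lambda>v\<in>pverts G. v) \<in> k" by blast
    then obtain A where "finite A" "A \<subseteq> pverts G" "fixator A {} \<subseteq> k" using UN(2) by blast
    then show ?case using k(1) by blast
  next
    case (Basis s)
    then obtain g A B where s: "s = (\<lambda>k. compose (pverts G) g k) ` fixator A B" "g \<in> Aut" "finite A"
      "A \<subseteq> pverts G" "finite B" "B \<subseteq> parcs G" by blast
    then obtain k where k: "k \<in> fixator A B" "(\<lambda>v\<in>pverts G. v) = compose (pverts G) g k" using Basis(2) by blast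
    \<comment> \<open>An edge is fixed as soon as both its ends are, so fixators of vertices
      suffice.\<close>
    let ?A = "A \<union> fst ` B \<union> snd ` B"
    have V: "?A \<subseteq> pverts G" using s(4,6) arc_fst_in_verts arc_snd_in_verts by blast
    have kA: "k \<in> Aut" using k(1) by (simp add: fixator_def)
    have "fixator ?A {} \<subseteq> s"
    proof
      fix h assume "h \<in> fixator ?A {}"
      then have h: "h \<in> Aut" "\<And>v. v \<in> ?A \<Longrightarrow> h v = v" by (auto simp: fixator_def)
      have hx: "h \<in> extensional (pverts G)" using h(1) by (simp add: Aut_def Bij_def)
      \<comment> \<open>The translate contains the identity, which means that \<open>g\<close> after
        \<open>k\<close> is the identity. Hence \<open>h\<close> is \<open>g\<close> after
        \<open>k\<close> after \<open>h\<close>, and \<open>k\<close> after \<open>h\<close> still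
        fixes \<open>A\<close> and \<open>B\<close>.\<close>
      let ?k = "compose (pverts G) k h"
      have "h = compose (pverts G) g ?k"
      proof (rule extensionalityI[OF hx compose_extensional])
        fix v assume v: "v \<in> pverts G"
        then have "g (k (h v)) = h v"
          using fun_cong[OF k(2), of "h v"] Aut_verts[OF h(1) v] by (simp add: compose_def)
        then show "h v = compose (pverts G) g ?k v" using v by (simp add: compose_def)
      qed
      moreover have "?k \<in> fixator A B" unfolding fixator_def
      proof (intro CollectI conjI ballI)
        show "?k \<in> Aut" by (rule Aut_compose[OF kA h(1)])
        show "?k v = v" if "v \<in> A" for v
          using that k(1) h(2)[of v] s(4) by (auto simp: fixator_def compose_def)
        fix e assume e: "e \<in> B"
        then have "map_prod k k e = e" "h (fst e) = fst e" "h (snd e) = snd e" "fst e \<in> pverts G" "snd e \<in> pverts G"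
          using k(1) h(2)[of "fst e"] h(2)[of "snd e"] V by (auto simp: fixator_def)
        then show "map_prod ?k ?k e = e" by (cases e) (simp add: compose_def)
      qed
      ultimately show "h \<in> s" unfolding s(1) by blast
    qed
    then show ?case using V s(3,5) by (intro exI[of _ ?A]) simp
  qed
qed

lemma identity_U: "(\<lambda>v\<in>pverts G. v) \<in> U F"
  by (rule local_in_F_U) (use nb_col_le F_id in \<open>auto simp: local_in_F_def intro!: bexI[OF _ F_id]\<close>)

lemma identity_topspace: "(\<lambda>v\<in>pverts G. v) \<in> topspace (U_topology F)"
proof -
  let ?i = "\<lambda>v\<in>pverts G. v"
  have "?i = compose (pverts G) ?i ?i" by (auto simp: compose_def fun_eq_iff)
  moreover have "?i \<in> fixator {} {}" using id_Aut by (simp add: fixator_def)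
  ultimately have "?i \<in> (\<lambda>k. compose (pverts G) ?i k) ` fixator {} {}" by blast
  then have "?i \<in> topspace Aut_topology"
    unfolding Aut_topology_def topology_generated_by_topspace using id_Aut by blast
  then show ?thesis using identity_U by (simp add: U_topology_def)
qed

lemma V_dense:
  assumes "is_N_topology F \<tau>"
  shows "\<tau> closure_of (V F f) = carrier (N F)"
proof -
  have top: "topspace \<tau> = carrier (N F)"
    and mult: "continuous_map (prod_topology \<tau> \<tau>) \<tau> (\<lambda>(x, y). x \<otimes>\<^bsub>N F\<^esub> y)"
    and emb: "continuous_map (U_topology F) \<tau> embed"
    using assms by (auto simp: is_N_topology_def group_topology_def)
  have carrier: "carrier (N F) = mostly local_in_F" by (simp add: N_eq)
  have "\<exists>Y\<in>V F f. Y \<in> Z" if X: "X \<in> carrier (N F)" "X \<in> Z" and Z: "openin \<tau> Z" for X Z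
  proof -
    obtain g where g: "X = cls g" "near g" "finite {w \<in> pverts G. \<not> local_in_F g w}"
      using X(1) unfolding carrier mostly_def by blast
    have "continuous_map \<tau> (prod_topology \<tau> \<tau>) (\<lambda>Y. (X, Y))"
      using X(1) top by (simp add: continuous_map_paired)
    then have "continuous_map \<tau> \<tau> ((\<lambda>(x, y). x \<otimes>\<^bsub>N F\<^esub> y) \<circ> (\<lambda>Y. (X, Y)))"
      using mult by (rule continuous_map_compose)
    then have "continuous_map (U_topology F) \<tau> (((\<lambda>(x, y). x \<otimes>\<^bsub>N F\<^esub> y) \<circ> (\<lambda>Y. (X, Y))) \<circ> embed)"
      by (rule continuous_map_compose[OF emb])
    then have cont: "continuous_map (U_topology F) \<tau> (\<lambda>h. X \<otimes>\<^bsub>N F\<^esub> embed h)" by (simp add: comp_def)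
    \<comment> \<open>Translating by \<open>X\<close> turns the approximation of \<open>X\<close>
      into a question about the identity of \<open>U F\<close>: an element of \<open>U F\<close>
      that fixes a large enough finite set moves \<open>X\<close> within \<open>Z\<close>, and
      \<open>correction_ex\<close> finds one that moves it into V_F.\<close>
    let ?S = "{h \<in> topspace (U_topology F). X \<otimes>\<^bsub>N F\<^esub> embed h \<in> Z}"
    have "openin (U_topology F) ?S" by (rule openin_continuous_map_preimage[OF cont Z])
    then obtain S where S: "openin Aut_topology S" "?S = S \<inter> U F"
      unfolding U_topology_def openin_subtopology by blast
    have one: "embed (\<lambda>v\<in>pverts G. v) = \<one>\<^bsub>N F\<^esub>" by (simp add: N_eq AAut_def)
    have "X \<otimes>\<^bsub>N F\<^esub> embed (\<lambda>v\<in>pverts G. v) = X"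
      unfolding one using group.is_monoid[OF N_group] X(1) by (simp add: monoid.r_one)
    then have "(\<lambda>v\<in>pverts G. v) \<in> ?S" using identity_topspace X(2) by simp
    then have "(\<lambda>v\<in>pverts G. v) \<in> S" using S(2) by blast
    then obtain A where A: "finite A" "A \<subseteq> pverts G" "fixator A {} \<subseteq> S" using identity_nhd[OF S(1)] by blast
    obtain h where h: "h \<in> U F" "\<forall>v\<in>A \<inter> pverts G. h v = v" "near (g \<circ> h)"
      "finite {w \<in> pverts G. \<not> canon (g \<circ> h) w}"
      using correction_ex[OF g(2,3) A(1)] by blast
    have hA: "h \<in> Aut" using h(1) by (simp add: U_def)
    then have "h \<in> fixator A {}" using h(2) A(2) by (auto simp: fixator_def)
    then have "h \<in> ?S" using A(3) S(2) h(1) by blast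
    then have "X \<otimes>\<^bsub>N F\<^esub> embed h \<in> Z" by blast
    moreover have "X \<otimes>\<^bsub>N F\<^esub> embed h = cls (g \<circ> h)"
      using g(1) embed_cls[OF hA] cls_mult[OF g(2) Aut_near[OF hA]] by (simp add: N_eq)
    moreover have "cls (g \<circ> h) \<in> V F f" unfolding V_mostly mostly_def using h(3,4) by blast
    ultimately show ?thesis by metis
  qed
  then show ?thesis
    unfolding closure_of_def top by blast
qed

end

theorem theorem4p1:
  fixes G :: "'v pair_pre_digraph" and v0 :: 'v and d :: nat and col :: "'v \<times> 'v \<Rightarrow> nat"
    and F :: "(nat \<Rightarrow> nat) set" and ref :: "nat set \<Rightarrow> nat" and f :: "nat \<Rightarrow> nat \<Rightarrow> nat"
  assumes "d \<ge> 2"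
    and "coloured_regular_tree G v0 d col"
    and "subgroup F (BijGroup {0..d})"
    and "reference_choice d F ref f"
  shows "finitely_generated_subgroup
           (coloured_regular_tree.V G v0 col F f) (coloured_regular_tree.N G v0 d col F)
       \<and> (\<forall>\<tau>. coloured_regular_tree.is_N_topology G v0 d col F \<tau> \<longrightarrow>
            \<tau> closure_of (coloured_regular_tree.V G v0 col F f)
              = carrier (coloured_regular_tree.N G v0 d col F))"
proof -
  interpret typed_tree G v0 d col F ref f
    using assms by (simp add: typed_tree_def typed_tree_axioms_def branching_tree_def branching_tree_axioms_def)
  show ?thesis using V_finitely_generated V_dense by blast
qed

end
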